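(* Let $\Omega\subset\mathbb R^d$ be a bounded, connected, open set admitting the relative isoperimetric inequality. Let $\mathbf m=(m_1,\dots,m_N)\in C^1(\overline\Omega;\mathbb R^N)$ and $A=(a_{ij})\in C^1(\overline\Omega;M_N(\mathbb R))$ satisfy the structural assumptions (S1)--(S3) of the context with some constant $\kappa>0$. Let $p\ge 1$ and let $\mathbf U\subset W^1_p(\Omega;\mathbb R^N)$ be a set of functions such that (i) every $\mathbf u\in\mathbf U$ satisfies $\mathbf u\ge 0$ (that is, all components of $\mathbf u$ are non-negative); (ii) there do not exist a sequence $\{\mathbf u_n=(u_{1n},\dots,u_{Nn})\}\subset\mathbf U$ bounded in the $L^p$ norm and a nonempty index set $I\subset\{1,\dots,N\}$ such that, as $n\to\infty$, $$u_{in}\to 0 \ \text{ in measure on } \Omega\quad\text{for all } i\in I,\qquad f_{kn}\to 0\ \text{ in measure on } \Omega\quad\text{for all } k\notin I,$$ where $f_{kn}=m_k-\sum_{j=1}^N a_{kj}u_{jn}$. Then there exists $C>0$ such that for all $\mathbf u=(u_1,\dots,u_N)\in\mathbf U$, with $f_i=m_i-\sum_{j=1}^N a_{ij}u_j$, $$\int_\Omega\sum_{i=1}^N|f_i|^p\,\mathrm dx\le C\int_\Omega\sum_{i=1}^N u_i\left(|f_i|^p+|\nabla f_i|^p\right)\mathrm dx .$$ (The integrand on the right-hand side is non-negative and the integral on the right may be infinite.)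
   Context: Relative isoperimetric inequality: there is a constant $c_\Omega>0$ such that $P(E;\Omega)\ge c_\Omega|E|^{\frac{d-1}{d}}$ for all Lebesgue measurable $E\subset\Omega$ of locally finite perimeter with $|E|\le\frac12|\Omega|$, where $P(E;\Omega)$ is the relative perimeter of $E$ with respect to $\Omega$ (the total variation in $\Omega$ of the Gauss--Green measure of $E$) and $|\cdot|$ is Lebesgue measure. Structural assumptions on $(A,\mathbf m)$ with constant $\kappa>0$ (independent of $x$), required at every $x\in\overline\Omega$: (S1) $|a_{ij}|\le \frac1\kappa$ for $i,j=1,\dots,N$, and $m_i\le\frac1\kappa$ for $i=1,\dots,N$. (S2) For every $I=\{i_1,\dots,i_r\}\subset\{1,\dots,N\}$, $i_1<\dots<i_r$, $$\begin{vmatrix} a_{i_1i_1}&\cdots&a_{i_1i_r}\\ \vdots&\ddots&\vdots\\ a_{i_ri_1}&\cdots&a_{i_ri_r}\end{vmatrix}\ge\kappa .$$ (S3) For every $I=\{i_1,\dots,i_r\}\subset\{1,\dots,N\}$, $i_1<\dots<i_r$, and every $j\notin I$, $$\begin{vmatrix} a_{i_1i_1}&\cdots&a_{i_1i_r}&m_{i_1}\\ \vdots&\ddots&\vdots&\vdots\\ a_{i_ri_1}&\cdots&a_{i_ri_r}&m_{i_r}\\ a_{ji_1}&\cdots&a_{ji_r}&m_j\end{vmatrix}\ge\kappa$$ (for $I=\varnothing$ this reads $m_j\ge\kappa$; the empty determinant in (S2) equals $1$). The matrix $A$ is not assumed symmetric. $W^1_p(\Omega;\mathbb R^N)$ is the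 usual Sobolev space of functions in $L^p$ with weak gradient in $L^p$. *)

theory Defs
  imports "HOL-Analysis.Analysis"
begin

section \<open>Continuously differentiable functions\<close>

definition support :: "('a::topological_space \<Rightarrow> 'b::zero) \<Rightarrow> 'a set" where
  "support T = closure {x. T x \<noteq> 0}"

text \<open>
  \<open>C\<^sup>1(\<Omega>)\<close>-functions that extend, together with their derivative, continuously to the
  closure of \<open>\<Omega>\<close>.
\<close>

definition C1_closure ::
    "'a::euclidean_space set \<Rightarrow> ('a \<Rightarrow> 'b::real_normed_vector) \<Rightarrow> bool" where
  "C1_closure \<Omega> f \<longleftrightarrow>
     continuous_on (closure \<Omega>) f \<and>
     (\<exists>f' :: 'a \<Rightarrow> 'a \<Rightarrow>\<^sub>L 'b. continuous_on (closure \<Omega>) f' \<and>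
        (\<forall>x\<in>\<Omega>. (f has_derivative blinfun_apply (f' x)) (at x)))"

text \<open>Compactly supported \<open>C\<^sup>1\<close> functions: \<open>C1_closure UNIV\<close> is plain continuous
  differentiability on the whole space.\<close>

definition C1c :: "'a::euclidean_space set \<Rightarrow> ('a \<Rightarrow> 'b::real_normed_vector) set" where
  "C1c \<Omega> = {T. C1_closure UNIV T \<and> compact (support T) \<and> support T \<subseteq> \<Omega>}"

definition divergence :: "('a::euclidean_space \<Rightarrow> 'a) \<Rightarrow> 'a \<Rightarrow> real" where
  "divergence T x = (\<Sum>b\<in>Basis. frechet_derivative T (at x) b \<bullet> b)"

definition gradient :: "('a::euclidean_space \<Rightarrow> real) \<Rightarrow> 'a \<Rightarrow> 'a" where
  "gradient \<phi> x = (\<Sum>b\<in>Basis. frechet_derivative \<phi> (at x) b *\<^sub>R b)"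


section \<open>Perimeter and the relative isoperimetric inequality\<close>

text \<open>
  The Gauss--Green measure \<open>\<mu>\<^sub>E\<close> of \<open>E\<close> is the vector-valued Radon measure with
  \<open>\<integral> T \<bullet> d\<mu>\<^sub>E = \<integral>\<^sub>E div T\<close> for all test fields \<open>T\<close>; it is represented here by this functional
  on test fields. Its total variation in an open set is the supremum of its values at test fields
  supported in that set and bounded by 1 (infinite when no such measure of finite total
  variation exists).
\<close>

definition gauss_green :: "'a::euclidean_space set \<Rightarrow> ('a \<Rightarrow> 'a) \<Rightarrow> real" where
  "gauss_green E T = (LINT x:E|lebesgue. divergence T x)"

definition total_variation ::
    "'a::euclidean_space set \<Rightarrow> (('a \<Rightarrow> 'a) \<Rightarrow> real) \<Rightarrow> ereal" where
  "total_variation V L = (SUP T \<in> {T \<in> C1c V. \<forall>x. norm (T x) \<le> 1}. ereal (L T))"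

definition relative_perimeter :: "'a::euclidean_space set \<Rightarrow> 'a set \<Rightarrow> ereal" where
  "relative_perimeter E \<Omega> = total_variation \<Omega> (gauss_green E)"

text \<open>Local finiteness is understood relative to the ambient open set \<open>\<Omega>\<close>, i.e. nothing is
  required of \<open>E\<close> at the boundary of \<open>\<Omega>\<close>.\<close>

definition locally_finite_perimeter :: "'a::euclidean_space set \<Rightarrow> 'a set \<Rightarrow> bool" where
  "locally_finite_perimeter E \<Omega> \<longleftrightarrow>
     (\<forall>V. open V \<and> compact (closure V) \<and> closure V \<subseteq> \<Omega> \<longrightarrow> relative_perimeter E V < \<infinity>)"

text \<open>For a null set in dimension 1 the convention \<open>0 powr 0 = 0\<close> is the intended one, as the
  perimeter of a null set vanishes.\<close>

definition relative_isoperimetric :: "'a::euclidean_space set \<Rightarrow> bool" where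
  "relative_isoperimetric \<Omega> \<longleftrightarrow>
     (\<exists>c>0. \<forall>E\<in>sets lebesgue.
        E \<subseteq> \<Omega> \<and> locally_finite_perimeter E \<Omega> \<and> measure lebesgue E \<le> measure lebesgue \<Omega> / 2 \<longrightarrow>
        ereal (c * measure lebesgue E powr ((real DIM('a) - 1) / real DIM('a)))
          \<le> relative_perimeter E \<Omega>)"


section \<open>Sobolev functions and convergence in measure\<close>

definition Lp :: "'a::euclidean_space set \<Rightarrow> real \<Rightarrow> ('a \<Rightarrow> 'b::euclidean_space) set" where
  "Lp \<Omega> p = {f. f \<in> borel_measurable (lebesgue_on \<Omega>) \<and>
                 integrable (lebesgue_on \<Omega>) (\<lambda>x. norm (f x) powr p)}"

definition Lp_norm ::
    "'a::euclidean_space set \<Rightarrow> real \<Rightarrow> ('a \<Rightarrow> 'b::euclidean_space) \<Rightarrow> real" where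
  "Lp_norm \<Omega> p f = (LINT x|lebesgue_on \<Omega>. norm (f x) powr p) powr (1 / p)"

definition locally_integrable ::
    "'a::euclidean_space set \<Rightarrow> ('a \<Rightarrow> 'b::euclidean_space) \<Rightarrow> bool" where
  "locally_integrable \<Omega> f \<longleftrightarrow> (\<forall>K. compact K \<and> K \<subseteq> \<Omega> \<longrightarrow> set_integrable lebesgue K f)"

text \<open>Test functions are \<open>C\<^sup>1\<close> with compact support; by mollification this agrees with the version
  using smooth test functions.\<close>

definition has_weak_gradient ::
    "'a::euclidean_space set \<Rightarrow> ('a \<Rightarrow> real) \<Rightarrow> ('a \<Rightarrow> 'a) \<Rightarrow> bool" where
  "has_weak_gradient \<Omega> f g \<longleftrightarrow>
     locally_integrable \<Omega> f \<and> locally_integrable \<Omega> g \<and>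
     (\<forall>\<phi>\<in>C1c \<Omega>. (LINT x|lebesgue_on \<Omega>. f x *\<^sub>R gradient \<phi> x)
                   = - (LINT x|lebesgue_on \<Omega>. \<phi> x *\<^sub>R g x))"

text \<open>The weak gradient is determined up to null sets; this picks a representative.\<close>

definition weak_gradient :: "'a::euclidean_space set \<Rightarrow> ('a \<Rightarrow> real) \<Rightarrow> 'a \<Rightarrow> 'a" where
  "weak_gradient \<Omega> f = (SOME g. has_weak_gradient \<Omega> f g)"

text \<open>Elements are representatives; only their values in \<open>\<Omega>\<close> matter.\<close>

definition sobolev_W1 :: "'a::euclidean_space set \<Rightarrow> real \<Rightarrow> ('a \<Rightarrow> real ^ 'n) set" where
  "sobolev_W1 \<Omega> p =
     {u. u \<in> Lp \<Omega> p \<and> (\<forall>i. \<exists>g. has_weak_gradient \<Omega> (\<lambda>x. u x $ i) g \<and> g \<in> Lp \<Omega> p)}"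

definition tendsto_in_measure ::
    "'a::euclidean_space set \<Rightarrow> (nat \<Rightarrow> 'a \<Rightarrow> real) \<Rightarrow> ('a \<Rightarrow> real) \<Rightarrow> bool" where
  "tendsto_in_measure \<Omega> g h \<longleftrightarrow>
     (\<forall>\<epsilon>>0. (\<lambda>n. measure lebesgue {x\<in>\<Omega>. \<bar>g n x - h x\<bar> > \<epsilon>}) \<longlonglongrightarrow> 0)"


section \<open>Structural assumptions\<close>

text \<open>
  Determinant of the matrix \<open>(M i j)\<close> with rows and columns indexed by the finite set \<open>I\<close>.
  Renumbering rows and columns simultaneously does not change it, so no order on \<open>I\<close> is needed;
  this is the content of \<open>det_on_reindex\<close>.
\<close>

definition det_on :: "'n set \<Rightarrow> ('n \<Rightarrow> 'n \<Rightarrow> real) \<Rightarrow> real" where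
  "det_on I M = (\<Sum>p | p permutes I. of_int (sign p) * (\<Prod>i\<in>I. M i (p i)))"

lemma det_eq_det_on: "det A = det_on UNIV (\<lambda>i j. A $ i $ j)"
  by (simp add: det_def det_on_def)

lemma det_on_reindex:
  assumes "finite J" and e: "bij_betw e J I"
  shows "det_on I M = det_on J (\<lambda>k l. M (e k) (e l))"
proof -
  have inj: "inj_on e J" and I: "I = e ` J"
    using e by (auto simp: bij_betw_def)
  have I': "bij_betw (inv_into J e) I J" and inj': "inj_on (inv_into J e) I"
    using bij_betw_inv_into[OF e] by (auto simp: bij_betw_def)
  have inv: "bij_betw (map_permutation J e) {p. p permutes J} {p. p permutes I}"
  proof (rule bij_betw_byWitness[where f' = "map_permutation I (inv_into J e)"])
    show "\<forall>p\<in>{p. p permutes J}. map_permutation I (inv_into J e) (map_permutation J e p) = p"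
      using e inj by (auto intro!: map_permutation_compose_inv simp: inv_into_f_f)
    show "\<forall>p\<in>{p. p permutes I}. map_permutation J e (map_permutation I (inv_into J e) p) = p"
      using I' I by (auto intro!: map_permutation_compose_inv simp: f_inv_into_f)
    show "map_permutation J e ` {p. p permutes J} \<subseteq> {p. p permutes I}"
      using e by (auto intro!: map_permutation_permutes)
    show "map_permutation I (inv_into J e) ` {p. p permutes I} \<subseteq> {p. p permutes J}"
      using I' by (auto intro!: map_permutation_permutes)
  qed
  have "det_on I M = (\<Sum>p | p permutes J. of_int (sign (map_permutation J e p)) *
                        (\<Prod>i\<in>I. M i (map_permutation J e p i)))"
    unfolding det_on_def by (rule sum.reindex_bij_betw[OF inv, symmetric])
  also have "\<dots> = det_on J (\<lambda>k l. M (e k) (e l))"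
    unfolding det_on_def
    by (rule sum.cong)
      (auto simp: I prod.reindex[OF inj] sign_map_permutation[OF inj _ \<open>finite J\<close>]
                  map_permutation_apply[OF inj] intro!: prod.cong)
  finally show ?thesis .
qed

text \<open>
  In (S3) the matrix has rows \<open>I \<union> {j}\<close>; its columns are those of \<open>A\<close> for \<open>I\<close>, and the vector
  \<open>m\<close> as the column with index \<open>j\<close>. Both \<open>j\<close>-indexed lines are the last ones in the display.
\<close>

definition structural :: "real \<Rightarrow> real ^ 'n ^ 'n \<Rightarrow> real ^ 'n \<Rightarrow> bool" where
  "structural \<kappa> a m \<longleftrightarrow>
     (\<forall>i j. \<bar>a $ i $ j\<bar> \<le> 1 / \<kappa>) \<and> (\<forall>i. m $ i \<le> 1 / \<kappa>) \<and>
     (\<forall>I. det_on I (\<lambda>k l. a $ k $ l) \<ge> \<kappa>) \<and>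
     (\<forall>I j. j \<notin> I \<longrightarrow> det_on (insert j I) (\<lambda>k l. if l = j then m $ k else a $ k $ l) \<ge> \<kappa>)"

definition fitness ::
    "('a \<Rightarrow> real ^ 'n) \<Rightarrow> ('a \<Rightarrow> real ^ 'n ^ 'n) \<Rightarrow> ('a \<Rightarrow> real ^ 'n) \<Rightarrow> 'n \<Rightarrow> 'a \<Rightarrow> real" where
  "fitness m A u i x = m x $ i - (\<Sum>j\<in>UNIV. A x $ i $ j * u x $ j)"

end

theory Submission
  imports Defs
begin

text \<open>
  Call the integrand on the right-hand side the dissipation, and let \<open>D\<close> be its integral.
  Where the dissipation vanishes, \<open>u\<^sub>i f\<^sub>i = 0\<close> for all \<open>i\<close>. By Cramer's rule, (S2) and (S3) then say
  that \<open>u\<close> is one of \<open>2\<^sup>N\<close> isolated steady states: for some index set \<open>K\<close>, \<open>f\<^sub>i = 0 < u\<^sub>i\<close> for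
  \<open>i \<in> K\<close>, and \<open>u\<^sub>i = 0 < f\<^sub>i\<close> for the other \<open>i\<close>. Near the state \<open>K = UNIV\<close> every \<open>u\<^sub>i\<close> is
  bounded below and the dissipation dominates \<open>\<bar>f\<^sub>i\<bar>\<^sup>p\<close>, so the task is to show that \<open>u\<close> stays close
  to one and the same state throughout \<open>\<Omega>\<close>, and to exclude the states \<open>K \<noteq> UNIV\<close>.

  Let \<open>E\<^sub>K\<close> be the region where \<open>\<bar>f\<^sub>i\<bar> \<le> t\<close> for \<open>i \<in> K\<close> and \<open>f\<^sub>i > t\<close> for \<open>i \<notin> K\<close>. On its boundary some
  \<open>\<bar>f\<^sub>i\<bar>\<close> equals \<open>t\<close> and all \<open>f\<^sub>j\<close> are at least \<open>- t\<close>. The decisive algebraic fact is that \<open>u\<^sub>i\<close> is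
  bounded below there (\<open>component_lower_bound\<close>), even far from all steady states: the steady states
  are the vertices of the polytope \<open>{u. u \<ge> 0 \<and> m - A u \<ge> 0}\<close>, and a linear function such as \<open>f\<^sub>i\<close> on
  the face \<open>u\<^sub>i = 0\<close> is positive because it is positive at the vertices of that face
  (\<open>residual_pos_outside_support\<close>). Hence the dissipation controls \<open>\<nabla>f\<^sub>i\<close> exactly where it matters for
  the perimeter, and some level \<open>t\<close> in a fixed interval makes the perimeters of all \<open>E\<^sub>K\<close> at most a
  multiple of \<open>D\<close> (\<open>gauss_green_level_region_le\<close>). By the relative isoperimetric inequality each \<open>E\<^sub>K\<close>
  or its complement has measure at most a multiple of \<open>D\<close>. The regions cover all of \<open>\<Omega>\<close> but a set
  where the dissipation is bounded below, so one of them fills \<open>\<Omega>\<close> up to measure \<open>C D\<close>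
  (\<open>state_selection\<close>).

  If that region has \<open>K = UNIV\<close>, the inequality follows by integrating pointwise bounds. If
  \<open>K \<noteq> UNIV\<close>, then \<open>D\<close> is bounded below: otherwise a sequence with \<open>D \<rightarrow> 0\<close> and constant \<open>K\<close> would be
  of the kind that hypothesis (ii) forbids, with \<open>I\<close> the complement of \<open>K\<close>
  (\<open>mixed_state_dissipation_lower_bound\<close>). A lower bound on \<open>D\<close> suffices, because the sum of the
  \<open>\<bar>f\<^sub>i\<bar>\<^sup>p\<close> is at most \<open>C\<close> plus \<open>C\<close> times the dissipation (\<open>residual_powr_le\<close>).

  The perimeter estimate rests on a chain rule for \<open>H(f\<^sub>1, \<dots>, f\<^sub>N)\<close> with weakly differentiable \<open>f\<^sub>i\<close>,
  proved by mollification (\<open>weak_chain_rule\<close>). It is applied to smoothed indicators of \<open>E\<^sub>K\<close> at a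
  level where a monotone function of \<open>t\<close> has difference quotients at most its average slope
  (\<open>exists_slope_le_average\<close>); this takes the place of the coarea formula.
\<close>

section \<open>Matrices with positive principal minors\<close>

text \<open>
  Padding a principal submatrix with the identity keeps its determinant and yields a matrix of the
  full type, to which the theorems on \<open>det\<close> and \<open>invertible\<close> apply.
\<close>

definition minor_matrix :: "'n::finite set \<Rightarrow> ('n \<Rightarrow> 'n \<Rightarrow> real) \<Rightarrow> real ^ 'n ^ 'n" where
  "minor_matrix J M = (\<chi> k l. if k \<in> J \<and> l \<in> J then M k l else if k = l then 1 else 0)"

lemma det_minor_matrix: "det (minor_matrix J M) = det_on J M"
proof -
  let ?t = "\<lambda>p. of_int (sign p) * (\<Prod>k\<in>UNIV. minor_matrix J M $ k $ p k) :: real"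
  have z: "?t p = 0" if p: "p permutes UNIV" "\<not> p permutes J" for p
  proof -
    obtain k where k: "k \<notin> J" "p k \<noteq> k"
      using p by (auto simp: permutes_def)
    have "minor_matrix J M $ k $ p k = 0"
      using k by (auto simp: minor_matrix_def)
    then show ?thesis by (auto intro!: prod_zero)
  qed
  have e: "(\<Prod>k\<in>UNIV. minor_matrix J M $ k $ p k) = (\<Prod>k\<in>J. M k (p k))" if p: "p permutes J" for p
  proof -
    have "(\<Prod>k\<in>UNIV. minor_matrix J M $ k $ p k) = (\<Prod>k\<in>J. minor_matrix J M $ k $ p k)"
      by (rule prod.mono_neutral_right) (auto simp: minor_matrix_def permutes_not_in[OF p])
    also have "\<dots> = (\<Prod>k\<in>J. M k (p k))"
      by (rule prod.cong) (auto simp: minor_matrix_def permutes_in_image[OF p])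
    finally show ?thesis .
  qed
  have "det (minor_matrix J M) = (\<Sum>p | p permutes UNIV. ?t p)"
    by (simp add: det_def)
  also have "\<dots> = (\<Sum>p | p permutes J. ?t p)"
    by (rule sum.mono_neutral_right) (auto simp: z finite_permutations intro: permutes_subset)
  also have "\<dots> = det_on J M"
    unfolding det_on_def by (rule sum.cong) (auto simp: e)
  finally show ?thesis .
qed

text \<open>
  The changed entry occurs only in the summands of permutations that fix \<open>i\<close>, and these are the
  permutations of \<open>J - {i}\<close>.
\<close>

lemma det_on_add_diagonal:
  fixes J :: "'n::finite set"
  shows "det_on J (\<lambda>k l. M k l + (if k = i \<and> l = i then d else 0)) =
    det_on J M + (if i \<in> J then d * det_on (J - {i}) M else 0)"
proof (cases "i \<in> J")
  case False
  have "(\<Prod>k\<in>J. M k (p k) + (if k = i \<and> p k = i then d else 0)) = (\<Prod>k\<in>J. M k (p k))" for p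
    using False by (intro prod.cong) auto
  then show ?thesis using False by (simp add: det_on_def)
next
  case True
  have eq: "(\<Prod>k\<in>J. M k (p k) + (if k = i \<and> p k = i then d else 0)) =
     (\<Prod>k\<in>J. M k (p k)) + (if p i = i then d * (\<Prod>k\<in>J-{i}. M k (p k)) else 0)" for p
  proof -
    have "(\<Prod>k\<in>J. M k (p k) + (if k = i \<and> p k = i then d else 0)) =
      (M i (p i) + (if p i = i then d else 0)) * (\<Prod>k\<in>J-{i}. M k (p k) + (if k = i \<and> p k = i then d else 0))"
      using True by (subst prod.remove[of J i]) auto
    also have "(\<Prod>k\<in>J-{i}. M k (p k) + (if k = i \<and> p k = i then d else 0)) = (\<Prod>k\<in>J-{i}. M k (p k))"
      by (rule prod.cong) auto
    finally show ?thesis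
      using True by (subst (2) prod.remove[of J i]) (auto simp: algebra_simps)
  qed
  have s: "{p. p permutes J - {i}} = {p \<in> {p. p permutes J}. p i = i}"
    using True by (auto simp: permutes_def)
  have "(\<Sum>p | p permutes J. of_int (sign p) * (if p i = i then d * (\<Prod>k\<in>J-{i}. M k (p k)) else 0))
     = d * det_on (J - {i}) M"
    unfolding det_on_def s sum_distrib_left
    by (rule sum.mono_neutral_cong_right) (auto simp: finite_permutations)
  then show ?thesis
    using True by (simp add: det_on_def eq distrib_left sum.distrib)
qed

lemma det_on_add_diag_pos:
  fixes J S :: "'n::finite set"
  assumes "\<And>J. det_on J M > 0" "\<And>i. d i \<ge> 0"
  shows "det_on J (\<lambda>k l. M k l + (if k = l \<and> k \<in> S then d k else 0)) > 0"
proof -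
  have "finite S" by simp
  then show ?thesis
  proof (induction S arbitrary: J)
    case empty
    then show ?case using assms(1) by simp
  next
    case (insert i S)
    let ?M = "\<lambda>k l. M k l + (if k = l \<and> k \<in> S then d k else 0)"
    have "(\<lambda>k l. M k l + (if k = l \<and> k \<in> insert i S then d k else 0)) =
      (\<lambda>k l. ?M k l + (if k = i \<and> l = i then d i else 0))"
      using insert by (intro ext) auto
    then have "det_on J (\<lambda>k l. M k l + (if k = l \<and> k \<in> insert i S then d k else 0)) =
       det_on J ?M + (if i \<in> J then d i * det_on (J - {i}) ?M else 0)"
      by (simp only: det_on_add_diagonal)
    moreover have "det_on J ?M > 0" "det_on (J - {i}) ?M > 0"
      using insert by blast+
    ultimately show ?case using assms(2)[of i]
      by (smt (verit) mult_nonneg_nonneg)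
  qed
qed

lemma minor_matrix_mult:
  "(minor_matrix J M *v x) $ k = (if k \<in> J then \<Sum>l\<in>J. M k l * x $ l else x $ k)"
proof (cases "k \<in> J")
  case True
  have "(minor_matrix J M *v x) $ k = (\<Sum>l\<in>UNIV. minor_matrix J M $ k $ l * x $ l)"
    by (simp add: matrix_vector_mult_def)
  also have "\<dots> = (\<Sum>l\<in>J. M k l * x $ l)"
    using True by (intro sum.mono_neutral_cong_right) (auto simp: minor_matrix_def)
  finally show ?thesis using True by simp
next
  case False
  have "(minor_matrix J M *v x) $ k = (\<Sum>l\<in>UNIV. minor_matrix J M $ k $ l * x $ l)"
    by (simp add: matrix_vector_mult_def)
  also have "\<dots> = (\<Sum>l\<in>UNIV. if k = l then x $ l else 0)"
    using False by (intro sum.cong) (auto simp: minor_matrix_def)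
  finally show ?thesis using False by simp
qed

lemma det_on_nonzero_solve:
  fixes M :: "'n::finite \<Rightarrow> 'n \<Rightarrow> real"
  assumes "det_on J M \<noteq> 0"
  obtains x :: "'n \<Rightarrow> real" where "\<And>k. k \<in> J \<Longrightarrow> (\<Sum>l\<in>J. M k l * x l) = b k" "\<And>k. k \<notin> J \<Longrightarrow> x k = 0"
proof -
  have "invertible (minor_matrix J M)"
    using assms by (simp add: invertible_det_nz det_minor_matrix)
  then obtain B where B: "minor_matrix J M ** B = mat 1"
    by (auto simp: invertible_def)
  define x where "x = B *v (\<chi> k. if k \<in> J then b k else 0)"
  have x: "minor_matrix J M *v x = (\<chi> k. if k \<in> J then b k else 0)"
    by (simp add: x_def matrix_vector_mul_assoc B)
  have "(\<Sum>l\<in>J. M k l * x $ l) = b k" if "k \<in> J" for k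
    using arg_cong[OF x, of "\<lambda>v. v $ k"] that by (simp add: minor_matrix_mult)
  moreover have "x $ k = 0" if "k \<notin> J" for k
    using arg_cong[OF x, of "\<lambda>v. v $ k"] that by (simp add: minor_matrix_mult)
  ultimately show ?thesis using that[of "\<lambda>k. x $ k"] by blast
qed

lemma det_on_nonzero_injective:
  fixes M :: "'n::finite \<Rightarrow> 'n \<Rightarrow> real"
  assumes "det_on J M \<noteq> 0" "\<And>k. k \<in> J \<Longrightarrow> (\<Sum>l\<in>J. M k l * x l) = 0" "k \<in> J"
  shows "x k = 0"
proof -
  define y :: "real ^ 'n" where "y = (\<chi> k. if k \<in> J then x k else 0)"
  have "invertible (minor_matrix J M)"
    using assms by (simp add: invertible_det_nz det_minor_matrix)
  moreover have "minor_matrix J M *v y = 0"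
    using assms(2) by (simp add: vec_eq_iff minor_matrix_mult) (simp add: y_def)
  ultimately have "y = 0"
    by (metis invertible_def matrix_left_invertible_ker)
  then have "y $ k = 0" by simp
  then show ?thesis using assms(3) by (simp add: y_def)
qed

lemma det_on_transpose:
  "det_on J (\<lambda>k l. M l k) = det_on J (M :: 'n::finite \<Rightarrow> 'n \<Rightarrow> real)"
proof -
  have "minor_matrix J (\<lambda>k l. M l k) = transpose (minor_matrix J M)"
    by (auto simp: minor_matrix_def transpose_def vec_eq_iff)
  then show ?thesis
    by (metis det_minor_matrix det_transpose)
qed

text \<open>
  The characteristic property of P-matrices, for nonnegative vectors. If all the products were
  nonpositive, then \<open>d i = - (M u)\<^sub>i / u\<^sub>i\<close> would be a nonnegative diagonal on the support \<open>J\<close> of \<open>u\<close>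
  with \<open>(M + d) u = 0\<close> there. But the principal minors stay positive when such a diagonal is added.
\<close>

lemma positive_minors_complementarity:
  fixes M :: "'n::finite \<Rightarrow> 'n \<Rightarrow> real" and u :: "'n \<Rightarrow> real"
  assumes pos: "\<And>J. det_on J M > 0" and u: "\<And>i. u i \<ge> 0" "u j > 0"
  shows "\<exists>i. u i * (\<Sum>l\<in>UNIV. M i l * u l) > 0"
proof (rule ccontr)
  assume "\<not> ?thesis"
  then have neg: "u i * (\<Sum>l\<in>UNIV. M i l * u l) \<le> 0" for i
    by (meson linorder_not_le)
  define J where "J = {i. u i > 0}"
  define s where "s i = (\<Sum>l\<in>UNIV. M i l * u l)" for i
  have s: "s i = (\<Sum>l\<in>J. M i l * u l)" for i
    unfolding s_def J_def using u(1) by (intro sum.mono_neutral_right) (auto simp: order.order_iff_strict)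
  define d where "d i = (if i \<in> J then - s i / u i else 0)" for i
  have d: "d i \<ge> 0" for i
    using neg[of i] by (auto simp: d_def J_def s_def[symmetric] mult_le_0_iff divide_nonpos_pos)
  have "det_on J (\<lambda>k l. M k l + (if k = l \<and> k \<in> J then d k else 0)) > 0"
    by (rule det_on_add_diag_pos[OF pos d])
  moreover have "(\<Sum>l\<in>J. (M k l + (if k = l \<and> k \<in> J then d k else 0)) * u l) = 0" if k: "k \<in> J" for k
  proof -
    have "(\<Sum>l\<in>J. (M k l + (if k = l \<and> k \<in> J then d k else 0)) * u l) =
      (\<Sum>l\<in>J. M k l * u l) + (\<Sum>l\<in>J. if k = l then d k * u k else 0)"
      using k by (subst sum.distrib[symmetric]) (auto intro!: sum.cong simp: algebra_simps)
    also have "\<dots> = s k + d k * u k" using k by (simp add: s)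
    also have "\<dots> = 0" using k by (simp add: d_def J_def)
    finally show ?thesis .
  qed
  ultimately have "u j = 0"
    using det_on_nonzero_injective[of J "\<lambda>k l. M k l + (if k = l \<and> k \<in> J then d k else 0)" u j] u(2)
    by (simp add: J_def)
  then show False using u by simp
qed

text \<open>
  The matrix of (S3). Subtracting from row \<open>i\<close> the combination \<open>c\<close> of the rows in \<open>J\<close> leaves one
  nonzero entry in that row, the one in column \<open>i\<close>.
\<close>

lemma det_on_bordered:
  fixes M :: "'n::finite \<Rightarrow> 'n \<Rightarrow> real"
  assumes i: "i \<notin> J" and c: "\<And>l. l \<in> J \<Longrightarrow> (\<Sum>j\<in>J. c j * M j l) = M i l"
  shows "det_on (insert i J) (\<lambda>k l. if l = i then m k else M k l) =
    (m i - (\<Sum>j\<in>J. c j * m j)) * det_on J M"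
proof -
  define W where "W = (\<lambda>k l. if l = i then m k else M k l)"
  define r where "r = m i - (\<Sum>j\<in>J. c j * m j)"
  define B where "B = minor_matrix (insert i J) W"
  define x where "x = (\<Sum>j\<in>J. (- c j) *s row j B)"
  have "x \<in> vec.span {row j B |j. j \<noteq> i}"
    unfolding x_def using i by (intro vec.span_sum vec.span_scale vec.span_base) auto
  then have d1: "det (\<chi> k. if k = i then row i B + x else row k B) = det B"
    by (rule det_row_span)
  have ri: "row i B + x = r *s axis i 1"
  proof -
    have "(row i B + x) $ l = r * (if l = i then 1 else 0)" for l
    proof -
      have xl: "x $ l = - (\<Sum>j\<in>J. c j * B $ j $ l)"
        by (simp add: x_def row_def sum_negf)
      have "(row i B + x) $ l = B $ i $ l - (\<Sum>j\<in>J. c j * B $ j $ l)"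
        by (simp add: xl) (simp add: row_def)
      also have "\<dots> = r * (if l = i then 1 else 0)"
      proof -
        consider "l = i" | "l \<in> J" "l \<noteq> i" | "l \<notin> J" "l \<noteq> i" using i by auto
        then show ?thesis
        proof cases
          case 1
          then show ?thesis by (simp add: B_def minor_matrix_def W_def r_def)
        next
          case 2
          then show ?thesis using c[of l] by (simp add: B_def minor_matrix_def W_def)
        next
          case 3
          then have "(\<Sum>j\<in>J. c j * B $ j $ l) = 0"
            by (intro sum.neutral) (auto simp: B_def minor_matrix_def)
          then show ?thesis using 3 by (simp add: B_def minor_matrix_def)
        qed
      qed
      finally show ?thesis .
    qed
    then show ?thesis by (auto simp: vec_eq_iff axis_def)
  qed
  have d2: "det (\<chi> k. if k = i then r *s axis i 1 else row k B) =
     r * det (\<chi> k. if k = i then axis i 1 else row k B)"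
    by (rule det_row_mul)
  have d3: "det (\<chi> k. if k = i then axis i 1 else row k B) = det (minor_matrix J M)"
    unfolding det_def
  proof (rule sum.cong)
    fix p :: "'n \<Rightarrow> 'n" assume "p \<in> {p. p permutes UNIV}"
    then have p: "inj p" by (auto simp: permutes_inj)
    have "(\<Prod>k\<in>UNIV. (\<chi> k. if k = i then axis i 1 else row k B) $ k $ p k) =
       (\<Prod>k\<in>UNIV. minor_matrix J M $ k $ p k)"
    proof (cases "p i = i")
      case True
      show ?thesis
      proof (rule prod.cong)
        fix k
        have "k \<noteq> i \<Longrightarrow> p k \<noteq> i" using True p by (metis injD)
        then show "(\<chi> k. if k = i then axis i 1 else row k B) $ k $ p k = minor_matrix J M $ k $ p k"
          using i True by (auto simp: B_def minor_matrix_def row_def W_def axis_def)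
      qed simp
    next
      case False
      then have "(\<chi> k. if k = i then axis i 1 else row k B) $ i $ p i = 0"
        by (simp add: axis_def)
      moreover have "minor_matrix J M $ i $ p i = 0"
        using False i by (simp add: minor_matrix_def)
      ultimately show ?thesis
        by (metis (no_types, lifting) UNIV_I finite_class.finite_UNIV prod_zero)
    qed
    then show "of_int (sign p) * (\<Prod>k\<in>UNIV. (\<chi> k. if k = i then axis i 1 else row k B) $ k $ p k) =
      of_int (sign p) * (\<Prod>k\<in>UNIV. minor_matrix J M $ k $ p k)" by simp
  qed simp
  have "det_on (insert i J) W = det B" by (simp add: B_def det_minor_matrix)
  also have "\<dots> = r * det_on J M"
    using d1[unfolded ri] d2 d3 by (simp only: det_minor_matrix)
  finally show ?thesis by (simp add: W_def r_def)
qed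


section \<open>Steady states and uniform bounds\<close>

text \<open>
  The value of \<open>f\<^sub>i\<close> at a single point, where \<open>A\<close>, \<open>m\<close> and \<open>u\<close> have the values \<open>a\<close>, \<open>m\<close> and \<open>u\<close>.
\<close>

abbreviation residual :: "real ^ 'n ^ 'n \<Rightarrow> real ^ 'n \<Rightarrow> real ^ 'n \<Rightarrow> 'n::finite \<Rightarrow> real" where
  "residual a m u i \<equiv> m $ i - (a *v u) $ i"

lemma fitness_eq_residual: "fitness m A u i x = residual (A x) (m x) (u x) i"
  by (simp add: fitness_def matrix_vector_mult_def)

text \<open>
  This is (S3) for the empty index set. It supplies the lower bound on \<open>m\<close> that makes the set of
  admissible pairs \<open>(a, m)\<close> bounded.
\<close>

lemma structural_m_lower:
  assumes "structural \<kappa> a m" shows "\<kappa> \<le> m $ j"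
proof -
  have "det_on {j} (\<lambda>k l. if l = j then m $ k else a $ k $ l) = m $ j"
    by (simp add: det_on_def)
  moreover have "det_on (insert j {}) (\<lambda>k l. if l = j then m $ k else a $ k $ l) \<ge> \<kappa>"
    using assms unfolding structural_def by blast
  ultimately show ?thesis by simp
qed

lemma continuous_on_det_on [continuous_intros]:
  "(\<And>k l. continuous_on S (\<lambda>z. M z k l)) \<Longrightarrow> continuous_on S (\<lambda>z. det_on I (M z))"
  unfolding det_on_def by (intro continuous_intros) auto

text \<open>
  The admissible pairs form a compact set that depends on \<open>\<kappa>\<close> alone. The constants below are minima
  of positive continuous functions on compact sets built from it, hence uniform in the point of \<open>\<Omega>\<close>.
\<close>

lemma compact_structural:
  assumes "\<kappa> > 0"
  shows "compact {z :: (real ^ 'n ^ 'n) \<times> (real ^ 'n::finite). structural \<kappa> (fst z) (snd z)}" (is "compact ?S")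
proof -
  have imp: "closed {z. P \<longrightarrow> Q z}" if "closed {z. Q z}" for P and Q :: "(real ^ 'n ^ 'n) \<times> (real ^ 'n) \<Rightarrow> bool"
    using that by (cases P) auto
  have cont: "continuous_on UNIV (\<lambda>z :: (real ^ 'n ^ 'n) \<times> (real ^ 'n). if l = j then snd z $ k else fst z $ k $ l)" for j k l
    by (cases "l = j") (auto intro!: continuous_intros)
  have "closed ?S"
    unfolding structural_def
    by (intro closed_Collect_conj closed_Collect_all imp closed_Collect_le continuous_intros cont)
  moreover have "bounded ?S"
  proof -
    have "norm z \<le> (\<Sum>i\<in>(UNIV::'n set). \<Sum>j\<in>(UNIV::'n set). 1 / \<kappa>) + (\<Sum>i\<in>(UNIV::'n set). 1 / \<kappa>)" if z: "z \<in> ?S" for z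
    proof -
      obtain a m where am: "z = (a, m)" by force
      with z have s: "structural \<kappa> a m" by simp
      have m: "\<bar>m $ i\<bar> \<le> 1 / \<kappa>" for i
        using structural_m_lower[OF s, of i] s assms unfolding structural_def
        by (smt (verit))
      have a: "\<bar>a $ i $ j\<bar> \<le> 1 / \<kappa>" for i j
        using s by (simp add: structural_def)
      have "norm z \<le> norm a + norm m" by (simp add: am norm_Pair_le)
      also have "norm a \<le> (\<Sum>i\<in>UNIV. norm (a $ i))" unfolding norm_vec_def by (rule L2_set_le_sum) auto
      also have "\<dots> \<le> (\<Sum>i\<in>(UNIV::'n set). \<Sum>j\<in>(UNIV::'n set). 1 / \<kappa>)"
        by (intro sum_mono order_trans[OF norm_le_l1_cart]) (use a in auto)
      also have "norm m \<le> (\<Sum>i\<in>UNIV. \<bar>m $ i\<bar>)" by (rule norm_le_l1_cart)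
      also have "\<dots> \<le> (\<Sum>i\<in>(UNIV::'n set). 1 / \<kappa>)" by (intro sum_mono m)
      finally show ?thesis by simp
    qed
    then show ?thesis unfolding bounded_iff by blast
  qed
  ultimately show ?thesis by (simp add: compact_eq_bounded_closed)
qed

lemma compact_imp_pos_lower_bound:
  fixes f :: "'a::topological_space \<Rightarrow> real"
  assumes "compact S" "continuous_on S f" "\<And>x. x \<in> S \<Longrightarrow> f x > 0"
  shows "\<exists>e>0. \<forall>x\<in>S. f x \<ge> e"
proof (cases "S = {}")
  case False
  then show ?thesis using continuous_attains_inf[OF assms(1) _ assms(2)] assms(3) by metis
qed (auto intro!: exI[of _ 1])

lemma structural_det_pos:
  assumes "structural \<kappa> a m" "\<kappa> > 0" shows "det_on I (\<lambda>k l. a $ k $ l) > 0"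
  using assms unfolding structural_def by (meson less_le_trans)

text \<open>
  By homogeneity it suffices to consider unit vectors, where
  \<open>positive_minors_complementarity\<close> and compactness apply.
\<close>

lemma structural_coercive:
  assumes "\<kappa> > 0"
  obtains \<alpha> where "\<alpha> > 0"
    "\<And>a m u. structural \<kappa> a m \<Longrightarrow> (\<And>i. u $ i \<ge> 0) \<Longrightarrow> \<exists>i::'n::finite. u $ i * (a *v u) $ i \<ge> \<alpha> * (norm u)\<^sup>2"
proof -
  let ?S = "{z :: (real ^ 'n ^ 'n) \<times> (real ^ 'n). structural \<kappa> (fst z) (snd z)} \<times>
     {u :: real ^ 'n. norm u = 1 \<and> (\<forall>i. u $ i \<ge> 0)}"
  let ?g = "\<lambda>z :: ((real ^ 'n ^ 'n) \<times> (real ^ 'n)) \<times> (real ^ 'n). \<Sum>i\<in>UNIV. max 0 (snd z $ i * (fst (fst z) *v snd z) $ i)"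
  have "compact {u :: real ^ 'n. norm u = 1 \<and> (\<forall>i. u $ i \<ge> 0)}"
    unfolding compact_eq_bounded_closed
    by (auto intro!: boundedI[where B = 1] closed_Collect_conj closed_Collect_all closed_Collect_le closed_Collect_eq continuous_intros)
  then have c: "compact ?S" by (intro compact_Times compact_structural assms)
  have cont: "continuous_on ?S ?g"
    unfolding matrix_vector_mult_def by (simp, intro continuous_intros)
  have pos: "?g z > 0" if z: "z \<in> ?S" for z
  proof -
    obtain a m u where amu: "z = ((a, m), u)" by (metis prod.collapse)
    with z have s: "structural \<kappa> a m" and u: "norm u = 1" "\<And>i. u $ i \<ge> 0" by auto
    from u(1) have "u \<noteq> 0" by auto
    with u(2) obtain j where j: "u $ j > 0" by (metis order_less_le vec_eq_iff zero_index)
    have "\<exists>i. u $ i * (\<Sum>l\<in>UNIV. a $ i $ l * u $ l) > 0"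
      by (rule positive_minors_complementarity[where j = j]) (use structural_det_pos[OF s assms] u j in auto)
    then obtain i where "u $ i * (a *v u) $ i > 0" by (auto simp: matrix_vector_mult_def)
    then show ?thesis unfolding amu by (intro sum_pos2[of _ i]) auto
  qed
  obtain e where e: "e > 0" "\<And>z. z \<in> ?S \<Longrightarrow> ?g z \<ge> e"
    using compact_imp_pos_lower_bound[OF c cont pos] by blast
  let ?N = "real CARD('n)"
  show ?thesis
  proof (rule that[of "e / ?N"])
    show "e / ?N > 0" using e(1) by simp
    fix a :: "real ^ 'n ^ 'n" and m u :: "real ^ 'n"
    assume s: "structural \<kappa> a m" and u: "\<And>i. u $ i \<ge> 0"
    show "\<exists>i. u $ i * (a *v u) $ i \<ge> e / ?N * (norm u)\<^sup>2"
    proof (cases "u = 0")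
      case False
      define v where "v = (1 / norm u) *\<^sub>R u"
      have uv: "u = norm u *\<^sub>R v" using False by (simp add: v_def)
      have "((a, m), v) \<in> ?S" using s u False by (auto simp: v_def)
      from e(2)[OF this] have ge: "e \<le> (\<Sum>i\<in>UNIV. max 0 (v $ i * (a *v v) $ i))" by simp
      have "\<exists>i. v $ i * (a *v v) $ i \<ge> e / ?N"
      proof (rule ccontr)
        assume "\<not> ?thesis"
        then have "v $ i * (a *v v) $ i < e / ?N" for i by (meson linorder_not_le)
        then have "max 0 (v $ i * (a *v v) $ i) < e / ?N" for i
          using e(1) by simp
        then have "(\<Sum>i\<in>UNIV. max 0 (v $ i * (a *v v) $ i)) < (\<Sum>i\<in>(UNIV::'n set). e / ?N)"
          by (intro sum_strict_mono) auto
        then show False using ge by simp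
      qed
      then obtain i where i: "v $ i * (a *v v) $ i \<ge> e / ?N" by blast
      have "u $ i * (a *v u) $ i = (norm u)\<^sup>2 * (v $ i * (a *v v) $ i)"
        by (subst (1 2) uv) (simp add: matrix_vector_mult_scaleR power2_eq_square)
      then show ?thesis using i
        by (metis mult.commute mult_left_mono zero_le_power2)
    qed (auto intro!: exI)
  qed
qed

text \<open>
  The index \<open>i\<close> from \<open>structural_coercive\<close> has \<open>u\<^sub>i > 0\<close>, so \<open>f\<^sub>i \<ge> -1\<close> bounds \<open>(a u)\<^sub>i\<close>.
\<close>

lemma structural_bounded:
  assumes "\<kappa> > 0"
  obtains R where "R > 0"
    "\<And>a m u. structural \<kappa> a m \<Longrightarrow> (\<And>i::'n::finite. u $ i \<ge> 0) \<Longrightarrow>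
      (\<And>i. u $ i > 0 \<Longrightarrow> residual a m u i \<ge> -1) \<Longrightarrow> norm u \<le> R"
proof -
  obtain \<alpha> where \<alpha>: "\<alpha> > 0"
    "\<And>a m u. structural \<kappa> a m \<Longrightarrow> (\<And>i. u $ i \<ge> 0) \<Longrightarrow> \<exists>i::'n. u $ i * (a *v u) $ i \<ge> \<alpha> * (norm u)\<^sup>2"
    using structural_coercive[OF assms] by blast
  show ?thesis
  proof (rule that[of "(1 / \<kappa> + 1) / \<alpha>"])
    show "(1 / \<kappa> + 1) / \<alpha> > 0" using assms \<alpha>(1) by (simp add: add_pos_pos)
    fix a :: "real ^ 'n ^ 'n" and m and u :: "real ^ 'n"
    assume s: "structural \<kappa> a m" and u: "\<And>i. u $ i \<ge> 0" and f: "\<And>i. u $ i > 0 \<Longrightarrow> residual a m u i \<ge> -1"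
    show "norm u \<le> (1 / \<kappa> + 1) / \<alpha>"
    proof (cases "u = 0")
      case False
      obtain i where i: "u $ i * (a *v u) $ i \<ge> \<alpha> * (norm u)\<^sup>2" using \<alpha>(2)[OF s u] by blast
      have "\<alpha> * (norm u)\<^sup>2 > 0" using \<alpha>(1) False by simp
      then have ui: "u $ i > 0" using i u[of i] by (metis le_less less_le_trans mult_zero_left not_less)
      have "(a *v u) $ i \<le> 1 / \<kappa> + 1"
        using f[OF ui] s unfolding structural_def by (smt (verit))
      then have "u $ i * (a *v u) $ i \<le> u $ i * (1 / \<kappa> + 1)"
        using u[of i] by (rule mult_left_mono)
      also have "\<dots> \<le> norm u * (1 / \<kappa> + 1)"
        using component_le_norm_cart[of u i] assms by (intro mult_right_mono) auto
      finally have "\<alpha> * (norm u * norm u) \<le> (1 / \<kappa> + 1) * norm u"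
        using i by (simp add: power2_eq_square mult.commute)
      then have "\<alpha> * norm u \<le> 1 / \<kappa> + 1" using False by (simp add: mult.assoc[symmetric])
      then show ?thesis using \<alpha>(1) by (simp add: field_simps)
    qed (use assms \<alpha>(1) in auto)
  qed
qed

text \<open>
  If \<open>u\<close> is supported in \<open>J\<close> and \<open>f\<^sub>j = 0\<close> on \<open>J\<close>, the expression is \<open>f\<^sub>i\<close>. It is the quotient of the
  determinants in (S3) and (S2).
\<close>

lemma vertex_residual_pos:
  fixes a :: "real ^ 'n ^ 'n" and m :: "real ^ 'n"
  assumes s: "structural \<kappa> a m" and \<kappa>: "\<kappa> > 0" and i: "i \<notin> J"
    and c: "\<And>l. l \<in> J \<Longrightarrow> (\<Sum>j\<in>J. c j * a $ j $ l) = a $ i $ l"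
  shows "m $ i - (\<Sum>j\<in>J. c j * m $ j) > 0"
proof -
  have "det_on (insert i J) (\<lambda>k l. if l = i then m $ k else a $ k $ l) \<ge> \<kappa>"
    using s i unfolding structural_def by blast
  then have "(m $ i - (\<Sum>j\<in>J. c j * m $ j)) * det_on J (\<lambda>k l. a $ k $ l) > 0"
    using det_on_bordered[OF i, of c "\<lambda>k l. a $ k $ l" "\<lambda>k. m $ k"] c \<kappa> by auto
  then show ?thesis
    using structural_det_pos[OF s \<kappa>, of J] by (simp add: zero_less_mult_iff)
qed

lemma matrix_vector_supported:
  fixes a :: "real ^ 'n ^ 'n"
  assumes "\<And>l. l \<notin> J \<Longrightarrow> u $ l = 0"
  shows "(a *v u) $ i = (\<Sum>l\<in>J. a $ i $ l * u $ l)"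
  unfolding matrix_vector_mult_def using assms by (simp, intro sum.mono_neutral_right) auto

text \<open>
  Minimise the linear function \<open>f\<^sub>i\<close> over the compact polytope of all \<open>u \<ge> 0\<close> that are supported in
  \<open>J\<close> and have \<open>f\<^sub>j \<ge> 0\<close> on \<open>J\<close>. If some \<open>u\<^sub>j\<close>, \<open>j \<in> J\<close>, vanishes at the minimiser, the support shrinks
  and induction applies. Otherwise every positive \<open>f\<^sub>j\<close> can be varied in both directions while the
  other ones are kept, so minimality shows that \<open>f\<^sub>i\<close> does not depend on it. Then \<open>f\<^sub>i\<close> has the value
  that it would have if all \<open>f\<^sub>j\<close> were zero, which is positive by \<open>vertex_residual_pos\<close>.
\<close>

lemma residual_pos_outside_support:
  fixes a :: "real ^ 'n ^ 'n" and m u :: "real ^ 'n"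
  assumes s: "structural \<kappa> a m" and \<kappa>: "\<kappa> > 0"
    and "\<And>j. u $ j \<ge> 0" "\<And>j. j \<notin> J \<Longrightarrow> u $ j = 0" "\<And>j. j \<in> J \<Longrightarrow> residual a m u j \<ge> 0" "i \<notin> J"
  shows "residual a m u i > 0"
proof -
  have "finite J" by simp
  then show ?thesis using assms(3-)
  proof (induction J arbitrary: u rule: finite_psubset_induct)
    case (psubset J)
    let ?Q = "{u :: real ^ 'n. (\<forall>j. u $ j \<ge> 0) \<and> (\<forall>j. j \<notin> J \<longrightarrow> u $ j = 0) \<and> (\<forall>j. j \<in> J \<longrightarrow> residual a m u j \<ge> 0)}"
    have imp: "closed {z. P \<longrightarrow> Q z}" if "closed {z. Q z}" for P and Q :: "real ^ 'n \<Rightarrow> bool"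
      using that by (cases P) auto
    have cont: "continuous_on S (\<lambda>u. (a *v u) $ j)" for S j
      unfolding matrix_vector_mult_def by (simp, intro continuous_intros)
    have cl: "closed ?Q"
      by (intro closed_Collect_conj closed_Collect_all imp closed_Collect_le closed_Collect_eq continuous_intros cont)
    obtain R where R: "\<And>u. (\<And>i::'n. u $ i \<ge> 0) \<Longrightarrow> (\<And>i. u $ i > 0 \<Longrightarrow> residual a m u i \<ge> -1) \<Longrightarrow> norm u \<le> R"
      using structural_bounded[OF \<kappa>] s by (metis (no_types))
    have "bounded ?Q"
      unfolding bounded_iff
    proof (intro exI ballI)
      fix x assume x: "x \<in> ?Q"
      have "residual a m x j \<ge> -1" if "x $ j > 0" for j
      proof -
        have "j \<in> J" using x that by force
        then have "residual a m x j \<ge> 0" using x by blast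
        then show ?thesis by linarith
      qed
      then show "norm x \<le> R" using x by (intro R) auto
    qed
    with cl have "compact ?Q" by (simp add: compact_eq_bounded_closed)
    moreover have uQ: "u \<in> ?Q" using psubset by auto
    moreover have "continuous_on ?Q (\<lambda>u. residual a m u i)" by (intro continuous_intros cont)
    ultimately obtain w where w: "w \<in> ?Q" "\<And>v. v \<in> ?Q \<Longrightarrow> residual a m w i \<le> residual a m v i"
      using continuous_attains_inf[of ?Q "\<lambda>u. residual a m u i"] by blast
    have "residual a m w i > 0"
    proof (rule ccontr)
      assume neg: "\<not> residual a m w i > 0"
      have wpos: "w $ j > 0" if j: "j \<in> J" for j
      proof (rule ccontr)
        assume "\<not> w $ j > 0"
        moreover have "w $ j \<ge> 0" using w(1) by blast
        ultimately have "w $ j = 0" by linarith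
        then have "residual a m w i > 0"
          using w(1) psubset.prems j by (intro psubset.IH[of "J - {j}"]) auto
        with neg show False by simp
      qed
      have dJ: "det_on J (\<lambda>k l. a $ l $ k) \<noteq> 0" "det_on J (\<lambda>k l. a $ k $ l) \<noteq> 0"
        using structural_det_pos[OF s \<kappa>, of J] det_on_transpose[of J "\<lambda>k l. a $ k $ l"] by auto
      \<comment> \<open>With these coefficients, \<open>f\<^sub>i\<close> is a constant plus the combination \<open>c\<close> of the \<open>f\<^sub>j\<close>.\<close>
      obtain c where "\<And>k. k \<in> J \<Longrightarrow> (\<Sum>l\<in>J. a $ l $ k * c l) = a $ i $ k"
        using det_on_nonzero_solve[OF dJ(1)] by metis
      then have c: "\<And>k. k \<in> J \<Longrightarrow> (\<Sum>l\<in>J. c l * a $ l $ k) = a $ i $ k"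
        by (simp add: mult.commute)
      have row: "(a *v v) $ i = (\<Sum>j\<in>J. c j * (a *v v) $ j)" if v: "\<And>l. l \<notin> J \<Longrightarrow> v $ l = 0" for v
      proof -
        have "(a *v v) $ i = (\<Sum>l\<in>J. (\<Sum>j\<in>J. c j * a $ j $ l) * v $ l)"
          using c by (simp add: matrix_vector_supported[OF v])
        also have "\<dots> = (\<Sum>j\<in>J. \<Sum>l\<in>J. c j * a $ j $ l * v $ l)"
          by (simp add: sum_distrib_right) (rule sum.swap)
        also have "\<dots> = (\<Sum>j\<in>J. c j * (a *v v) $ j)"
          by (intro sum.cong) (simp_all add: matrix_vector_supported[OF v] sum_distrib_left mult.assoc)
        finally show ?thesis .
      qed
      have zero: "c j * residual a m w j = 0" if j: "j \<in> J" for j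
      proof (rule ccontr)
        assume "c j * residual a m w j \<noteq> 0"
        moreover have "residual a m w j \<ge> 0" using w(1) j by blast
        ultimately have cj: "c j \<noteq> 0" and fj: "residual a m w j > 0" by auto
        \<comment> \<open>Moving \<open>u\<close> along \<open>v\<close> changes \<open>f\<^sub>j\<close> and no other component of \<open>f\<close> in \<open>J\<close>.\<close>
        obtain y where y: "\<And>k. k \<in> J \<Longrightarrow> (\<Sum>l\<in>J. a $ k $ l * y l) = (if k = j then 1 else 0)" "\<And>k. k \<notin> J \<Longrightarrow> y k = 0"
          using det_on_nonzero_solve[OF dJ(2), of "\<lambda>k. if k = j then 1 else 0"] by metis
        define v :: "real ^ 'n" where "v = (\<chi> k. y k)"
        have v0: "\<And>l. l \<notin> J \<Longrightarrow> v $ l = 0" using y(2) by (simp add: v_def)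
        have v: "(a *v v) $ k = (if k = j then 1 else 0)" if "k \<in> J" for k
        proof -
          have "(a *v v) $ k = (\<Sum>l\<in>J. a $ k $ l * v $ l)" by (rule matrix_vector_supported[OF v0])
          then show ?thesis using y(1)[OF that] by (simp add: v_def)
        qed
        have vi: "(a *v v) $ i = c j"
          using j by (simp add: row[OF v0] v if_distrib cong: if_cong)
        define \<epsilon> where "\<epsilon> = Min (insert (residual a m w j) ((\<lambda>k. w $ k / (1 + \<bar>v $ k\<bar>)) ` J))"
        have \<epsilon>0: "\<epsilon> > 0" unfolding \<epsilon>_def using fj wpos by (subst Min_gr_iff) (auto intro!: divide_pos_pos)
        have \<epsilon>1: "\<epsilon> \<le> residual a m w j" unfolding \<epsilon>_def by simp
        have \<epsilon>2: "\<epsilon> * \<bar>v $ k\<bar> \<le> w $ k" if "k \<in> J" for k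
        proof -
          have "\<epsilon> \<le> w $ k / (1 + \<bar>v $ k\<bar>)" unfolding \<epsilon>_def using that by (intro Min_le) auto
          then have "\<epsilon> + \<epsilon> * \<bar>v $ k\<bar> \<le> w $ k" by (simp add: field_simps)
          then show ?thesis using \<epsilon>0 by simp
        qed
        \<comment> \<open>The sign is chosen such that this move lowers \<open>f\<^sub>i\<close> by \<open>\<epsilon> * \<bar>c j\<bar>\<close>.\<close>
        define z where "z = w + (\<epsilon> * sgn (c j)) *\<^sub>R v"
        have az: "(a *v z) $ k = (a *v w) $ k + \<epsilon> * sgn (c j) * (a *v v) $ k" for k
          by (simp add: z_def matrix_vector_right_distrib matrix_vector_mult_scaleR)
        have "z \<in> ?Q"
        proof safe
          fix k show "0 \<le> z $ k"
          proof (cases "k \<in> J")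
            case True
            have "- (\<epsilon> * \<bar>v $ k\<bar>) \<le> \<epsilon> * sgn (c j) * v $ k"
              using \<epsilon>0 by (auto simp: sgn_if abs_if)
            then show ?thesis using \<epsilon>2[OF True] by (simp add: z_def)
          next
            case False
            then show ?thesis using v0 w(1) by (simp add: z_def)
          qed
        next
          fix k assume "k \<notin> J" then show "z $ k = 0" using v0 w(1) by (simp add: z_def)
        next
          fix k assume k: "k \<in> J"
          have "residual a m w k \<ge> 0" using w(1) k by simp
          moreover have "\<epsilon> * sgn (c j) \<le> \<epsilon>" using \<epsilon>0 by (auto simp: sgn_if)
          ultimately show "0 \<le> residual a m z k" using \<epsilon>1 unfolding az v[OF k] by auto
        qed
        from w(2)[OF this] have "\<epsilon> * \<bar>c j\<bar> \<le> 0"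
          unfolding az vi by (simp add: mult_sgn_abs abs_sgn mult.commute mult.left_commute)
        then show False using \<epsilon>0 cj by (simp add: mult_le_0_iff)
      qed
      have w0: "\<And>l. l \<notin> J \<Longrightarrow> w $ l = 0" using w(1) by simp
      have "residual a m w i = m $ i - (\<Sum>j\<in>J. c j * m $ j) + (\<Sum>j\<in>J. c j * residual a m w j)"
        by (simp add: row[OF w0] right_diff_distrib sum_subtractf)
      also have "(\<Sum>j\<in>J. c j * residual a m w j) = 0" using zero by (intro sum.neutral) auto
      finally show False using vertex_residual_pos[OF s \<kappa> psubset.prems(4) c] neg by simp
    qed
    with w(2)[OF uQ] show ?case by simp
  qed
qed


text \<open>
  For large \<open>u\<close>, the index supplied by \<open>structural_coercive\<close> has both \<open>u\<^sub>i\<close> and \<open>- f\<^sub>i\<close> at least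
  proportional to the norm of \<open>u\<close>.
\<close>

lemma residual_growth:
  assumes \<kappa>: "\<kappa> > 0" and p: "p \<ge> 1"
  obtains R q \<beta> where "R \<ge> 1" "q > 0" "\<beta> > 0"
    "\<And>a m u. \<And>j::'n::finite. structural \<kappa> a m \<Longrightarrow> \<bar>residual a m u j\<bar> \<le> \<beta> * (1 + norm u)"
    "\<And>a m u. structural \<kappa> a m \<Longrightarrow> (\<And>i::'n::finite. u $ i \<ge> 0) \<Longrightarrow> norm u \<ge> R \<Longrightarrow>
      (\<Sum>i\<in>UNIV. u $ i * \<bar>residual a m u i\<bar> powr p) \<ge> q * norm u powr p"
proof -
  obtain \<alpha> where \<alpha>: "\<alpha> > 0"
    "\<And>a m u. structural \<kappa> a m \<Longrightarrow> (\<And>i. u $ i \<ge> 0) \<Longrightarrow> \<exists>i::'n. u $ i * (a *v u) $ i \<ge> \<alpha> * (norm u)\<^sup>2"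
    using structural_coercive[OF \<kappa>] by blast
  define \<beta> where "\<beta> = real CARD('n) / \<kappa>"
  have \<beta>: "\<beta> > 0" using \<kappa> by (simp add: \<beta>_def)
  have au: "\<bar>(a *v u) $ j\<bar> \<le> \<beta> * norm u" if "structural \<kappa> a m" for a m and u :: "real ^ 'n" and j
  proof -
    have "\<bar>(a *v u) $ j\<bar> \<le> (\<Sum>l\<in>UNIV. \<bar>a $ j $ l\<bar> * \<bar>u $ l\<bar>)"
      unfolding matrix_vector_mult_def abs_mult[symmetric] by (simp add: sum_abs)
    also have "\<dots> \<le> (\<Sum>l\<in>(UNIV :: 'n set). 1 / \<kappa> * norm u)"
      using that \<kappa> by (intro sum_mono mult_mono component_le_norm_cart) (auto simp: structural_def)
    finally show ?thesis by (simp add: \<beta>_def)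
  qed
  have m: "\<bar>m $ j\<bar> \<le> 1 / \<kappa>" if "structural \<kappa> a m" for a :: "real ^ 'n ^ 'n" and m j
    using structural_m_lower[OF that, of j] that \<kappa> unfolding structural_def by (smt (verit))
  have \<beta>1: "1 / \<kappa> \<le> \<beta>" unfolding \<beta>_def using \<kappa> by (intro divide_right_mono) (auto simp: Suc_leI)
  show ?thesis
  proof (rule that[of "max 1 (2 / (\<alpha> * \<kappa>))" "\<alpha> / \<beta> * (\<alpha> / 2) powr p" \<beta>])
    show "\<alpha> / \<beta> * (\<alpha> / 2) powr p > 0" using \<alpha> \<beta> by simp
    show "\<bar>residual a m u j\<bar> \<le> \<beta> * (1 + norm u)" if "structural \<kappa> a m" for a m and u :: "real ^ 'n" and j
    proof -
      have "\<bar>residual a m u j\<bar> \<le> \<bar>m $ j\<bar> + \<bar>(a *v u) $ j\<bar>" by simp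
      also have "\<dots> \<le> \<beta> + \<beta> * norm u" using au[OF that, of u j] m[OF that, of j] \<beta>1 by linarith
      finally show ?thesis by (simp add: algebra_simps)
    qed
    fix a :: "real ^ 'n ^ 'n" and m and u :: "real ^ 'n"
    assume s: "structural \<kappa> a m" and u: "\<And>i. u $ i \<ge> 0" and R: "norm u \<ge> max 1 (2 / (\<alpha> * \<kappa>))"
    define x where "x = norm u"
    have x1: "x \<ge> 1" and x2: "2 / (\<alpha> * \<kappa>) \<le> x" using R by (auto simp: x_def)
    obtain i where i: "u $ i * (a *v u) $ i \<ge> \<alpha> * x\<^sup>2" using \<alpha>(2)[OF s u] by (auto simp: x_def)
    have pos: "\<alpha> * x\<^sup>2 > 0" using \<alpha>(1) x1 by simp
    then have ui: "u $ i > 0" and ai: "(a *v u) $ i > 0"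
      using i u[of i] by (smt (verit) zero_less_mult_iff mult_nonneg_nonpos)+
    have "\<alpha> * x * x \<le> u $ i * (\<beta> * x)"
      using i mult_left_mono[OF order_trans[OF abs_ge_self au[OF s, of u i]] u[of i]]
      by (simp add: power2_eq_square x_def mult.assoc)
    then have u1: "\<alpha> / \<beta> * x \<le> u $ i" using x1 \<beta> by (simp add: field_simps)
    have "u $ i * (a *v u) $ i \<le> x * (a *v u) $ i"
      using component_le_norm_cart[of u i] ai by (intro mult_right_mono) (auto simp: x_def)
    then have "\<alpha> * x * x \<le> x * (a *v u) $ i"
      using i by (simp add: power2_eq_square mult.assoc)
    then have a1: "\<alpha> * x \<le> (a *v u) $ i" using x1 by (simp add: mult.commute)
    have "1 / \<kappa> \<le> \<alpha> * x / 2" using x2 \<kappa> \<alpha>(1) by (simp add: field_simps)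
    then have f1: "\<alpha> / 2 * x \<le> \<bar>residual a m u i\<bar>" using a1 m[OF s, of i] by linarith
    have "\<alpha> / \<beta> * (\<alpha> / 2) powr p * norm u powr p = \<alpha> / \<beta> * (\<alpha> / 2 * x) powr p"
      using \<alpha>(1) x1 powr_mult[of "\<alpha> / 2" x p] by (simp add: x_def)
    also have "\<dots> \<le> (\<alpha> / \<beta> * x) * (\<alpha> / 2 * x) powr p"
      using \<alpha>(1) \<beta> x1 by (intro mult_right_mono) (auto simp: field_simps)
    also have "\<dots> \<le> u $ i * \<bar>residual a m u i\<bar> powr p"
      using u1 f1 u \<alpha>(1) x1 p by (intro mult_mono powr_mono2) auto
    also have "\<dots> \<le> (\<Sum>i\<in>UNIV. u $ i * \<bar>residual a m u i\<bar> powr p)"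
      using u by (intro member_le_sum) auto
    finally show "(\<Sum>i\<in>UNIV. u $ i * \<bar>residual a m u i\<bar> powr p) \<ge> \<alpha> / \<beta> * (\<alpha> / 2) powr p * norm u powr p" .
  qed (use \<beta> in auto)
qed

text \<open>
  Split at the radius from \<open>residual_growth\<close>: inside, the left-hand sides are bounded. The first
  estimate turns bounded dissipation into bounded \<open>L\<^sup>p\<close> norm, the second one turns a lower bound on
  the total dissipation into the desired inequality.
\<close>

lemma residual_powr_le:
  assumes \<kappa>: "\<kappa> > 0" and p: "p \<ge> 1"
  shows "\<exists>C>0. \<forall>a m. \<forall>u :: real ^ 'n. structural \<kappa> a m \<longrightarrow> (\<forall>i. u $ i \<ge> 0) \<longrightarrow>
      norm u powr p \<le> C * (1 + (\<Sum>i\<in>UNIV. u $ i * \<bar>residual a m u i\<bar> powr p)) \<and>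
      (\<Sum>i\<in>UNIV. \<bar>residual a m u i\<bar> powr p) \<le> C * (1 + (\<Sum>i\<in>UNIV. u $ i * \<bar>residual a m u i\<bar> powr p))"
proof -
  obtain R q \<beta> where R: "R \<ge> 1" and q: "q > 0" and \<beta>: "\<beta> > 0"
    and 1: "\<And>a m u. \<And>j::'n. structural \<kappa> a m \<Longrightarrow> \<bar>residual a m u j\<bar> \<le> \<beta> * (1 + norm u)"
    and 2: "\<And>a m u. structural \<kappa> a m \<Longrightarrow> (\<And>i::'n. u $ i \<ge> 0) \<Longrightarrow> norm u \<ge> R \<Longrightarrow>
      (\<Sum>i\<in>UNIV. u $ i * \<bar>residual a m u i\<bar> powr p) \<ge> q * norm u powr p"
    using residual_growth[OF \<kappa> p, where ?'n = 'n] by blast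
  define C1 where "C1 = R powr p + 1 / q"
  define C2 where "C2 = real CARD('n) * (2 * \<beta>) powr p"
  have C1: "C1 > 0" using R q by (simp add: C1_def add_pos_pos)
  have C2: "C2 > 0" using \<beta> by (simp add: C2_def)
  have A: "norm u powr p \<le> C1 * (1 + (\<Sum>i\<in>UNIV. u $ i * \<bar>residual a m u i\<bar> powr p))"
    if s: "structural \<kappa> a m" and u: "\<And>i::'n. u $ i \<ge> 0" for a m u
  proof -
    let ?S = "\<Sum>i\<in>UNIV. u $ i * \<bar>residual a m u i\<bar> powr p"
    have S: "?S \<ge> 0" using u by (intro sum_nonneg) auto
    have "norm u powr p \<le> R powr p + ?S / q"
    proof (cases "norm u \<ge> R")
      case True
      have "norm u powr p \<le> ?S / q" using 2[OF s u True] q by (simp add: field_simps)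
      then show ?thesis using powr_ge_zero[of R p] by linarith
    next
      case False
      then have "norm u powr p \<le> R powr p" using p by (intro powr_mono2) auto
      then show ?thesis using S q by (smt (verit) divide_nonneg_pos)
    qed
    also have "\<dots> \<le> C1 * (1 + ?S)"
      using S q mult_nonneg_nonneg[OF powr_ge_zero[of R p] S] by (simp add: C1_def algebra_simps)
    finally show ?thesis .
  qed
  have B: "(\<Sum>i\<in>UNIV. \<bar>residual a m u i\<bar> powr p) \<le> C2 * (1 + norm u powr p)"
    if s: "structural \<kappa> a m" for a m and u :: "real ^ 'n"
  proof -
    have x: "(1 + norm u) powr p \<le> 2 powr p * (1 + norm u powr p)"
    proof -
      have "(1 + norm u) powr p \<le> (2 * max 1 (norm u)) powr p" using p by (intro powr_mono2) auto
      also have "\<dots> = 2 powr p * max 1 (norm u) powr p" by (simp add: powr_mult)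
      also have "max 1 (norm u) powr p \<le> 1 + norm u powr p" by (simp add: max_def)
      finally show ?thesis by simp
    qed
    have "\<bar>residual a m u i\<bar> powr p \<le> (2 * \<beta>) powr p * (1 + norm u powr p)" for i
    proof -
      have "\<bar>residual a m u i\<bar> powr p \<le> (\<beta> * (1 + norm u)) powr p"
        using p by (intro powr_mono2 1[OF s]) auto
      also have "\<dots> = \<beta> powr p * (1 + norm u) powr p" using \<beta> by (simp add: powr_mult)
      also have "\<dots> \<le> \<beta> powr p * (2 powr p * (1 + norm u powr p))" by (intro mult_left_mono x) auto
      finally show ?thesis using \<beta> by (simp add: powr_mult mult_ac)
    qed
    then have "(\<Sum>i\<in>UNIV. \<bar>residual a m u i\<bar> powr p) \<le> (\<Sum>i\<in>(UNIV::'n set). (2 * \<beta>) powr p * (1 + norm u powr p))"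
      by (rule sum_mono)
    then show ?thesis by (simp add: C2_def mult.assoc)
  qed
  show ?thesis
  proof (intro exI[of _ "C1 + C2 * (1 + C1)"] conjI allI impI)
    show "C1 + C2 * (1 + C1) > 0" using C1 C2 by (simp add: add_pos_pos)
    fix a :: "real ^ 'n ^ 'n" and m and u :: "real ^ 'n" assume s: "structural \<kappa> a m" and u': "\<forall>i. u $ i \<ge> 0"
    have u: "\<And>i. u $ i \<ge> 0" using u' by blast
    let ?S = "\<Sum>i\<in>UNIV. u $ i * \<bar>residual a m u i\<bar> powr p"
    have S: "?S \<ge> 0" using u by (intro sum_nonneg) auto
    have "C1 * (1 + ?S) \<le> (C1 + C2 * (1 + C1)) * (1 + ?S)"
      using S C1 C2 by (intro mult_right_mono) (auto intro!: mult_nonneg_nonneg)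
    then show "norm u powr p \<le> (C1 + C2 * (1 + C1)) * (1 + ?S)" using A[OF s u] by simp
    have "(\<Sum>i\<in>UNIV. \<bar>residual a m u i\<bar> powr p) \<le> C2 * (1 + norm u powr p)" by (rule B[OF s])
    also have "\<dots> \<le> C2 * (1 + C1 * (1 + ?S))" using A[OF s u] C2 by (intro mult_left_mono) auto
    also have "\<dots> \<le> C2 * ((1 + C1) * (1 + ?S))" using S C1 C2 by (intro mult_left_mono) (auto simp: algebra_simps)
    also have "\<dots> \<le> (C1 + C2 * (1 + C1)) * (1 + ?S)"
      using S C1 by (simp add: algebra_simps)
    finally show "(\<Sum>i\<in>UNIV. \<bar>residual a m u i\<bar> powr p) \<le> (C1 + C2 * (1 + C1)) * (1 + ?S)" .
  qed
qed

lemma compact_structural_nonneg: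
  assumes "\<kappa> > 0"
  shows "compact ({z :: (real ^ 'n ^ 'n) \<times> (real ^ 'n::finite). structural \<kappa> (fst z) (snd z)} \<times>
     {u :: real ^ 'n. norm u \<le> R \<and> (\<forall>i. u $ i \<ge> 0)})"
proof -
  have "compact {u :: real ^ 'n. norm u \<le> R \<and> (\<forall>i. u $ i \<ge> 0)}"
    unfolding compact_eq_bounded_closed
    by (auto intro!: boundedI[where B = R] closed_Collect_conj closed_Collect_all closed_Collect_le continuous_intros)
  then show ?thesis by (intro compact_Times compact_structural assms)
qed

lemma continuous_on_residual:
  "continuous_on S (\<lambda>z :: ((real ^ 'n ^ 'n) \<times> (real ^ 'n::finite)) \<times> (real ^ 'n). residual (fst (fst z)) (snd (fst z)) (snd z) i)"
  unfolding matrix_vector_mult_def by (simp, intro continuous_intros)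

text \<open>
  If all \<open>f\<^sub>j \<ge> 0\<close> and \<open>f\<^sub>i = 0\<close>, then \<open>u\<^sub>i > 0\<close>, by \<open>residual_pos_outside_support\<close> for the complement
  of \<open>{i}\<close>. So the sum of \<open>u\<^sub>i\<close>, \<open>\<bar>f\<^sub>i\<bar>\<close> and the negative parts of the \<open>f\<^sub>j\<close> is positive, and compactness
  bounds it below. This allows \<open>f\<^sub>i\<close> and the \<open>f\<^sub>j\<close> to deviate by a small \<open>s\<close>.
\<close>

lemma component_lower_bound:
  assumes \<kappa>: "\<kappa> > 0"
  obtains s c where "s > 0" "c > 0"
    "\<And>a m u i. structural \<kappa> a m \<Longrightarrow> (\<And>j::'n::finite. u $ j \<ge> 0) \<Longrightarrow>
      (\<And>j. residual a m u j \<ge> - s) \<Longrightarrow> residual a m u i \<le> s \<Longrightarrow> u $ i \<ge> c"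
proof -
  obtain R where R: "R > 0" "\<And>a m u. structural \<kappa> a m \<Longrightarrow> (\<And>i::'n. u $ i \<ge> 0) \<Longrightarrow>
      (\<And>i. u $ i > 0 \<Longrightarrow> residual a m u i \<ge> -1) \<Longrightarrow> norm u \<le> R"
    using structural_bounded[OF \<kappa>] by metis
  let ?S = "{z :: (real ^ 'n ^ 'n) \<times> (real ^ 'n). structural \<kappa> (fst z) (snd z)} \<times>
     {u :: real ^ 'n. norm u \<le> R \<and> (\<forall>i. u $ i \<ge> 0)}"
  let ?r = "\<lambda>z :: ((real ^ 'n ^ 'n) \<times> (real ^ 'n)) \<times> (real ^ 'n). residual (fst (fst z)) (snd (fst z)) (snd z)"
  let ?g = "\<lambda>i z. snd z $ i + \<bar>?r z i\<bar> + (\<Sum>j\<in>UNIV. max 0 (- ?r z j))"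
  have "\<exists>e>0. \<forall>z\<in>?S. ?g i z \<ge> e" for i
  proof -
    have co: "continuous_on ?S (?g i)" by (intro continuous_intros continuous_on_residual)
    have po: "?g i z > 0" if z: "z \<in> ?S" for z
    proof (rule ccontr)
      assume neg: "\<not> ?g i z > 0"
      obtain a m u where amu: "z = ((a, m), u)" by (metis prod.collapse)
      with z have s: "structural \<kappa> a m" and u: "\<And>i. u $ i \<ge> 0" by auto
      have sn: "(\<Sum>j\<in>UNIV. max 0 (- residual a m u j)) \<ge> 0" by (intro sum_nonneg) auto
      have "(\<Sum>j\<in>UNIV. max 0 (- residual a m u j)) = 0" and ui: "u $ i = 0" and ri: "residual a m u i = 0"
        using neg u[of i] sn unfolding amu by auto
      then have "max 0 (- residual a m u j) = 0" for j by (subst (asm) sum_nonneg_eq_0_iff) auto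
      then have "residual a m u j \<ge> 0" for j by (metis max.cobounded2 neg_le_0_iff_le)
      then have "residual a m u i > 0"
        using ui u by (intro residual_pos_outside_support[OF s \<kappa>, where J = "- {i}"]) auto
      with ri show False by simp
    qed
    show ?thesis
      using compact_imp_pos_lower_bound[OF compact_structural_nonneg[OF \<kappa>] co po] by fast
  qed
  then have "\<forall>i. \<exists>e>0. \<forall>z\<in>?S. ?g i z \<ge> e" by blast
  from choice[OF this] obtain e where ex: "\<forall>i. e i > 0 \<and> (\<forall>z\<in>?S. ?g i z \<ge> e i)" ..
  have e: "\<And>i. e i > 0" "\<And>i z. z \<in> ?S \<Longrightarrow> ?g i z \<ge> e i" using ex by fast+
  define \<gamma> where "\<gamma> = Min (range e)"
  have \<gamma>: "\<gamma> > 0" "\<And>i. \<gamma> \<le> e i" using e(1) by (auto simp: \<gamma>_def)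
  \<comment> \<open>\<open>s \<le> 1\<close> puts \<open>u\<close> into the ball from \<open>structural_bounded\<close>. The \<open>N + 1\<close> terms other than \<open>u\<^sub>i\<close> are at
    most \<open>s\<close> each, so they use up half of \<open>\<gamma>\<close>.\<close>
  define s where "s = min 1 (\<gamma> / (2 * (real CARD('n) + 1)))"
  have s: "s > 0" "s \<le> 1" using \<gamma> by (auto simp: s_def)
  have sN: "(real CARD('n) + 1) * s \<le> \<gamma> / 2"
  proof -
    have "s \<le> \<gamma> / (2 * (real CARD('n) + 1))" by (simp add: s_def)
    then show ?thesis by (simp add: field_simps)
  qed
  show ?thesis
  proof (rule that[of s "\<gamma> / 2"])
    fix a :: "real ^ 'n ^ 'n" and m and u :: "real ^ 'n" and i
    assume st: "structural \<kappa> a m" and u: "\<And>j::'n. u $ j \<ge> 0"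
      and f: "\<And>j. residual a m u j \<ge> - s" and fi: "residual a m u i \<le> s"
    have "residual a m u j \<ge> - 1" for j using f[of j] s by linarith
    then have "norm u \<le> R" by (intro R(2)[OF st u]) auto
    then have "((a, m), u) \<in> ?S" using st u by auto
    from e(2)[OF this, of i] have "e i \<le> u $ i + \<bar>residual a m u i\<bar> + (\<Sum>j\<in>UNIV. max 0 (- residual a m u j))"
      by simp
    also have "(\<Sum>j\<in>UNIV. max 0 (- residual a m u j)) \<le> (\<Sum>j\<in>(UNIV::'n set). s)"
    proof (intro sum_mono max.boundedI)
      fix j show "- residual a m u j \<le> s" using f[of j] by linarith
    qed (use s in auto)
    also have "\<bar>residual a m u i\<bar> \<le> s" using f[of i] fi by linarith
    finally show "u $ i \<ge> \<gamma> / 2" using \<gamma>(2)[of i] sN by (simp add: algebra_simps)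
  qed (use s \<gamma> in auto)
qed

text \<open>
  If all the products \<open>u\<^sub>i f\<^sub>i\<close> vanish, then \<open>u\<close> is supported in \<open>{i. f\<^sub>i = 0}\<close>, and the other \<open>f\<^sub>i\<close> are
  positive by \<open>residual_pos_outside_support\<close>. So the sum is positive where some \<open>f\<^sub>j \<le> - t\<close>;
  compactness bounds it below for bounded \<open>u\<close>, and \<open>residual_growth\<close> for large \<open>u\<close>.
\<close>

lemma dissipation_lower_bound:
  assumes \<kappa>: "\<kappa> > 0" and p: "p \<ge> 1" and t: "t > 0"
  obtains \<delta> where "\<delta> > 0"
    "\<And>a m u j. structural \<kappa> a m \<Longrightarrow> (\<And>j::'n::finite. u $ j \<ge> 0) \<Longrightarrow> residual a m u j \<le> - t \<Longrightarrow>
      (\<Sum>i\<in>UNIV. u $ i * \<bar>residual a m u i\<bar> powr p) \<ge> \<delta>"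
proof -
  obtain R q \<beta> where R: "R \<ge> 1" and q: "q > 0" and "\<beta> > 0"
    and "\<And>a m u. \<And>j::'n. structural \<kappa> a m \<Longrightarrow> \<bar>residual a m u j\<bar> \<le> \<beta> * (1 + norm u)"
    and 2: "\<And>a m u. structural \<kappa> a m \<Longrightarrow> (\<And>i::'n. u $ i \<ge> 0) \<Longrightarrow> norm u \<ge> R \<Longrightarrow>
      (\<Sum>i\<in>UNIV. u $ i * \<bar>residual a m u i\<bar> powr p) \<ge> q * norm u powr p"
    using residual_growth[OF \<kappa> p, where ?'n = 'n] by blast
  let ?S = "{z :: (real ^ 'n ^ 'n) \<times> (real ^ 'n). structural \<kappa> (fst z) (snd z)} \<times>
     {u :: real ^ 'n. norm u \<le> R \<and> (\<forall>i. u $ i \<ge> 0)}"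
  let ?r = "\<lambda>z :: ((real ^ 'n ^ 'n) \<times> (real ^ 'n)) \<times> (real ^ 'n). residual (fst (fst z)) (snd (fst z)) (snd z)"
  let ?g = "\<lambda>z. \<Sum>i\<in>UNIV. snd z $ i * \<bar>?r z i\<bar> powr p"
  have "\<exists>e>0. \<forall>z\<in>?S \<inter> {z. ?r z j \<le> - t}. ?g z \<ge> e" for j
  proof -
    have "closed {z. ?r z j \<le> - t}" by (intro closed_Collect_le continuous_on_residual continuous_intros)
    then have c: "compact (?S \<inter> {z. ?r z j \<le> - t})"
      using compact_structural_nonneg[OF \<kappa>] by (intro compact_Int_closed) auto
    have co: "continuous_on (?S \<inter> {z. ?r z j \<le> - t}) ?g"
      using p by (intro continuous_intros continuous_on_powr' continuous_on_residual) auto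
    have po: "?g z > 0" if z: "z \<in> ?S \<inter> {z. ?r z j \<le> - t}" for z
    proof (rule ccontr)
      assume neg: "\<not> ?g z > 0"
      obtain a m u where amu: "z = ((a, m), u)" by (metis prod.collapse)
      with z have s: "structural \<kappa> a m" and u: "\<And>i. u $ i \<ge> 0" and rj: "residual a m u j \<le> - t" by auto
      have "(\<Sum>i\<in>UNIV. u $ i * \<bar>residual a m u i\<bar> powr p) \<ge> 0" using u by (intro sum_nonneg) auto
      then have "(\<Sum>i\<in>UNIV. u $ i * \<bar>residual a m u i\<bar> powr p) = 0"
        using neg unfolding amu by auto
      then have z: "u $ i * \<bar>residual a m u i\<bar> powr p = 0" for i
        using u by (subst (asm) sum_nonneg_eq_0_iff) auto
      have z': "u $ i = 0 \<or> residual a m u i = 0" for i using z[of i] by simp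
      have "residual a m u j > 0"
      proof (rule residual_pos_outside_support[OF s \<kappa> u])
        show "j \<notin> {i. residual a m u i = 0}" using rj t by simp
      qed (use z' in auto)
      with rj t show False by simp
    qed
    show ?thesis
      using compact_imp_pos_lower_bound[OF c co po] by fast
  qed
  then have "\<forall>i. \<exists>e>0. \<forall>z\<in>?S \<inter> {z. ?r z i \<le> - t}. ?g z \<ge> e" by blast
  from choice[OF this] obtain e where ex: "\<forall>i. e i > 0 \<and> (\<forall>z\<in>?S \<inter> {z. ?r z i \<le> - t}. ?g z \<ge> e i)" ..
  have e: "\<And>i. e i > 0" "\<And>i z. z \<in> ?S \<inter> {z. ?r z i \<le> - t} \<Longrightarrow> ?g z \<ge> e i" using ex by fast+
  define \<gamma> where "\<gamma> = Min (range e)"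
  have \<gamma>: "\<gamma> > 0" "\<And>i. \<gamma> \<le> e i" using e(1) by (auto simp: \<gamma>_def)
  show ?thesis
  proof (rule that[of "min \<gamma> (q * R powr p)"])
    show "min \<gamma> (q * R powr p) > 0" using \<gamma> q R by auto
    fix a :: "real ^ 'n ^ 'n" and m and u :: "real ^ 'n" and j
    assume st: "structural \<kappa> a m" and u: "\<And>j::'n. u $ j \<ge> 0" and f: "residual a m u j \<le> - t"
    show "(\<Sum>i\<in>UNIV. u $ i * \<bar>residual a m u i\<bar> powr p) \<ge> min \<gamma> (q * R powr p)"
    proof (cases "norm u \<le> R")
      case True
      then have "((a, m), u) \<in> ?S \<inter> {z. ?r z j \<le> - t}" using st u f by auto
      from e(2)[OF this] \<gamma>(2)[of j] show ?thesis by simp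
    next
      case False
      then have "R powr p \<le> norm u powr p" using R p by (intro powr_mono2) auto
      then have "q * R powr p \<le> q * norm u powr p" using q by simp
      then show ?thesis using 2[OF st u] False by (simp add: min_le_iff_disj)
    qed
  qed
qed

section \<open>Continuity of translations in the mean\<close>

lemma lborel_distr_translate: "distr lborel borel (\<lambda>x::'a::euclidean_space. x - z) = lborel"
proof -
  have "(+) (- z) = (\<lambda>x. x - z)" by auto
  then show ?thesis using lborel_distr_plus[of "- z"] by simp
qed

lemma lborel_distr_reflect: "distr lborel borel (\<lambda>x::'a::euclidean_space. z - x) = lborel"
  using lborel_affine[of "- 1" z] by (simp add: density_1)

lemma
  fixes f :: "'a::euclidean_space \<Rightarrow> 'b::{banach, second_countable_topology}"
  assumes [measurable]: "f \<in> borel_measurable borel"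
  shows integrable_translate_iff: "integrable lborel (\<lambda>x. f (x - z)) \<longleftrightarrow> integrable lborel f"
    and integral_translate: "(\<integral>x. f (x - z) \<partial>lborel) = (\<integral>x. f x \<partial>lborel)"
    and integrable_reflect_iff: "integrable lborel (\<lambda>x. f (z - x)) \<longleftrightarrow> integrable lborel f"
    and integral_reflect: "(\<integral>x. f (z - x) \<partial>lborel) = (\<integral>x. f x \<partial>lborel)"
  using integrable_distr_eq[of "\<lambda>x. x - z" lborel borel f] integral_distr[of "\<lambda>x. x - z" lborel borel f]
    integrable_distr_eq[of "\<lambda>x. z - x" lborel borel f] integral_distr[of "\<lambda>x. z - x" lborel borel f]
  by (simp_all add: lborel_distr_translate lborel_distr_reflect)

text \<open>
  Translations do not change the \<open>L\<^sup>1\<close> norm, so continuity passes to limits in \<open>L\<^sup>1\<close>.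
\<close>

lemma translate_L1_approx:
  fixes f :: "'a::euclidean_space \<Rightarrow> 'b::{banach, second_countable_topology}"
  assumes f: "integrable lborel f"
    and ap: "\<And>e. e > 0 \<Longrightarrow> \<exists>k. integrable lborel k \<and> (\<integral>x. norm (f x - k x) \<partial>lborel) < e \<and>
        (\<lambda>n. \<integral>x. norm (k (x - z n) - k x) \<partial>lborel) \<longlonglongrightarrow> 0"
  shows "(\<lambda>n. \<integral>x. norm (f (x - z n) - f x) \<partial>lborel) \<longlonglongrightarrow> 0"
proof (rule LIMSEQ_I)
  fix e :: real assume e: "e > 0"
  obtain k where k: "integrable lborel k" and fk: "(\<integral>x. norm (f x - k x) \<partial>lborel) < e / 3"
    and lim: "(\<lambda>n. \<integral>x. norm (k (x - z n) - k x) \<partial>lborel) \<longlonglongrightarrow> 0"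
    using ap[of "e / 3"] e by auto
  note [measurable] = borel_measurable_integrable[OF f, simplified] borel_measurable_integrable[OF k, simplified]
  obtain N where N: "\<And>n. n \<ge> N \<Longrightarrow> norm ((\<integral>x. norm (k (x - z n) - k x) \<partial>lborel) - 0) < e / 3"
    using LIMSEQ_D[OF lim, of "e / 3"] e by auto
  have "norm ((\<integral>x. norm (f (x - z n) - f x) \<partial>lborel) - 0) < e" if n: "n \<ge> N" for n
  proof -
    have i: "integrable lborel (\<lambda>x. f (x - z n))" "integrable lborel (\<lambda>x. k (x - z n))"
      using f k by (simp_all add: integrable_translate_iff)
    have "(\<integral>x. norm (f (x - z n) - f x) \<partial>lborel) \<le>
      (\<integral>x. norm (f (x - z n) - k (x - z n)) + norm (k (x - z n) - k x) + norm (f x - k x) \<partial>lborel)"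
    proof (rule integral_mono)
      fix x
      have "f (x - z n) - f x = (f (x - z n) - k (x - z n)) + (k (x - z n) - k x) - (f x - k x)" by simp
      then show "norm (f (x - z n) - f x) \<le>
        norm (f (x - z n) - k (x - z n)) + norm (k (x - z n) - k x) + norm (f x - k x)"
        by (metis (no_types) norm_triangle_ineq norm_triangle_ineq4 add_right_mono order_trans)
    qed (use f k i in auto)
    also have "\<dots> = (\<integral>x. norm (f (x - z n) - k (x - z n)) \<partial>lborel) +
       (\<integral>x. norm (k (x - z n) - k x) \<partial>lborel) + (\<integral>x. norm (f x - k x) \<partial>lborel)"
      using f k i by simp
    also have "(\<integral>x. norm (f (x - z n) - k (x - z n)) \<partial>lborel) = (\<integral>x. norm (f x - k x) \<partial>lborel)"
      by (rule integral_translate[of "\<lambda>x. norm (f x - k x)"]) simp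
    finally show ?thesis using fk N[OF n] by auto
  qed
  then show "\<exists>N. \<forall>n\<ge>N. norm ((\<integral>x. norm (f (x - z n) - f x) \<partial>lborel) - 0) < e" by blast
qed

text \<open>
  The indicator of an open set is lower semicontinuous, so the positive part of
  \<open>indicator O' x - indicator O' (x - z n)\<close> tends to zero pointwise. The negative part has the same
  integral, as translations preserve the measure.
\<close>

lemma translate_L1_open:
  fixes O' :: "'a::euclidean_space set"
  assumes O: "open O'" "emeasure lborel O' < \<infinity>" and z: "z \<longlonglongrightarrow> 0"
  shows "(\<lambda>n. \<integral>x. \<bar>indicator O' (x - z n) - indicator O' x :: real\<bar> \<partial>lborel) \<longlonglongrightarrow> 0"
proof -
  let ?i = "indicator O' :: 'a \<Rightarrow> real"
  have [measurable]: "O' \<in> sets borel" using O by simp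
  have i: "integrable lborel ?i" using O by (simp add: integrable_indicator_iff)
  have i': "integrable lborel (\<lambda>x. ?i (x - z n))" for n using i by (simp add: integrable_translate_iff)
  have "(\<lambda>n. \<integral>x. max 0 (?i x - ?i (x - z n)) \<partial>lborel) \<longlonglongrightarrow> (\<integral>x. 0 \<partial>(lborel :: 'a measure))"
  proof (rule integral_dominated_convergence[where w = ?i])
    show "AE x in lborel. (\<lambda>n. max 0 (?i x - ?i (x - z n))) \<longlonglongrightarrow> 0"
    proof (rule AE_I2)
      fix x
      show "(\<lambda>n. max 0 (?i x - ?i (x - z n))) \<longlonglongrightarrow> 0"
      proof (cases "x \<in> O'")
        case True
        have "(\<lambda>n. x - z n) \<longlonglongrightarrow> x" using tendsto_diff[OF tendsto_const z, of x] by simp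
        then have "eventually (\<lambda>n. x - z n \<in> O') sequentially" using True O(1) by (intro topological_tendstoD)
        then have "eventually (\<lambda>n. max 0 (?i x - ?i (x - z n)) = 0) sequentially"
          by eventually_elim (use True in auto)
        then show ?thesis by (rule tendsto_eventually)
      qed (auto intro!: tendsto_eventually always_eventually simp: max_def indicator_def)
    qed
    show "AE x in lborel. norm (max 0 (?i x - ?i (x - z n))) \<le> ?i x" for n
      by (auto simp: indicator_def)
  qed (use i in auto)
  moreover have "(\<integral>x. \<bar>?i (x - z n) - ?i x\<bar> \<partial>lborel) = 2 * (\<integral>x. max 0 (?i x - ?i (x - z n)) \<partial>lborel)" for n
  proof -
    have "(\<integral>x. \<bar>?i (x - z n) - ?i x\<bar> \<partial>lborel) = (\<integral>x. 2 * max 0 (?i x - ?i (x - z n)) + (?i (x - z n) - ?i x) \<partial>lborel)"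
      by (intro Bochner_Integration.integral_cong) (auto simp: max_def abs_if)
    also have "\<dots> = 2 * (\<integral>x. max 0 (?i x - ?i (x - z n)) \<partial>lborel) + ((\<integral>x. ?i (x - z n) \<partial>lborel) - (\<integral>x. ?i x \<partial>lborel))"
      using i i' by (subst Bochner_Integration.integral_add) auto
    also have "(\<integral>x. ?i (x - z n) \<partial>lborel) = (\<integral>x. ?i x \<partial>lborel)"
      by (rule integral_translate) simp
    finally show ?thesis by simp
  qed
  ultimately show ?thesis using tendsto_mult_right_zero by auto
qed

lemma translate_L1:
  fixes f :: "'a::euclidean_space \<Rightarrow> 'b::{banach, second_countable_topology}"
  assumes f: "integrable lborel f" and z: "z \<longlonglongrightarrow> 0"
  shows "(\<lambda>n. \<integral>x. norm (f (x - z n) - f x) \<partial>lborel) \<longlonglongrightarrow> 0"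
  using f
proof (induction rule: integrable_induct)
  case (base A c)
  then have [measurable]: "A \<in> sets borel" by simp
  show ?case
  proof (rule translate_L1_approx)
    show "integrable lborel (\<lambda>x. indicator A x *\<^sub>R c)" using base by (intro integrable_scaleR_left) (simp add: integrable_indicator_iff)
    fix e :: real assume e: "e > 0"
    define e' where "e' = e / (1 + norm c)"
    have e': "e' > 0" using e by (simp add: e'_def add_pos_nonneg)
    obtain O' where O: "open O'" "A \<subseteq> O'" "emeasure lborel (O' - A) < e'"
      using outer_regular_lborel[of A e'] base e' by auto
    have [measurable]: "O' \<in> sets borel" using O by simp
    have fin: "emeasure lborel O' < \<infinity>"
    proof -
      have "O' = A \<union> (O' - A)" using O by auto
      then have "emeasure lborel O' \<le> emeasure lborel A + emeasure lborel (O' - A)"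
        using base by (metis emeasure_subadditive \<open>O' \<in> sets borel\<close> sets.Diff sets_lborel)
      also have "\<dots> < \<infinity>" using base(2) O(3) by (auto simp: less_top order_less_trans[OF _ ennreal_less_top])
      finally show ?thesis .
    qed
    have ik: "integrable lborel (\<lambda>x. indicator O' x *\<^sub>R c)" using fin by (intro integrable_scaleR_left) (simp add: integrable_indicator_iff)
    moreover have "(\<integral>x. norm (indicator A x *\<^sub>R c - indicator O' x *\<^sub>R c) \<partial>lborel) < e"
    proof -
      have "(\<integral>x. norm (indicator A x *\<^sub>R c - indicator O' x *\<^sub>R c) \<partial>lborel) = (\<integral>x. indicator (O' - A) x * norm c \<partial>lborel)"
        using O(2) by (intro Bochner_Integration.integral_cong) (auto simp: indicator_def)
      also have "\<dots> = measure lborel (O' - A) * norm c" by simp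
      also have "\<dots> \<le> e' * norm c"
      proof (intro mult_right_mono)
        show "measure lborel (O' - A) \<le> e'" using O(3) e'
          by (metis emeasure_eq_ennreal_measure ennreal_leI ennreal_le_iff infinity_ennreal_def less_imp_le not_less_iff_gr_or_eq top.not_eq_extremum measure_def enn2real_leI)
      qed simp
      also have "\<dots> < e" using e by (simp add: e'_def field_simps add_pos_nonneg)
      finally show ?thesis .
    qed
    moreover have "(\<lambda>n. \<integral>x. norm (indicator O' (x - z n) *\<^sub>R c - indicator O' x *\<^sub>R c) \<partial>lborel) \<longlonglongrightarrow> 0"
    proof -
      have "(\<lambda>n. (\<integral>x. \<bar>indicator O' (x - z n) - indicator O' x :: real\<bar> \<partial>lborel) * norm c) \<longlonglongrightarrow> 0 * norm c"
        by (intro tendsto_mult translate_L1_open O fin z tendsto_const)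
      moreover have "(\<integral>x. \<bar>indicator O' (x - z n) - indicator O' x :: real\<bar> \<partial>lborel) * norm c =
          (\<integral>x. norm (indicator O' (x - z n) *\<^sub>R c - indicator O' x *\<^sub>R c) \<partial>lborel)" for n
        by (simp add: scaleR_diff_left[symmetric])
      ultimately show ?thesis by simp
    qed
    ultimately show "\<exists>k. integrable lborel k \<and> (\<integral>x. norm (indicator A x *\<^sub>R c - k x) \<partial>lborel) < e \<and>
        (\<lambda>n. \<integral>x. norm (k (x - z n) - k x) \<partial>lborel) \<longlonglongrightarrow> 0"
      by (intro exI[of _ "\<lambda>x. indicator O' x *\<^sub>R c"]) auto
  qed
next
  case (add f g)
  note [measurable] = borel_measurable_integrable[OF add.hyps(1), simplified] borel_measurable_integrable[OF add.hyps(2), simplified]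
  have i: "integrable lborel (\<lambda>x. f (x - z n))" "integrable lborel (\<lambda>x. g (x - z n))" for n
    using add by (simp_all add: integrable_translate_iff)
  have "(\<lambda>n. (\<integral>x. norm (f (x - z n) - f x) \<partial>lborel) + (\<integral>x. norm (g (x - z n) - g x) \<partial>lborel)) \<longlonglongrightarrow> 0"
    using tendsto_add[OF add.IH] by simp
  then show ?case
  proof (rule Lim_null_comparison[rotated])
    show "\<forall>\<^sub>F n in sequentially. norm (\<integral>x. norm (f (x - z n) + g (x - z n) - (f x + g x)) \<partial>lborel)
       \<le> (\<integral>x. norm (f (x - z n) - f x) \<partial>lborel) + (\<integral>x. norm (g (x - z n) - g x) \<partial>lborel)"
    proof (rule always_eventually, rule allI)
      fix n
      have "(\<integral>x. norm (f (x - z n) + g (x - z n) - (f x + g x)) \<partial>lborel) \<le>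
        (\<integral>x. norm (f (x - z n) - f x) + norm (g (x - z n) - g x) \<partial>lborel)"
        by (rule integral_mono) (use add i in \<open>auto simp: add_diff_add norm_triangle_ineq\<close>)
      then show "norm (\<integral>x. norm (f (x - z n) + g (x - z n) - (f x + g x)) \<partial>lborel)
       \<le> (\<integral>x. norm (f (x - z n) - f x) \<partial>lborel) + (\<integral>x. norm (g (x - z n) - g x) \<partial>lborel)"
        using add i by simp
    qed
  qed
next
  case (lim f s)
  show ?case
  proof (rule translate_L1_approx[OF lim.hyps(4)])
    fix e :: real assume e: "e > 0"
    have "(\<lambda>i. \<integral>x. norm (f x - s i x) \<partial>lborel) \<longlonglongrightarrow> (\<integral>x. 0 \<partial>(lborel :: 'a measure))"
    proof (rule integral_dominated_convergence[where w = "\<lambda>x. 3 * norm (f x)"])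
      show "AE x in lborel. (\<lambda>i. norm (f x - s i x)) \<longlonglongrightarrow> 0"
      proof (rule AE_I2)
        fix x :: 'a
        have "(\<lambda>i. s i x) \<longlonglongrightarrow> f x" by (rule lim.hyps) simp
        then have "(\<lambda>i. norm (f x - s i x)) \<longlonglongrightarrow> norm (f x - f x)" by (intro tendsto_intros)
        then show "(\<lambda>i. norm (f x - s i x)) \<longlonglongrightarrow> 0" by simp
      qed
      show "AE x in lborel. norm (norm (f x - s i x)) \<le> 3 * norm (f x)" for i
      proof (rule AE_I2)
        fix x :: 'a
        show "norm (norm (f x - s i x)) \<le> 3 * norm (f x)"
          using norm_triangle_ineq4[of "f x" "s i x"] lim.hyps(3)[of x i] by simp
      qed
    qed (use lim in auto)
    then have "(\<lambda>i. \<integral>x. norm (f x - s i x) \<partial>lborel) \<longlonglongrightarrow> 0" by simp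
    then obtain i where "(\<integral>x. norm (f x - s i x) \<partial>lborel) < e"
      using order_tendstoD(2)[OF _ e] eventually_happens'[OF sequentially_bot] by blast
    then show "\<exists>k. integrable lborel k \<and> (\<integral>x. norm (f x - k x) \<partial>lborel) < e \<and>
        (\<lambda>n. \<integral>x. norm (k (x - z n) - k x) \<partial>lborel) \<longlonglongrightarrow> 0"
      using lim by blast
  qed
qed

section \<open>Mollifiers\<close>

definition mollifier :: "real \<Rightarrow> ('a::euclidean_space \<Rightarrow> real) \<Rightarrow> ('a \<Rightarrow> 'a) \<Rightarrow> bool" where
  "mollifier \<delta> \<eta> \<eta>' \<longleftrightarrow>
    (\<forall>x. (\<eta> has_derivative (\<lambda>h. \<eta>' x \<bullet> h)) (at x)) \<and> continuous_on UNIV \<eta>' \<and>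
    (\<forall>x. \<eta> x \<ge> 0) \<and> (\<forall>x. norm x \<ge> \<delta> \<longrightarrow> \<eta> x = 0 \<and> \<eta>' x = 0) \<and> (\<integral>x. \<eta> x \<partial>lborel) = 1"

text \<open>
  This \<open>C\<^sup>1\<close> function is the building block of the mollifiers and of the cutoff functions.
\<close>

lemma has_real_derivative_pos_part_square:
  "((\<lambda>s. (max 0 s)\<^sup>2) has_real_derivative 2 * max 0 s) (at (s::real))"
proof (cases "s = 0")
  case True
  have "(\<lambda>h. ((max 0 h)\<^sup>2 - 0) / h) = max (0::real)"
    by (auto simp: max_def power2_eq_square fun_eq_iff)
  moreover have "(max (0::real) \<longlongrightarrow> max 0 0) (at 0)" by (intro tendsto_intros)
  ultimately have "((\<lambda>h. ((max 0 h)\<^sup>2 - 0) / h) \<longlongrightarrow> (0::real)) (at 0)" by simp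
  then show ?thesis using True by (simp add: has_field_derivative_iff)
next
  case False
  then consider "s > 0" | "s < 0" by linarith
  then show ?thesis
  proof cases
    case 1
    have "((\<lambda>s. s\<^sup>2) has_real_derivative 2 * max 0 s) (at s)"
      using 1 by (auto intro!: derivative_eq_intros)
    then show ?thesis
      by (rule has_field_derivative_transform_within_open[where S = "{0<..}"]) (use 1 in auto)
  next
    case 2
    have "((\<lambda>s. 0) has_real_derivative 2 * max 0 s) (at s)"
      using 2 by (auto intro!: derivative_eq_intros)
    then show ?thesis
      by (rule has_field_derivative_transform_within_open[where S = "{..<0}"]) (use 2 in auto)
  qed
qed

lemma integrable_continuous_compact_support:
  fixes f :: "'a::euclidean_space \<Rightarrow> 'b::euclidean_space"
  assumes "continuous_on UNIV f" "\<And>x. norm x \<ge> r \<Longrightarrow> f x = 0"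
  shows "integrable lborel f"
proof -
  have "integrable lborel (\<lambda>x. indicator (cball 0 r) x *\<^sub>R f x)"
    using assms(1) by (intro borel_integrable_compact) (auto intro: continuous_on_subset)
  moreover have "(\<lambda>x. indicator (cball 0 r) x *\<^sub>R f x) = f"
    using assms(2) by (auto simp: indicator_def fun_eq_iff)
  ultimately show ?thesis by simp
qed

lemma mollifier_exists:
  assumes \<delta>: "\<delta> > 0"
  shows "\<exists>\<eta> \<eta>'. mollifier \<delta> (\<eta> :: 'a::euclidean_space \<Rightarrow> real) \<eta>'"
proof -
  define c where "c = 1 / \<delta>\<^sup>2"
  define b :: "'a \<Rightarrow> real" where "b x = (max 0 (1 - c * (x \<bullet> x)))\<^sup>2" for x
  define b' :: "'a \<Rightarrow> 'a" where "b' x = (2 * max 0 (1 - c * (x \<bullet> x)) * (- 2 * c)) *\<^sub>R x" for x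
  have d: "(b has_derivative (\<lambda>h. b' x \<bullet> h)) (at x)" for x
  proof -
    have "((\<lambda>s. (max 0 s)\<^sup>2) has_derivative (\<lambda>h. 2 * max 0 (1 - c * (x \<bullet> x)) * h)) (at (1 - c * (x \<bullet> x)))"
      using has_real_derivative_pos_part_square by (auto simp: has_field_derivative_def)
    moreover have "((\<lambda>x. 1 - c * (x \<bullet> x)) has_derivative (\<lambda>h. - 2 * c * (x \<bullet> h))) (at x)"
      by (auto intro!: derivative_eq_intros simp: inner_commute algebra_simps)
    ultimately have "((\<lambda>x. (max 0 (1 - c * (x \<bullet> x)))\<^sup>2) has_derivative
       (\<lambda>h. 2 * max 0 (1 - c * (x \<bullet> x)) * (- 2 * c * (x \<bullet> h)))) (at x)"
      using diff_chain_at by (fastforce simp: o_def)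
    then show ?thesis unfolding b_def[abs_def] b'_def by (simp add: mult.assoc)
  qed
  have z: "b x = 0" "b' x = 0" if "norm x \<ge> \<delta>" for x
  proof -
    have "\<delta>\<^sup>2 \<le> x \<bullet> x" using that \<delta> unfolding power2_norm_eq_inner[symmetric] by (intro power_mono) auto
    then have "1 - c * (x \<bullet> x) \<le> 0" using \<delta> by (simp add: c_def)
    then show "b x = 0" "b' x = 0" by (auto simp: b_def b'_def max_def)
  qed
  have cb: "continuous_on UNIV b" unfolding b_def by (intro continuous_intros)
  have c': "continuous_on UNIV b'" unfolding b'_def by (intro continuous_intros)
  have i: "integrable lborel b" by (rule integrable_continuous_compact_support[OF cb z(1)])
  define Z where "Z = (\<integral>x. b x \<partial>lborel)"
  have "Z > 0"
  proof -
    have "(\<integral>x. indicator (ball (0::'a) (\<delta> / 2)) x * (9/16::real) \<partial>lborel) \<le> Z" unfolding Z_def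
    proof (rule integral_mono)
      show "integrable lborel (\<lambda>x. indicator (ball (0::'a) (\<delta> / 2)) x * (9/16::real))"
        by (intro integrable_mult_left) (auto simp: integrable_indicator_iff emeasure_lborel_ball_finite[unfolded infinity_ennreal_def])
      fix x :: 'a
      show "indicator (ball (0::'a) (\<delta> / 2)) x * (9/16::real) \<le> b x"
      proof (cases "x \<in> ball 0 (\<delta> / 2)")
        case True
        then have "x \<bullet> x \<le> (\<delta> / 2)\<^sup>2" unfolding power2_norm_eq_inner[symmetric] by (intro power_mono) auto
        then have "c * (x \<bullet> x) \<le> 1 / 4" using \<delta> by (simp add: c_def field_simps power2_eq_square)
        then have "(3/4)\<^sup>2 \<le> b x" unfolding b_def by (intro power_mono) auto
        then show ?thesis using True by (simp add: power2_eq_square)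
      qed (simp add: b_def)
    qed (rule i)
    then have "measure lborel (ball (0::'a) (\<delta> / 2)) * (9 / 16) \<le> Z" by simp
    moreover have "measure lborel (ball (0::'a) (\<delta> / 2)) > 0"
      using content_ball_pos[of "\<delta> / 2" "0::'a"] \<delta> by simp
    ultimately show ?thesis by linarith
  qed
  have dZ: "((\<lambda>x. 1 / Z * b x) has_derivative (\<lambda>h. ((1 / Z) *\<^sub>R b' x) \<bullet> h)) (at x)" for x
    by (rule has_derivative_eq_rhs[OF has_derivative_mult_right[OF d]]) simp
  have "1 / Z * b x \<ge> 0" for x using \<open>Z > 0\<close> by (simp add: b_def)
  moreover have "(\<integral>x. 1 / Z * b x \<partial>lborel) = 1" using \<open>Z > 0\<close> by (simp add: Z_def[symmetric])
  ultimately have "mollifier \<delta> (\<lambda>x. 1 / Z * b x) (\<lambda>x. (1 / Z) *\<^sub>R b' x)"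
    unfolding mollifier_def by (intro conjI allI impI dZ continuous_intros c') (simp_all add: z)
  then show ?thesis by blast
qed


lemma compact_support_bounded:
  fixes f :: "'a::euclidean_space \<Rightarrow> 'b::euclidean_space"
  assumes "continuous_on UNIV f" "\<And>x. norm x \<ge> r \<Longrightarrow> f x = 0"
  shows "\<exists>B\<ge>0. \<forall>x. norm (f x) \<le> B"
proof -
  have "bounded (f ` cball 0 r)"
    using assms(1) by (intro compact_imp_bounded compact_continuous_image) (auto intro: continuous_on_subset)
  then obtain B where B: "B > 0" "\<And>x. x \<in> cball 0 r \<Longrightarrow> norm (f x) \<le> B"
    by (auto simp: bounded_pos)
  have "norm (f x) \<le> B" for x
    using B assms(2)[of x] by (cases "norm x \<ge> r") auto
  then show ?thesis using B by (intro exI[of _ B]) auto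
qed

lemma gradient_bounded_lipschitz:
  fixes f :: "'a::euclidean_space \<Rightarrow> real"
  assumes d: "\<And>x. (f has_derivative (\<lambda>h. f' x \<bullet> h)) (at x)" and B: "\<And>x. norm (f' x) \<le> B"
  shows "\<bar>f y - f x\<bar> \<le> B * norm (y - x)"
proof -
  have "norm (f y - f x) \<le> B * norm (y - x)"
  proof (rule differentiable_bound[of UNIV f "\<lambda>x h. f' x \<bullet> h"])
    show "onorm (\<lambda>h. f' x \<bullet> h) \<le> B" for x
    proof (rule onorm_bound)
      show "B \<ge> 0" using B[of x] norm_ge_zero order_trans by blast
      show "norm (f' x \<bullet> h) \<le> B * norm h" for h
        using Cauchy_Schwarz_ineq2[of "f' x" h] mult_right_mono[OF B[of x], of "norm h"] by simp
    qed
  qed (use d in auto)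
  then show ?thesis by simp
qed

text \<open>
  By translation invariance the difference quotients of \<open>\<psi>\<close> have integral zero; they converge
  boundedly to the derivative.
\<close>

lemma integral_gradient_zero:
  fixes \<psi> :: "'a::euclidean_space \<Rightarrow> real"
  assumes d: "\<And>x. (\<psi> has_derivative (\<lambda>h. \<psi>' x \<bullet> h)) (at x)" and B: "\<And>x. norm (\<psi>' x) \<le> B"
    and z: "\<And>x. norm x \<ge> r \<Longrightarrow> \<psi> x = 0" and m[measurable]: "\<psi>' \<in> borel_measurable borel"
  shows "(\<integral>x. \<psi>' x \<partial>lborel) = 0"
proof -
  have cont: "continuous_on UNIV \<psi>"
    using d by (meson continuous_at_imp_continuous_on has_derivative_continuous)
  then have [measurable]: "\<psi> \<in> borel_measurable borel" by (rule borel_measurable_continuous_onI)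
  have i\<psi>: "integrable lborel \<psi>" by (rule integrable_continuous_compact_support[OF cont z])
  have B0: "B \<ge> 0" using B[of 0] norm_ge_zero order_trans by blast
  have z': "\<psi>' x = 0" if "norm x > r" for x
  proof -
    have "((\<lambda>x. 0) has_derivative (\<lambda>h. \<psi>' x \<bullet> h)) (at x)"
      by (rule has_derivative_transform_within_open[OF d open_Compl[OF closed_cball[of 0 r]]])
        (use that z in \<open>auto intro: less_imp_le\<close>)
    then have "(\<lambda>h. \<psi>' x \<bullet> h) = (\<lambda>h. 0)"
      using has_derivative_const has_derivative_unique by blast
    then have "\<psi>' x \<bullet> \<psi>' x = 0" by metis
    then show ?thesis by simp
  qed
  let ?c = "\<lambda>x. indicator (cball (0::'a) (\<bar>r\<bar> + 1)) x * B :: real"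
  have ic: "integrable lborel ?c"
    by (auto simp: integrable_indicator_iff emeasure_lborel_cball_finite[unfolded infinity_ennreal_def])
  have i\<psi>': "integrable lborel \<psi>'"
    by (rule Bochner_Integration.integrable_bound[OF ic]) (use B B0 z' in \<open>auto simp: indicator_def intro!: AE_I2\<close>)
  show ?thesis
  proof (rule euclidean_eqI)
    fix b :: 'a assume b: "b \<in> Basis"
    define t where "t n = inverse (real (Suc n))" for n
    have t: "t n > 0" "t n \<le> 1" for n by (auto simp: t_def field_simps)
    have t0: "t \<longlonglongrightarrow> 0" unfolding t_def by (rule LIMSEQ_inverse_real_of_nat)
    let ?q = "\<lambda>n x. (\<psi> (x - (- t n) *\<^sub>R b) - \<psi> x) / t n"
    have "(\<lambda>n. \<integral>x. ?q n x \<partial>lborel) \<longlonglongrightarrow> (\<integral>x. \<psi>' x \<bullet> b \<partial>lborel)"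
    proof (rule integral_dominated_convergence[OF _ _ ic])
      show "AE x in lborel. (\<lambda>n. ?q n x) \<longlonglongrightarrow> \<psi>' x \<bullet> b"
      proof (rule AE_I2)
        fix x
        have "((\<lambda>s. \<psi> (x + s *\<^sub>R b)) has_derivative (\<lambda>s. \<psi>' (x + 0 *\<^sub>R b) \<bullet> (s *\<^sub>R b))) (at 0)"
          by (rule has_derivative_compose[OF _ d]) (auto intro!: derivative_eq_intros)
        then have "((\<lambda>s. \<psi> (x + s *\<^sub>R b)) has_real_derivative \<psi>' x \<bullet> b) (at 0)"
          unfolding has_field_derivative_def by (rule has_derivative_eq_rhs) (auto simp: fun_eq_iff mult.commute)
        then have "((\<lambda>s. (\<psi> (x + s *\<^sub>R b) - \<psi> x) / s) \<longlongrightarrow> \<psi>' x \<bullet> b) (at 0)"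
          by (simp add: has_field_derivative_iff)
        moreover have "filterlim t (at 0) sequentially"
          using t0 t by (auto simp: filterlim_at less_imp_neq[symmetric])
        ultimately have "(\<lambda>n. (\<psi> (x + t n *\<^sub>R b) - \<psi> x) / t n) \<longlonglongrightarrow> \<psi>' x \<bullet> b"
          by (rule filterlim_compose)
        then show "(\<lambda>n. ?q n x) \<longlonglongrightarrow> \<psi>' x \<bullet> b" by simp
      qed
      show "AE x in lborel. norm (?q n x) \<le> ?c x" for n
      proof (rule AE_I2)
        fix x
        have nb: "norm (t n *\<^sub>R b) \<le> 1" using t[of n] b by simp
        show "norm (?q n x) \<le> ?c x"
        proof (cases "norm x \<le> \<bar>r\<bar> + 1")
          case True
          have "\<bar>\<psi> (x + t n *\<^sub>R b) - \<psi> x\<bar> \<le> B * t n"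
            using gradient_bounded_lipschitz[OF d B, of "x + t n *\<^sub>R b" x] b t[of n] by simp
          then show ?thesis using True t[of n] by (simp add: field_simps)
        next
          case False
          have "norm x \<le> norm (x + t n *\<^sub>R b) + norm (t n *\<^sub>R b)"
            by (metis add_diff_cancel_right' norm_triangle_ineq4)
          then have "norm (x + t n *\<^sub>R b) \<ge> r" using False nb by linarith
          then show ?thesis using False z[of x] z[of "x + t n *\<^sub>R b"] by simp
        qed
      qed
    qed (measurable)
    moreover have "(\<integral>x. ?q n x \<partial>lborel) = 0" for n
    proof -
      have "integrable lborel (\<lambda>x. \<psi> (x - (- t n) *\<^sub>R b))" using i\<psi> by (subst integrable_translate_iff) auto
      moreover have "(\<integral>x. \<psi> (x - (- t n) *\<^sub>R b) \<partial>lborel) = (\<integral>x. \<psi> x \<partial>lborel)" by (rule integral_translate) simp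
      ultimately show ?thesis using i\<psi> by simp
    qed
    ultimately have "(\<lambda>n. 0) \<longlonglongrightarrow> (\<integral>x. \<psi>' x \<bullet> b \<partial>lborel)" by (simp only:)
    then have "(\<integral>x. \<psi>' x \<bullet> b \<partial>lborel) = 0" by (simp add: LIMSEQ_const_iff)
    then show "(\<integral>x. \<psi>' x \<partial>lborel) \<bullet> b = 0 \<bullet> b" using i\<psi>' by simp
  qed
qed

definition mollify :: "('a::euclidean_space \<Rightarrow> real) \<Rightarrow> ('a \<Rightarrow> 'b::euclidean_space) \<Rightarrow> 'a \<Rightarrow> 'b" where
  "mollify \<eta> f x = (\<integral>y. \<eta> (x - y) *\<^sub>R f y \<partial>lborel)"

lemma mollifierD:
  assumes "mollifier \<delta> \<eta> \<eta>'"
  shows "(\<eta> has_derivative (\<lambda>h. \<eta>' x \<bullet> h)) (at x)" "continuous_on UNIV \<eta>'" "\<eta> x \<ge> 0"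
    "norm x \<ge> \<delta> \<Longrightarrow> \<eta> x = 0" "norm x \<ge> \<delta> \<Longrightarrow> \<eta>' x = 0" "(\<integral>x. \<eta> x \<partial>lborel) = 1"
    "continuous_on UNIV \<eta>" "\<eta> \<in> borel_measurable borel" "\<eta>' \<in> borel_measurable borel" "integrable lborel \<eta>"
    "\<exists>B\<ge>0. \<forall>x. norm (\<eta>' x) \<le> B" "\<exists>B\<ge>0. \<forall>x. \<bar>\<eta> x\<bar> \<le> B"
proof -
  note m = assms[unfolded mollifier_def]
  show d: "(\<eta> has_derivative (\<lambda>h. \<eta>' x \<bullet> h)) (at x)" for x using m by blast
  show c': "continuous_on UNIV \<eta>'" "\<eta> x \<ge> 0" "(\<integral>x. \<eta> x \<partial>lborel) = 1" using m by auto
  show z: "norm x \<ge> \<delta> \<Longrightarrow> \<eta> x = 0" "norm x \<ge> \<delta> \<Longrightarrow> \<eta>' x = 0" for x using m by auto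
  show c: "continuous_on UNIV \<eta>" using d by (meson continuous_at_imp_continuous_on has_derivative_continuous)
  show "\<eta> \<in> borel_measurable borel" "\<eta>' \<in> borel_measurable borel"
    using c c' by (auto intro: borel_measurable_continuous_onI)
  show "integrable lborel \<eta>" by (rule integrable_continuous_compact_support[OF c z(1)])
  show "\<exists>B\<ge>0. \<forall>x. norm (\<eta>' x) \<le> B" by (rule compact_support_bounded[OF c'(1) z(2)])
  show "\<exists>B\<ge>0. \<forall>x. \<bar>\<eta> x\<bar> \<le> B" using compact_support_bounded[OF c z(1)] by simp
qed

lemma integrable_bounded_scaleR:
  fixes f :: "'a \<Rightarrow> 'b::{banach, second_countable_topology}" and k :: "'a \<Rightarrow> real"
  assumes "integrable M f" "k \<in> borel_measurable M" "\<And>x. \<bar>k x\<bar> \<le> B"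
  shows "integrable M (\<lambda>x. k x *\<^sub>R f x)"
proof (rule Bochner_Integration.integrable_bound)
  show "integrable M (\<lambda>x. B *\<^sub>R f x)" using assms by simp
  show "AE x in M. norm (k x *\<^sub>R f x) \<le> norm (B *\<^sub>R f x)"
    using assms(3) by (auto intro!: AE_I2 mult_right_mono order_trans[OF assms(3)])
qed (use assms in auto)

lemma integrable_scaleR_bounded:
  fixes f :: "'a \<Rightarrow> real" and k :: "'a \<Rightarrow> 'b::{banach, second_countable_topology}"
  assumes "integrable M f" "k \<in> borel_measurable M" "\<And>x. norm (k x) \<le> B"
  shows "integrable M (\<lambda>x. f x *\<^sub>R k x)"
proof (rule Bochner_Integration.integrable_bound)
  show "integrable M (\<lambda>x. B * f x)" using assms by simp
  show "AE x in M. norm (f x *\<^sub>R k x) \<le> norm (B * f x)"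
  proof (rule AE_I2)
    fix x
    have "\<bar>f x\<bar> * norm (k x) \<le> \<bar>f x\<bar> * \<bar>B\<bar>" using assms(3)[of x] by (intro mult_left_mono) auto
    then show "norm (f x *\<^sub>R k x) \<le> norm (B * f x)" by (simp add: abs_mult mult.commute)
  qed
qed (use assms in auto)

text \<open>
  Differentiation under the integral sign; the Lipschitz constant of \<open>\<eta>\<close> provides the majorant.
\<close>

lemma mollify_has_derivative:
  fixes f :: "'a::euclidean_space \<Rightarrow> real"
  assumes \<eta>: "mollifier \<delta> \<eta> \<eta>'" and f: "integrable lborel f"
  shows "(mollify \<eta> f has_derivative (\<lambda>h. (\<integral>y. f y *\<^sub>R \<eta>' (x - y) \<partial>lborel) \<bullet> h)) (at x)"
proof -
  note md = mollifierD[OF \<eta>]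
  note [measurable] = md(8,9) borel_measurable_integrable[OF f, simplified]
  obtain B where B: "B \<ge> 0" "\<And>x. norm (\<eta>' x) \<le> B" using md(11) by blast
  obtain B2 where B2: "\<And>x. \<bar>\<eta> x\<bar> \<le> B2" using md(12) by blast
  let ?F' = "\<integral>y. f y *\<^sub>R \<eta>' (x - y) \<partial>lborel"
  have i1: "integrable lborel (\<lambda>y. \<eta> (w - y) * f y)" for w
    using integrable_bounded_scaleR[OF f, of "\<lambda>y. \<eta> (w - y)" B2] B2 by simp
  have i2: "integrable lborel (\<lambda>y. f y *\<^sub>R \<eta>' (x - y))"
    by (rule integrable_scaleR_bounded[OF f _ B(2)]) simp
  have "((\<lambda>h. norm (mollify \<eta> f (x + h) - mollify \<eta> f x - ?F' \<bullet> h) / norm h) \<longlongrightarrow> 0) (at 0)"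
    unfolding tendsto_at_iff_sequentially comp_def
  proof (intro allI impI)
    fix h :: "nat \<Rightarrow> 'a" assume h: "\<forall>i. h i \<in> UNIV - {0}" "h \<longlonglongrightarrow> 0"
    let ?q = "\<lambda>n y. (\<eta> (x - y + h n) - \<eta> (x - y) - \<eta>' (x - y) \<bullet> h n) / norm (h n)"
    have "(\<lambda>n. \<integral>y. f y * ?q n y \<partial>lborel) \<longlonglongrightarrow> (\<integral>y. 0 \<partial>(lborel :: 'a measure))"
    proof (rule integral_dominated_convergence[where w = "\<lambda>y. \<bar>f y\<bar> * (2 * B)"])
      show "AE y in lborel. (\<lambda>n. f y * ?q n y) \<longlonglongrightarrow> 0"
      proof (rule AE_I2)
        fix y
        have "((\<lambda>h. norm (\<eta> (x - y + h) - \<eta> (x - y) - \<eta>' (x - y) \<bullet> h) / norm h) \<longlongrightarrow> 0) (at 0)"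
          using md(1)[of "x - y"] unfolding has_derivative_at by blast
        moreover have "filterlim h (at 0) sequentially" using h by (auto simp: filterlim_at)
        ultimately have "(\<lambda>n. norm (\<eta> (x - y + h n) - \<eta> (x - y) - \<eta>' (x - y) \<bullet> h n) / norm (h n)) \<longlonglongrightarrow> 0"
          by (rule filterlim_compose)
        then have "(\<lambda>n. ?q n y) \<longlonglongrightarrow> 0"
          by (intro tendsto_norm_zero_cancel[of "\<lambda>n. ?q n y"]) simp
        then show "(\<lambda>n. f y * ?q n y) \<longlonglongrightarrow> 0" by (rule tendsto_mult_right_zero)
      qed
      show "AE y in lborel. norm (f y * ?q n y) \<le> \<bar>f y\<bar> * (2 * B)" for n
      proof (rule AE_I2)
        fix y
        have "\<bar>\<eta> (x - y + h n) - \<eta> (x - y)\<bar> \<le> B * norm (h n)"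
          using gradient_bounded_lipschitz[OF md(1) B(2), of "x - y + h n" "x - y"] by simp
        moreover have "\<bar>\<eta>' (x - y) \<bullet> h n\<bar> \<le> B * norm (h n)"
          using Cauchy_Schwarz_ineq2[of "\<eta>' (x - y)" "h n"] mult_right_mono[OF B(2)[of "x - y"], of "norm (h n)"] by simp
        ultimately have "\<bar>?q n y\<bar> \<le> 2 * B"
          using h(1) by (simp add: field_simps)
        then have "\<bar>f y\<bar> * \<bar>?q n y\<bar> \<le> \<bar>f y\<bar> * (2 * B)" by (intro mult_left_mono) auto
        then show "norm (f y * ?q n y) \<le> \<bar>f y\<bar> * (2 * B)" by (simp only: real_norm_def abs_mult)
      qed
    qed (use f in auto)
    moreover have "(\<integral>y. f y * ?q n y \<partial>lborel) =
       (mollify \<eta> f (x + h n) - mollify \<eta> f x - ?F' \<bullet> h n) / norm (h n)" for n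
    proof -
      have i3: "integrable lborel (\<lambda>y. (f y *\<^sub>R \<eta>' (x - y)) \<bullet> h n)"
        using i2 by (intro integrable_inner_left) auto
      have "(\<integral>y. f y * ?q n y \<partial>lborel) =
        (\<integral>y. (\<eta> (x + h n - y) * f y - \<eta> (x - y) * f y - (f y *\<^sub>R \<eta>' (x - y)) \<bullet> h n) / norm (h n) \<partial>lborel)"
        by (intro Bochner_Integration.integral_cong) (auto simp: algebra_simps)
      also have "\<dots> = (\<integral>y. \<eta> (x + h n - y) * f y - \<eta> (x - y) * f y - (f y *\<^sub>R \<eta>' (x - y)) \<bullet> h n \<partial>lborel) / norm (h n)"
        by (rule integral_divide_zero)
      also have "(\<integral>y. \<eta> (x + h n - y) * f y - \<eta> (x - y) * f y - (f y *\<^sub>R \<eta>' (x - y)) \<bullet> h n \<partial>lborel) =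
        mollify \<eta> f (x + h n) - mollify \<eta> f x - (\<integral>y. (f y *\<^sub>R \<eta>' (x - y)) \<bullet> h n \<partial>lborel)"
        unfolding mollify_def real_scaleR_def
        by (simp only: Bochner_Integration.integral_diff[OF Bochner_Integration.integrable_diff[OF i1 i1] i3]
              Bochner_Integration.integral_diff[OF i1 i1])
      also have "(\<integral>y. (f y *\<^sub>R \<eta>' (x - y)) \<bullet> h n \<partial>lborel) = ?F' \<bullet> h n"
        using i2 by (intro integral_inner_left)  auto
      finally show ?thesis .
    qed
    ultimately have "(\<lambda>n. (mollify \<eta> f (x + h n) - mollify \<eta> f x - ?F' \<bullet> h n) / norm (h n)) \<longlonglongrightarrow> 0"
      by (simp only: Bochner_Integration.integral_zero)
    from tendsto_norm_zero[OF this]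
    show "(\<lambda>n. norm (mollify \<eta> f (x + h n) - mollify \<eta> f x - ?F' \<bullet> h n) / norm (h n)) \<longlonglongrightarrow> 0" by simp
  qed
  then show ?thesis unfolding has_derivative_at by (auto intro: bounded_linear_inner_right)
qed

text \<open>
  The difference \<open>mollify (\<eta> n) f x - f x\<close> is an average of \<open>f (x - z) - f x\<close> over small \<open>z\<close>. Exchange
  the integrals over \<open>x\<close> and \<open>z\<close> and use the continuity of translations.
\<close>

lemma mollify_L1:
  fixes f :: "'a::euclidean_space \<Rightarrow> 'b::euclidean_space"
  assumes \<eta>: "\<And>n. mollifier (\<delta> n) (\<eta> n) (\<eta>' n)" and \<delta>: "\<delta> \<longlonglongrightarrow> 0" and f: "integrable lborel f"
  shows "\<And>n. integrable lborel (\<lambda>x. mollify (\<eta> n) f x - f x)"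
    and "(\<lambda>n. \<integral>x. norm (mollify (\<eta> n) f x - f x) \<partial>lborel) \<longlonglongrightarrow> 0"
proof -
  note md = mollifierD[OF \<eta>]
  have [measurable]: "\<And>n. \<eta> n \<in> borel_measurable borel" "f \<in> borel_measurable borel"
    using md(8) borel_measurable_integrable[OF f] by auto
  have [measurable]: "mollify (\<eta> n) f \<in> borel_measurable borel" for n
    unfolding mollify_def[abs_def] by measurable
  define \<tau> where "\<tau> z = (\<integral>x. norm (f (x - z) - f x) \<partial>lborel)" for z
  have fi: "integrable lborel (\<lambda>x. f (x - z))" for z using f by (simp add: integrable_translate_iff)
  have "(\<tau> \<longlongrightarrow> 0) (at 0)"
    unfolding tendsto_at_iff_sequentially comp_def \<tau>_def using translate_L1[OF f] by blast
  then have small: "\<exists>d>0. \<forall>z. norm z < d \<longrightarrow> \<tau> z < e" if "e > 0" for e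
  proof -
    have "\<forall>\<^sub>F z in at 0. \<tau> z < e" using \<open>(\<tau> \<longlongrightarrow> 0) (at 0)\<close> that by (rule order_tendstoD)
    then obtain d where d: "d > 0" "\<And>z. z \<noteq> 0 \<Longrightarrow> norm z < d \<Longrightarrow> \<tau> z < e"
      by (auto simp: eventually_at)
    moreover have "\<tau> 0 < e" using that by (simp add: \<tau>_def)
    ultimately show ?thesis by metis
  qed
  have key: "(\<integral>\<^sup>+x. norm (mollify (\<eta> n) f x - f x) \<partial>lborel) \<le> e"
    if e: "e \<ge> 0" and d: "\<And>z. norm z < \<delta> n \<Longrightarrow> \<tau> z \<le> e" for n e
  proof -
    obtain B where B: "\<And>x. \<bar>\<eta> n x\<bar> \<le> B" using md(12) by blast
    have pt: "ennreal (norm (mollify (\<eta> n) f x - f x)) \<le> (\<integral>\<^sup>+z. ennreal (\<eta> n z * norm (f (x - z) - f x)) \<partial>lborel)" for x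
    proof -
      have i0: "integrable lborel (\<lambda>z. f (x - z))" using f by (simp add: integrable_reflect_iff)
      have i1: "integrable lborel (\<lambda>z. \<eta> n z *\<^sub>R f (x - z))"
        by (rule integrable_bounded_scaleR[OF i0 _ B]) simp
      have i2: "integrable lborel (\<lambda>z. \<eta> n z *\<^sub>R f x)"
        using md(10) by simp
      have "mollify (\<eta> n) f x = (\<integral>z. \<eta> n z *\<^sub>R f (x - z) \<partial>lborel)"
        unfolding mollify_def using integral_reflect[of "\<lambda>z. \<eta> n z *\<^sub>R f (x - z)" x] by simp
      then have "mollify (\<eta> n) f x - f x = (\<integral>z. \<eta> n z *\<^sub>R f (x - z) \<partial>lborel) - (\<integral>z. \<eta> n z *\<^sub>R f x \<partial>lborel)"
        using md(6,10) by simp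
      also have "\<dots> = (\<integral>z. \<eta> n z *\<^sub>R (f (x - z) - f x) \<partial>lborel)"
        using i1 i2 by (simp add: scaleR_diff_right)
      finally have "ennreal (norm (mollify (\<eta> n) f x - f x)) \<le> (\<integral>\<^sup>+z. norm (\<eta> n z *\<^sub>R (f (x - z) - f x)) \<partial>lborel)"
        using i1 i2 by (simp only:) (intro integral_norm_bound_ennreal, simp add: scaleR_diff_right)
      then show ?thesis using md(3)[of n] by simp
    qed
    have "(\<integral>\<^sup>+x. norm (mollify (\<eta> n) f x - f x) \<partial>lborel) \<le>
      (\<integral>\<^sup>+x. \<integral>\<^sup>+z. ennreal (\<eta> n z * norm (f (x - z) - f x)) \<partial>lborel \<partial>lborel)"
      by (rule nn_integral_mono) (rule pt)
    also have "\<dots> = (\<integral>\<^sup>+z. \<integral>\<^sup>+x. ennreal (\<eta> n z * norm (f (x - z) - f x)) \<partial>lborel \<partial>lborel)"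
      by (rule lborel_pair.Fubini') measurable
    also have "\<dots> \<le> (\<integral>\<^sup>+z. ennreal e * ennreal (\<eta> n z) \<partial>lborel)"
    proof (rule nn_integral_mono)
      fix z :: 'a
      have "(\<integral>\<^sup>+x. ennreal (\<eta> n z * norm (f (x - z) - f x)) \<partial>lborel) = ennreal (\<eta> n z * \<tau> z)"
        unfolding \<tau>_def using fi f md(3)[of n z]
        by (subst nn_integral_eq_integral) auto
      also have "\<dots> \<le> ennreal (e * \<eta> n z)"
      proof (cases "norm z < \<delta> n")
        case True
        then show ?thesis using d[OF True] md(3)[of n z] by (intro ennreal_leI) (simp add: mult.commute mult_right_mono)
      qed (use md(4)[of n z] in auto)
      finally show "(\<integral>\<^sup>+x. ennreal (\<eta> n z * norm (f (x - z) - f x)) \<partial>lborel) \<le> ennreal e * ennreal (\<eta> n z)"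
        using e md(3)[of n z] by (simp add: ennreal_mult)
    qed
    also have "\<dots> = ennreal e * ennreal (\<integral>z. \<eta> n z \<partial>lborel)"
      using md(3,10) by (subst nn_integral_cmult) (auto simp: nn_integral_eq_integral)
    finally show ?thesis using md(6) by simp
  qed
  show int: "integrable lborel (\<lambda>x. mollify (\<eta> n) f x - f x)" for n
  proof -
    \<comment> \<open>A bound for \<open>\<tau>\<close> everywhere, which \<open>key\<close> turns into integrability.\<close>
    define e where "e = 2 * (\<integral>x. norm (f x) \<partial>lborel)"
    have "\<tau> z \<le> e" for z
    proof -
      have "\<tau> z \<le> (\<integral>x. norm (f (x - z)) + norm (f x) \<partial>lborel)"
        unfolding \<tau>_def using f fi by (intro integral_mono) (auto intro: norm_triangle_ineq4)
      also have "\<dots> = e" using f fi integral_translate[of "\<lambda>x. norm (f x)" z] by (simp add: e_def)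
      finally show ?thesis .
    qed
    moreover have "e \<ge> 0" by (simp add: e_def)
    ultimately have "(\<integral>\<^sup>+x. norm (mollify (\<eta> n) f x - f x) \<partial>lborel) < \<infinity>"
      using key[of e n] by (metis ennreal_less_top infinity_ennreal_def order_le_less_trans)
    then show ?thesis by (intro integrableI_bounded) auto
  qed
  show "(\<lambda>n. \<integral>x. norm (mollify (\<eta> n) f x - f x) \<partial>lborel) \<longlonglongrightarrow> 0"
  proof (rule LIMSEQ_I)
    fix e :: real assume e: "e > 0"
    obtain d where d: "d > 0" "\<And>z. norm z < d \<Longrightarrow> \<tau> z < e / 2" using small[of "e / 2"] e by auto
    obtain N where N: "\<And>n. n \<ge> N \<Longrightarrow> \<delta> n < d"
      using order_tendstoD(2)[OF \<delta> d(1)] by (auto simp: eventually_sequentially)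
    have "norm ((\<integral>x. norm (mollify (\<eta> n) f x - f x) \<partial>lborel) - 0) < e" if "n \<ge> N" for n
    proof -
      have "ennreal (\<integral>x. norm (mollify (\<eta> n) f x - f x) \<partial>lborel) = (\<integral>\<^sup>+x. norm (mollify (\<eta> n) f x - f x) \<partial>lborel)"
        using int[of n] by (intro nn_integral_eq_integral[symmetric]) auto
      also have "\<dots> \<le> ennreal (e / 2)"
        using N[OF that] d(2) e by (intro key) (auto intro: less_imp_le)
      finally have "(\<integral>x. norm (mollify (\<eta> n) f x - f x) \<partial>lborel) \<le> e / 2" using e by simp
      then show ?thesis using e by simp
    qed
    then show "\<exists>N. \<forall>n\<ge>N. norm ((\<integral>x. norm (mollify (\<eta> n) f x - f x) \<partial>lborel) - 0) < e" by blast
  qed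
qed


section \<open>Test functions\<close>

lemma gradient_eqI:
  fixes \<phi> :: "'a::euclidean_space \<Rightarrow> real"
  assumes "(\<phi> has_derivative (\<lambda>h. v \<bullet> h)) (at x)"
  shows "gradient \<phi> x = v"
  unfolding gradient_def frechet_derivative_at[OF assms, symmetric] by (rule euclidean_representation)

lemma has_derivative_gradient:
  fixes \<phi> :: "'a::euclidean_space \<Rightarrow> real"
  assumes "(\<phi> has_derivative D) (at x)"
  shows "(\<phi> has_derivative (\<lambda>h. gradient \<phi> x \<bullet> h)) (at x)"
proof -
  have "D h = gradient \<phi> x \<bullet> h" for h
  proof -
    interpret D: bounded_linear D using assms by (rule has_derivative_bounded_linear)
    have "D h = D (\<Sum>b\<in>Basis. (h \<bullet> b) *\<^sub>R b)" by (simp add: euclidean_representation)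
    also have "\<dots> = (\<Sum>b\<in>Basis. D b * (b \<bullet> h))" by (simp add: D.sum D.scaleR inner_commute mult.commute)
    also have "\<dots> = gradient \<phi> x \<bullet> h"
      unfolding gradient_def frechet_derivative_at[OF assms, symmetric] by (simp add: inner_sum_left)
    finally show ?thesis .
  qed
  then have "D = (\<lambda>h. gradient \<phi> x \<bullet> h)" by (rule ext)
  then show ?thesis using assms by simp
qed

lemma C1cD:
  fixes \<phi> :: "'a::euclidean_space \<Rightarrow> real"
  assumes "\<phi> \<in> C1c \<Omega>"
  shows "(\<phi> has_derivative (\<lambda>h. gradient \<phi> x \<bullet> h)) (at x)" "continuous_on UNIV (gradient \<phi>)"
    "continuous_on UNIV \<phi>" "compact (support \<phi>)" "support \<phi> \<subseteq> \<Omega>"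
    "x \<notin> support \<phi> \<Longrightarrow> \<phi> x = 0" "x \<notin> support \<phi> \<Longrightarrow> gradient \<phi> x = 0"
proof -
  obtain \<phi>' :: "'a \<Rightarrow> 'a \<Rightarrow>\<^sub>L real" where c': "continuous_on UNIV \<phi>'"
    and d: "\<And>x. (\<phi> has_derivative blinfun_apply (\<phi>' x)) (at x)"
    using assms by (auto simp: C1c_def C1_closure_def)
  show d': "(\<phi> has_derivative (\<lambda>h. gradient \<phi> x \<bullet> h)) (at x)" for x
    by (rule has_derivative_gradient[OF d])
  have "gradient \<phi> = (\<lambda>x. \<Sum>b\<in>Basis. \<phi>' x b *\<^sub>R b)"
    unfolding gradient_def frechet_derivative_at[OF d, symmetric] ..
  then show "continuous_on UNIV (gradient \<phi>)" by (simp) (intro continuous_intros c')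
  show "continuous_on UNIV \<phi>" "compact (support \<phi>)" "support \<phi> \<subseteq> \<Omega>"
    using assms by (auto simp: C1c_def C1_closure_def)
  show z: "\<phi> x = 0" if "x \<notin> support \<phi>" for x
    using that closure_subset[of "{x. \<phi> x \<noteq> 0}"] by (auto simp: support_def)
  show "gradient \<phi> x = 0" if "x \<notin> support \<phi>"
  proof (rule gradient_eqI)
    have o: "open (- support \<phi>)" unfolding support_def by (rule open_Compl) (rule closed_closure)
    have "((\<lambda>x. 0) has_derivative (\<lambda>h. 0 \<bullet> h)) (at x)" by simp
    then show "(\<phi> has_derivative (\<lambda>h. 0 \<bullet> h)) (at x)"
      by (rule has_derivative_transform_within_open[OF _ o]) (use that z in auto)
  qed
qed

lemma C1cI:
  fixes \<phi> :: "'a::euclidean_space \<Rightarrow> real"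
  assumes d: "\<And>x. (\<phi> has_derivative (\<lambda>h. \<phi>' x \<bullet> h)) (at x)" and c: "continuous_on UNIV \<phi>'"
    and K: "compact K" "K \<subseteq> \<Omega>" "\<And>x. x \<notin> K \<Longrightarrow> \<phi> x = 0"
  shows "\<phi> \<in> C1c \<Omega>"
proof -
  have "support \<phi> \<subseteq> K"
    unfolding support_def using K by (intro closure_minimal compact_imp_closed) auto
  moreover from this have "compact (support \<phi>)"
    using K(1) by (metis compact_Int_closed closed_closure inf.absorb2 support_def)
  moreover have "C1_closure UNIV \<phi>"
    unfolding C1_closure_def
  proof (intro conjI exI[of _ "\<lambda>x. blinfun_inner_right (\<phi>' x)"])
    show "continuous_on (closure UNIV) \<phi>"
      using d by (meson continuous_at_imp_continuous_on has_derivative_continuous)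
    show "continuous_on (closure UNIV) (\<lambda>x. blinfun_inner_right (\<phi>' x))"
      using c by (simp add: bounded_linear.continuous_on[OF bounded_linear_blinfun_inner_right])
  qed (use d in auto)
  ultimately show ?thesis using K(2) by (auto simp: C1c_def)
qed

lemma C1c_bounded:
  fixes \<phi> :: "'a::euclidean_space \<Rightarrow> real"
  assumes "\<phi> \<in> C1c \<Omega>"
  shows "\<exists>r B. B \<ge> 0 \<and> (\<forall>x. norm x \<ge> r \<longrightarrow> \<phi> x = 0 \<and> gradient \<phi> x = 0) \<and>
    (\<forall>x. \<bar>\<phi> x\<bar> \<le> B) \<and> (\<forall>x. norm (gradient \<phi> x) \<le> B)"
proof -
  note C = C1cD[OF assms]
  obtain r where r: "\<And>x. x \<in> support \<phi> \<Longrightarrow> norm x \<le> r"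
    using compact_imp_bounded[OF C(4)] unfolding bounded_iff by blast
  have z: "\<phi> x = 0" "gradient \<phi> x = 0" if "norm x \<ge> r + 1" for x
  proof -
    have "x \<notin> support \<phi>" using r[of x] that by auto
    then show "\<phi> x = 0" "gradient \<phi> x = 0" using C by auto
  qed
  obtain B1 where "B1 \<ge> 0" "\<And>x. norm (\<phi> x) \<le> B1" using compact_support_bounded[OF C(3) z(1)] by blast
  moreover obtain B2 where "B2 \<ge> 0" "\<And>x. norm (gradient \<phi> x) \<le> B2" using compact_support_bounded[OF C(2) z(2)] by blast
  ultimately show ?thesis
    using z by (intro exI[of _ "r + 1"] exI[of _ "B1 + B2"]) (auto intro: add_increasing add_increasing2)
qed

section \<open>The weak chain rule\<close>

text \<open>
  \<open>f\<close> is the pointwise limit of its restrictions to an exhaustion of \<open>\<Omega>\<close> by compact sets.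
\<close>

lemma locally_integrable_measurable:
  assumes "open \<Omega>" "locally_integrable \<Omega> f"
  shows "f \<in> borel_measurable (lebesgue_on \<Omega>)"
proof -
  obtain C where C: "\<And>n. compact (C n)" "\<And>n. C n \<subseteq> \<Omega>" "\<And>n. C n \<subseteq> interior (C (Suc n))"
    "\<Union>(range C) = \<Omega>" "\<And>K. \<lbrakk>compact K; K \<subseteq> \<Omega>\<rbrakk> \<Longrightarrow> \<exists>N. \<forall>n\<ge>N. K \<subseteq> C n"
    using open_Union_compact_subsets[OF assms(1)] by blast
  show ?thesis
  proof (rule borel_measurable_LIMSEQ_metric)
    fix n
    have "set_integrable lebesgue (C n) f" using assms(2) C by (auto simp: locally_integrable_def)
    then show "(\<lambda>x. indicator (C n) x *\<^sub>R f x) \<in> borel_measurable (lebesgue_on \<Omega>)"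
      unfolding set_integrable_def by (intro measurable_restrict_space1 borel_measurable_integrable)
  next
    fix x assume "x \<in> space (lebesgue_on \<Omega>)"
    then obtain N where N: "\<forall>n\<ge>N. {x} \<subseteq> C n" using C(5)[of "{x}"] by auto
    have "eventually (\<lambda>n. indicator (C n) x *\<^sub>R f x = f x) sequentially"
      using N by (intro eventually_sequentiallyI[of N]) auto
    then show "(\<lambda>n. indicator (C n) x *\<^sub>R f x) \<longlonglongrightarrow> f x" by (rule tendsto_eventually)
  qed
qed

lemma has_weak_gradient_measurable:
  assumes "open \<Omega>" "has_weak_gradient \<Omega> f g"
  shows "f \<in> borel_measurable (lebesgue_on \<Omega>)" "g \<in> borel_measurable (lebesgue_on \<Omega>)"
  using assms by (auto simp: has_weak_gradient_def intro: locally_integrable_measurable)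

text \<open>
  Fubini's theorem is applied to the product of \<open>lborel\<close> with itself (in \<open>mollify_L1\<close>), so Lebesgue
  measurable functions are replaced by Borel measurable ones.
\<close>

lemma integrable_lebesgue_borel_representative:
  fixes f :: "'a::euclidean_space \<Rightarrow> 'b::euclidean_space"
  assumes "integrable lebesgue f"
  obtains f' where "integrable lborel f'" "f' \<in> borel_measurable borel" "AE x in lebesgue. f x = f' x"
proof -
  have "\<forall>b. \<exists>f'\<in>borel_measurable lborel. AE x in lborel. f x \<bullet> b = f' x"
  proof
    fix b
    have [measurable]: "f \<in> borel_measurable lebesgue" using assms by auto
    have "(\<lambda>x. f x \<bullet> b) \<in> borel_measurable lebesgue" by measurable
    then show "\<exists>f'\<in>borel_measurable lborel. AE x in lborel. f x \<bullet> b = f' x"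
      by (rule completion_ex_borel_measurable_real)
  qed
  then obtain k where k: "\<And>b. k b \<in> borel_measurable lborel" "\<And>b. AE x in lborel. f x \<bullet> b = k b x"
    by metis
  define f' where "f' x = (\<Sum>b\<in>Basis. k b x *\<^sub>R b)" for x
  have m: "f' \<in> borel_measurable lborel"
    unfolding f'_def[abs_def] using k(1) by (intro borel_measurable_sum borel_measurable_scaleR) auto
  have "AE x in lborel. \<forall>b\<in>Basis. f x \<bullet> b = k b x"
    using k(2) by (intro AE_finite_allI) auto
  then have ae: "AE x in lborel. f x = f' x"
    by eventually_elim (simp add: f'_def euclidean_representation cong: sum.cong, metis (no_types, lifting) euclidean_representation sum.cong)
  then have ae': "AE x in lebesgue. f x = f' x" by (rule AE_completion)
  have "integrable lebesgue f'"
    by (rule integrable_cong_AE_imp[OF assms]) (use m ae' in \<open>auto intro: measurable_completion simp: eq_commute\<close>)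
  then have "integrable lborel f'" using m by (simp add: integrable_completion)
  then show ?thesis using m ae' that by auto
qed

lemma integral_lebesgue_on_borel:
  fixes h :: "'a::euclidean_space \<Rightarrow> 'b::euclidean_space"
  assumes "\<Omega> \<in> sets lebesgue" "h \<in> borel_measurable (lebesgue_on \<Omega>)" "k \<in> borel_measurable borel"
    and "AE x in lebesgue. indicator \<Omega> x *\<^sub>R h x = k x"
  shows "(LINT x|lebesgue_on \<Omega>. h x) = (LINT x|lborel. k x)"
proof -
  have "(LINT x|lebesgue_on \<Omega>. h x) = (LINT x|lebesgue. indicator \<Omega> x *\<^sub>R h x)"
    using assms(1) by (intro integral_restrict_space) auto
  also have "\<dots> = (LINT x|lebesgue. k x)"
  proof (rule integral_cong_AE)
    show "(\<lambda>x. indicator \<Omega> x *\<^sub>R h x) \<in> borel_measurable lebesgue"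
      using assms(1,2) borel_measurable_restrict_space_iff[of \<Omega> lebesgue h] by (simp add: mult.commute)
    show "k \<in> borel_measurable lebesgue" using assms(3) by (intro measurable_completion) simp
  qed (rule assms)
  also have "\<dots> = (LINT x|lborel. k x)" using assms(3) by (intro integral_completion) simp
  finally show ?thesis .
qed


text \<open>
  The definition of the weak gradient, tested with \<open>\<lambda>y. \<eta> (x - y)\<close>.
\<close>

lemma mollify_gradient_eq_mollify_weak_gradient:
  fixes f :: "'a::euclidean_space \<Rightarrow> real"
  assumes \<Omega>: "open \<Omega>" and w: "has_weak_gradient \<Omega> f g" and \<eta>: "mollifier \<delta> \<eta> \<eta>'"
    and K: "compact K" "K \<subseteq> \<Omega>" and x: "cball x \<delta> \<subseteq> K"
    and a: "integrable lborel a" "AE y in lebesgue. indicator K y *\<^sub>R f y = a y"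
    and c: "integrable lborel c" "AE y in lebesgue. indicator K y *\<^sub>R g y = c y"
  shows "(\<integral>y. a y *\<^sub>R \<eta>' (x - y) \<partial>lborel) = mollify \<eta> c x"
proof -
  note md = mollifierD[OF \<eta>]
  have [measurable]: "\<eta> \<in> borel_measurable borel" "\<eta>' \<in> borel_measurable borel"
    "a \<in> borel_measurable borel" "c \<in> borel_measurable borel"
    using md a c by auto
  define \<theta> where "\<theta> y = \<eta> (x - y)" for y
  have d: "(\<theta> has_derivative (\<lambda>h. (- \<eta>' (x - y)) \<bullet> h)) (at y)" for y
    unfolding \<theta>_def
    by (rule has_derivative_eq_rhs[OF has_derivative_compose[OF _ md(1)]]) (auto intro!: derivative_eq_intros)
  have far: "\<eta> (x - y) = 0" "\<eta>' (x - y) = 0" if "y \<notin> K" for y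
  proof -
    have "y \<notin> cball x \<delta>" using x that by blast
    then have "norm (x - y) \<ge> \<delta>" by (simp add: dist_norm)
    then show "\<eta> (x - y) = 0" "\<eta>' (x - y) = 0" using md by auto
  qed
  have "continuous_on UNIV (\<lambda>y. - \<eta>' (x - y))"
    by (intro continuous_intros continuous_on_compose2[OF md(2)]) auto
  then have "\<theta> \<in> C1c \<Omega>" using K far by (intro C1cI[OF d _ K]) (auto simp: \<theta>_def)
  then have eq: "(LINT y|lebesgue_on \<Omega>. f y *\<^sub>R gradient \<theta> y) = - (LINT y|lebesgue_on \<Omega>. \<theta> y *\<^sub>R g y)"
    using w unfolding has_weak_gradient_def by blast
  have gr: "gradient \<theta> y = - \<eta>' (x - y)" for y by (rule gradient_eqI[OF d])
  have \<Omega>s: "\<Omega> \<in> sets lebesgue" using \<Omega> by auto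
  have bm: "k \<in> borel_measurable (lebesgue_on \<Omega>)" if "k \<in> borel_measurable borel" for k :: "'a \<Rightarrow> 'c::euclidean_space"
    using that by (intro measurable_restrict_space1 measurable_completion) simp
  have "(LINT y|lebesgue_on \<Omega>. f y *\<^sub>R gradient \<theta> y) = (LINT y|lborel. - (a y *\<^sub>R \<eta>' (x - y)))"
    unfolding gr
  proof (rule integral_lebesgue_on_borel[OF \<Omega>s])
    show "(\<lambda>y. f y *\<^sub>R - \<eta>' (x - y)) \<in> borel_measurable (lebesgue_on \<Omega>)"
      by (intro borel_measurable_scaleR has_weak_gradient_measurable(1)[OF \<Omega> w] bm) measurable
    show "AE y in lebesgue. indicator \<Omega> y *\<^sub>R f y *\<^sub>R - \<eta>' (x - y) = - (a y *\<^sub>R \<eta>' (x - y))"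
      using a(2)
    proof eventually_elim
      case (elim y)
      then show ?case using far[of y] K(2) by (cases "y \<in> K") (auto simp: indicator_def)
    qed
  qed measurable
  moreover have "(LINT y|lebesgue_on \<Omega>. \<theta> y *\<^sub>R g y) = (LINT y|lborel. \<eta> (x - y) *\<^sub>R c y)"
    unfolding \<theta>_def
  proof (rule integral_lebesgue_on_borel[OF \<Omega>s])
    show "(\<lambda>y. \<eta> (x - y) *\<^sub>R g y) \<in> borel_measurable (lebesgue_on \<Omega>)"
      by (intro borel_measurable_scaleR has_weak_gradient_measurable(2)[OF \<Omega> w] bm) measurable
    show "AE y in lebesgue. indicator \<Omega> y *\<^sub>R \<eta> (x - y) *\<^sub>R g y = \<eta> (x - y) *\<^sub>R c y"
      using c(2)
    proof eventually_elim
      case (elim y)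
      then show ?case using far[of y] K(2) by (cases "y \<in> K") (auto simp: indicator_def)
    qed
  qed measurable
  ultimately show ?thesis using eq by (simp add: mollify_def)
qed

lemma has_derivative_vec_componentwise:
  fixes F :: "'a::euclidean_space \<Rightarrow> real ^ 'n"
  assumes "\<And>i. ((\<lambda>x. F x $ i) has_derivative (\<lambda>h. G i \<bullet> h)) (at x)"
  shows "(F has_derivative (\<lambda>h. \<chi> i. G i \<bullet> h)) (at x)"
  unfolding has_derivative_componentwise_within[of F]
proof
  fix b :: "real ^ 'n" assume "b \<in> Basis"
  then obtain i where b: "b = axis i 1" by (auto simp: Basis_vec_def)
  show "((\<lambda>x. F x \<bullet> b) has_derivative (\<lambda>h. (\<chi> i. G i \<bullet> h) \<bullet> b)) (at x)"
    using assms[of i] by (simp add: b inner_axis)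
qed

text \<open>
  The sum over \<open>i\<close> tends to zero in \<open>L\<^sup>1\<close>, so one subsequence serves all \<open>i\<close>.
\<close>

lemma tendsto_zero_AE_subseq_finite:
  fixes u :: "nat \<Rightarrow> 'i::finite \<Rightarrow> 'a \<Rightarrow> real"
  assumes i: "\<And>n i. integrable M (u n i)" and l: "\<And>i. (\<lambda>n. \<integral>x. \<bar>u n i x\<bar> \<partial>M) \<longlonglongrightarrow> 0"
  obtains r :: "nat \<Rightarrow> nat" where "strict_mono r" "AE x in M. \<forall>i. (\<lambda>n. u (r n) i x) \<longlonglongrightarrow> 0"
proof -
  have "(\<lambda>n. \<Sum>i\<in>UNIV. \<integral>x. \<bar>u n i x\<bar> \<partial>M) \<longlonglongrightarrow> (\<Sum>i\<in>(UNIV::'i set). 0)" by (intro tendsto_sum l)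
  moreover have "(\<Sum>i\<in>UNIV. \<integral>x. \<bar>u n i x\<bar> \<partial>M) = (\<integral>x. norm (\<Sum>i\<in>UNIV. \<bar>u n i x\<bar>) \<partial>M)" for n
    using i by (subst Bochner_Integration.integral_sum[symmetric]) (auto simp: sum_nonneg)
  ultimately have "(\<lambda>n. \<integral>x. norm (\<Sum>i\<in>UNIV. \<bar>u n i x\<bar>) \<partial>M) \<longlonglongrightarrow> 0" by simp
  then obtain r where r: "strict_mono r" "AE x in M. (\<lambda>n. \<Sum>i\<in>UNIV. \<bar>u (r n) i x\<bar>) \<longlonglongrightarrow> 0"
    using tendsto_L1_AE_subseq[of M "\<lambda>n x. \<Sum>i\<in>UNIV. \<bar>u n i x\<bar>"] i by auto
  have "AE x in M. \<forall>i. (\<lambda>n. u (r n) i x) \<longlonglongrightarrow> 0"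
    using r(2)
  proof eventually_elim
    case (elim x)
    show ?case
    proof
      fix i
      show "(\<lambda>n. u (r n) i x) \<longlonglongrightarrow> 0"
        by (rule Lim_null_comparison[OF _ elim])
          (auto intro!: always_eventually member_le_sum[of i UNIV "\<lambda>i. \<bar>u _ i x\<bar>"])
    qed
  qed
  with r(1) show ?thesis by (rule that)
qed

lemma borel_measurable_vecI:
  fixes f :: "'a \<Rightarrow> real ^ 'n"
  assumes "\<And>i. (\<lambda>x. f x $ i) \<in> borel_measurable M"
  shows "f \<in> borel_measurable M"
  unfolding borel_measurable_euclidean_space[of f] using assms by (auto simp: Basis_vec_def inner_axis)

text \<open>
  For mollified \<open>f\<close> this is \<open>integral_gradient_zero\<close> for the product of \<open>H \<circ> f\<close> and \<open>\<phi>\<close>. In the limit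
  the gradients converge in \<open>L\<^sup>1\<close> near the support of \<open>\<phi>\<close>, and along a subsequence \<open>f\<close> converges almost
  everywhere, so dominated convergence takes care of the factors \<open>H\<close> and \<open>H'\<close>.
\<close>

proposition weak_chain_rule:
  fixes f :: "'a::euclidean_space \<Rightarrow> real ^ 'n" and H :: "real ^ 'n \<Rightarrow> real"
  assumes \<Omega>: "open \<Omega>" and w: "\<And>i. has_weak_gradient \<Omega> (\<lambda>x. f x $ i) (g i)"
    and H: "\<And>y. (H has_derivative (\<lambda>h. H' y \<bullet> h)) (at y)" "continuous_on UNIV H'"
    and B: "\<And>y. norm (H' y) \<le> B" "\<And>y. \<bar>H y\<bar> \<le> B"
    and \<phi>: "\<phi> \<in> C1c \<Omega>"
  shows "(LINT x|lebesgue_on \<Omega>. H (f x) *\<^sub>R gradient \<phi> x) =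
     - (LINT x|lebesgue_on \<Omega>. \<phi> x *\<^sub>R (\<Sum>i\<in>UNIV. H' (f x) $ i *\<^sub>R g i x))"
proof -
  note C = C1cD[OF \<phi>]
  have \<Omega>s: "\<Omega> \<in> sets lebesgue" using \<Omega> by auto
  let ?S = "support \<phi>"
  obtain e where e: "e > 0" "(\<Union>x\<in>?S. ball x e) \<subseteq> \<Omega>"
    using compact_subset_open_imp_ball_epsilon_subset[OF C(4) \<Omega> C(5)] by blast
  define r where "r = e / 2"
  have r: "r > 0" "r < e" using e by (auto simp: r_def)
  \<comment> \<open>A compact neighbourhood of the support of \<open>\<phi>\<close> inside \<open>\<Omega>\<close>, wide enough for mollifiers of
    radius \<open>r\<close>.\<close>
  define K where "K = {x + y |x y. x \<in> ?S \<and> y \<in> cball 0 r}"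
  have K: "compact K" unfolding K_def by (intro compact_sums C(4) compact_cball)
  have SK: "cball x r \<subseteq> K" if "x \<in> ?S" for x
  proof
    fix y assume "y \<in> cball x r"
    then have "y - x \<in> cball 0 r" by (simp add: dist_norm norm_minus_commute)
    then show "y \<in> K" unfolding K_def using that by (intro CollectI exI[of _ x] exI[of _ "y - x"]) auto
  qed
  have K\<Omega>: "K \<subseteq> \<Omega>"
  proof
    fix z assume "z \<in> K"
    then obtain x y where "x \<in> ?S" "norm y \<le> r" "z = x + y" by (auto simp: K_def)
    then have "z \<in> ball x e" using r by (simp add: dist_norm)
    then show "z \<in> \<Omega>" using e(2) \<open>x \<in> ?S\<close> by blast
  qed
  have SK': "x \<in> K" if "x \<in> ?S" for x using SK[OF that] r by auto
  \<comment> \<open>\<open>a\<close> and \<open>c\<close> are Borel representatives of \<open>f\<close> and \<open>g\<close>, cut off outside \<open>K\<close> to be integrable.\<close>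
  have "\<forall>i. \<exists>a. integrable lborel a \<and> a \<in> borel_measurable borel \<and> (AE x in lebesgue. indicator K x *\<^sub>R (f x $ i) = a x)"
  proof
    fix i
    have "set_integrable lebesgue K (\<lambda>x. f x $ i)"
      using w[of i] K K\<Omega> by (auto simp: has_weak_gradient_def locally_integrable_def)
    from integrable_lebesgue_borel_representative[OF this[unfolded set_integrable_def]]
    show "\<exists>a. integrable lborel a \<and> a \<in> borel_measurable borel \<and> (AE x in lebesgue. indicator K x *\<^sub>R (f x $ i) = a x)"
      by blast
  qed
  from choice[OF this] obtain a where a: "\<And>i. integrable lborel (a i)" "\<And>i. a i \<in> borel_measurable borel"
    "\<And>i. AE x in lebesgue. indicator K x *\<^sub>R (f x $ i) = a i x" by blast
  have "\<forall>i. \<exists>a. integrable lborel a \<and> a \<in> borel_measurable borel \<and> (AE x in lebesgue. indicator K x *\<^sub>R g i x = a x)"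
  proof
    fix i
    have "set_integrable lebesgue K (g i)"
      using w[of i] K K\<Omega> by (auto simp: has_weak_gradient_def locally_integrable_def)
    from integrable_lebesgue_borel_representative[OF this[unfolded set_integrable_def]]
    show "\<exists>a. integrable lborel a \<and> a \<in> borel_measurable borel \<and> (AE x in lebesgue. indicator K x *\<^sub>R g i x = a x)"
      by blast
  qed
  from choice[OF this] obtain c where c: "\<And>i. integrable lborel (c i)" "\<And>i. c i \<in> borel_measurable borel"
    "\<And>i. AE x in lebesgue. indicator K x *\<^sub>R g i x = c i x" by blast
  define \<delta> where "\<delta> n = r * inverse (real (Suc n))" for n
  have \<delta>: "\<delta> n > 0" "\<delta> n \<le> r" for n using r by (auto simp: \<delta>_def field_simps)
  have \<delta>0: "\<delta> \<longlonglongrightarrow> 0"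
    unfolding \<delta>_def by (intro tendsto_mult_right_zero LIMSEQ_inverse_real_of_nat)
  have "\<forall>n. \<exists>p. mollifier (\<delta> n) (fst p :: 'a \<Rightarrow> real) (snd p)"
    using mollifier_exists[OF \<delta>(1)] by (metis fst_conv snd_conv)
  from choice[OF this] obtain p where p: "\<And>n. mollifier (\<delta> n) (fst (p n) :: 'a \<Rightarrow> real) (snd (p n))" by blast
  define \<eta> where "\<eta> n = fst (p n)" for n
  define \<eta>' where "\<eta>' n = snd (p n)" for n
  have \<eta>: "mollifier (\<delta> n) (\<eta> n) (\<eta>' n)" for n using p by (simp add: \<eta>_def \<eta>'_def)
  note md = mollifierD[OF \<eta>]
  \<comment> \<open>\<open>G\<close> is the gradient of \<open>F\<close> everywhere; \<open>M\<close> is the mollified weak gradient, and agrees with \<open>G\<close> on the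
    support of \<open>\<phi>\<close>.\<close>
  define F :: "nat \<Rightarrow> 'a \<Rightarrow> real ^ 'n" where "F n x = (\<chi> i. mollify (\<eta> n) (a i) x)" for n x
  define G where "G n i x = (\<integral>y. a i y *\<^sub>R \<eta>' n (x - y) \<partial>lborel)" for n i x
  define M where "M n i = mollify (\<eta> n) (c i)" for n i
  define b :: "'a \<Rightarrow> real ^ 'n" where "b x = (\<chi> i. a i x)" for x
  have [measurable]: "\<And>n. \<eta>' n \<in> borel_measurable borel" "\<And>n. \<eta> n \<in> borel_measurable borel"
    "\<And>i. a i \<in> borel_measurable borel" "\<And>i. c i \<in> borel_measurable borel"
    "H' \<in> borel_measurable borel" "gradient \<phi> \<in> borel_measurable borel" "\<phi> \<in> borel_measurable borel"
    using md a c C H(2) by (auto intro: borel_measurable_continuous_onI)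
  have contH: "continuous_on UNIV H" using H(1) by (meson continuous_at_imp_continuous_on has_derivative_continuous)
  then have [measurable]: "H \<in> borel_measurable borel" by (rule borel_measurable_continuous_onI)
  have dF: "(F n has_derivative (\<lambda>h. \<chi> i. G n i x \<bullet> h)) (at x)" for n x
    by (rule has_derivative_vec_componentwise) (simp add: F_def G_def mollify_has_derivative[OF \<eta> a(1)])
  have "continuous_on UNIV (F n)" for n using dF by (meson continuous_at_imp_continuous_on has_derivative_continuous)
  then have [measurable]: "F n \<in> borel_measurable borel" for n by (rule borel_measurable_continuous_onI)
  have [measurable]: "G n i \<in> borel_measurable borel" for n i unfolding G_def[abs_def] by measurable
  have [measurable]: "M n i \<in> borel_measurable borel" for n i unfolding M_def mollify_def[abs_def] by measurable
  have [measurable]: "b \<in> borel_measurable borel" 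
    unfolding b_def[abs_def] by (rule borel_measurable_vecI) simp
  obtain R B\<phi> where B\<phi>: "B\<phi> \<ge> 0" "\<And>x. norm x \<ge> R \<Longrightarrow> \<phi> x = 0 \<and> gradient \<phi> x = 0"
    "\<And>x. \<bar>\<phi> x\<bar> \<le> B\<phi>" "\<And>x. norm (gradient \<phi> x) \<le> B\<phi>" using C1c_bounded[OF \<phi>] by blast
  have B0: "B \<ge> 0" using B(2)[of 0] by linarith
  have B': "\<bar>H' y $ i\<bar> \<le> B" for y i using component_le_norm_cart[of "H' y" i] B(1)[of y] by linarith
  have i\<phi>: "integrable lborel (gradient \<phi>)" "integrable lborel \<phi>"
    using C B\<phi>(2) by (auto intro!: integrable_continuous_compact_support[of _ R])
  have iH: "integrable lborel (\<lambda>x. H (q x) *\<^sub>R gradient \<phi> x)" if "q \<in> borel_measurable borel" for q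
    using that B(2) by (intro integrable_bounded_scaleR[OF i\<phi>(1)]) auto
  have k_bound: "\<bar>\<phi> x * H' (q x) $ i\<bar> \<le> B\<phi> * B" for x i and q :: "'a \<Rightarrow> real ^ 'n"
    unfolding abs_mult using B\<phi> B' B0 by (intro mult_mono) auto
  have [measurable]: "(\<lambda>x. H' (q x) $ i) \<in> borel_measurable borel" if q: "q \<in> borel_measurable borel" for q :: "'a \<Rightarrow> real ^ 'n" and i
  proof -
    have "(\<lambda>y. H' y $ i) \<in> borel_measurable borel" by (intro borel_measurable_continuous_onI continuous_intros H(2))
    then show ?thesis by (rule measurable_compose[OF q])
  qed
  have GM: "(\<phi> x * v) *\<^sub>R G n i x = (\<phi> x * v) *\<^sub>R M n i x" for n i x v
  proof (cases "x \<in> ?S")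
    case True
    have "cball x (\<delta> n) \<subseteq> K" using SK[OF True] \<delta>(2)[of n] by auto
    then show ?thesis unfolding G_def M_def
      using mollify_gradient_eq_mollify_weak_gradient[OF \<Omega> w \<eta> K K\<Omega> _ a(1) a(3) c(1) c(3)] by simp
  qed (use C in simp)
  have iM: "integrable lborel (\<lambda>x. (\<phi> x * H' (q x) $ i) *\<^sub>R (M n i x - c i x))" "integrable lborel (\<lambda>x. (\<phi> x * H' (q x) $ i) *\<^sub>R c i x)"
    if [measurable]: "q \<in> borel_measurable borel" for q n i
    by (rule integrable_bounded_scaleR[OF _ _ k_bound], use mollify_L1(1)[OF \<eta> \<delta>0 c(1)] c(1) in \<open>simp_all add: M_def\<close>)+
  have ibp: "(\<integral>x. H (F n x) *\<^sub>R gradient \<phi> x \<partial>lborel) =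
     - (\<Sum>i\<in>UNIV. (\<integral>x. (\<phi> x * H' (F n x) $ i) *\<^sub>R (M n i x - c i x) \<partial>lborel) + (\<integral>x. (\<phi> x * H' (F n x) $ i) *\<^sub>R c i x \<partial>lborel))" for n
  proof -
    define \<psi>' where "\<psi>' x = H (F n x) *\<^sub>R gradient \<phi> x + \<phi> x *\<^sub>R (\<Sum>i\<in>UNIV. H' (F n x) $ i *\<^sub>R G n i x)" for x
    obtain B\<eta> where B\<eta>: "B\<eta> \<ge> 0" "\<And>x. norm (\<eta>' n x) \<le> B\<eta>" using md(11)[of n] by blast
    have GB: "norm (G n i x) \<le> (\<integral>y. \<bar>a i y\<bar> * B\<eta> \<partial>lborel)" for i x
      unfolding G_def
    proof (rule order_trans[OF integral_norm_bound integral_mono])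
      show "integrable lborel (\<lambda>y. norm (a i y *\<^sub>R \<eta>' n (x - y)))"
        by (intro integrable_norm integrable_scaleR_bounded[OF a(1) _ B\<eta>(2)]) simp
      show "norm (a i y *\<^sub>R \<eta>' n (x - y)) \<le> \<bar>a i y\<bar> * B\<eta>" for y
        using B\<eta>(2) by (simp add: mult_left_mono)
    qed (use a(1) in auto)
    have "(\<integral>x. \<psi>' x \<partial>lborel) = 0"
    proof (rule integral_gradient_zero[where \<psi> = "\<lambda>x. H (F n x) * \<phi> x" and r = R])
      show "((\<lambda>x. H (F n x) * \<phi> x) has_derivative (\<lambda>h. \<psi>' x \<bullet> h)) (at x)" for x
      proof -
        have "((\<lambda>x. H (F n x)) has_derivative (\<lambda>h. H' (F n x) \<bullet> (\<chi> i. G n i x \<bullet> h))) (at x)"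
          by (rule has_derivative_compose[OF dF H(1)])
        from has_derivative_mult[OF this C(1)]
        show ?thesis
          by (rule has_derivative_eq_rhs) (auto simp: \<psi>'_def inner_vec_def inner_add_left inner_sum_left algebra_simps sum_distrib_left)
      qed
      show "norm (\<psi>' x) \<le> B * B\<phi> + B\<phi> * (\<Sum>i\<in>UNIV. B * (\<integral>y. \<bar>a i y\<bar> * B\<eta> \<partial>lborel))" for x
      proof -
        have "norm (\<Sum>i\<in>UNIV. H' (F n x) $ i *\<^sub>R G n i x) \<le> (\<Sum>i\<in>UNIV. B * (\<integral>y. \<bar>a i y\<bar> * B\<eta> \<partial>lborel))"
          using GB B' B0 by (intro order_trans[OF norm_sum] sum_mono) (auto intro!: mult_mono)
        then have "norm (\<phi> x *\<^sub>R (\<Sum>i\<in>UNIV. H' (F n x) $ i *\<^sub>R G n i x)) \<le> B\<phi> * (\<Sum>i\<in>UNIV. B * (\<integral>y. \<bar>a i y\<bar> * B\<eta> \<partial>lborel))"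
          unfolding norm_scaleR using B\<phi> by (intro mult_mono) auto
        moreover have "norm (H (F n x) *\<^sub>R gradient \<phi> x) \<le> B * B\<phi>"
          unfolding norm_scaleR using B\<phi> B B0 by (intro mult_mono) auto
        ultimately show ?thesis unfolding \<psi>'_def by (intro order_trans[OF norm_triangle_ineq] add_mono) auto
      qed
      show "\<psi>' \<in> borel_measurable borel" unfolding \<psi>'_def[abs_def] by measurable
    qed (use B\<phi> in auto)
    moreover have "\<psi>' x = H (F n x) *\<^sub>R gradient \<phi> x +
      (\<Sum>i\<in>UNIV. (\<phi> x * H' (F n x) $ i) *\<^sub>R (M n i x - c i x) + (\<phi> x * H' (F n x) $ i) *\<^sub>R c i x)" for x
      unfolding \<psi>'_def by (simp add: scaleR_sum_right GM scaleR_diff_right)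
    ultimately have "(\<integral>x. H (F n x) *\<^sub>R gradient \<phi> x +
      (\<Sum>i\<in>UNIV. (\<phi> x * H' (F n x) $ i) *\<^sub>R (M n i x - c i x) + (\<phi> x * H' (F n x) $ i) *\<^sub>R c i x) \<partial>lborel) = 0" by simp
    then show ?thesis
      by (simp add: iH iM Bochner_Integration.integral_add Bochner_Integration.integral_sum
        Bochner_Integration.integrable_add Bochner_Integration.integrable_sum eq_neg_iff_add_eq_0)
  qed
  have La: "(\<lambda>n. \<integral>x. \<bar>mollify (\<eta> n) (a i) x - a i x\<bar> \<partial>lborel) \<longlonglongrightarrow> 0" for i
    using mollify_L1(2)[OF \<eta> \<delta>0 a(1)] by simp
  obtain s where s: "strict_mono s" "AE x in lborel. \<forall>i. (\<lambda>n. mollify (\<eta> (s n)) (a i) x - a i x) \<longlonglongrightarrow> 0"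
    by (rule tendsto_zero_AE_subseq_finite[of lborel "\<lambda>n i x. mollify (\<eta> n) (a i) x - a i x"])
      (use mollify_L1(1)[OF \<eta> \<delta>0 a(1)] La in auto)
  have Fb: "AE x in lborel. (\<lambda>n. F (s n) x) \<longlonglongrightarrow> b x"
    using s(2)
  proof eventually_elim
    case (elim x)
    show ?case
    proof (rule vec_tendstoI)
      fix i
      have "(\<lambda>n. mollify (\<eta> (s n)) (a i) x - a i x + a i x) \<longlonglongrightarrow> 0 + a i x"
        using elim by (intro tendsto_add tendsto_const) auto
      then show "(\<lambda>n. F (s n) x $ i) \<longlonglongrightarrow> b x $ i" by (simp add: F_def b_def)
    qed
  qed
  have l1: "(\<lambda>n. \<integral>x. H (F (s n) x) *\<^sub>R gradient \<phi> x \<partial>lborel) \<longlonglongrightarrow> (\<integral>x. H (b x) *\<^sub>R gradient \<phi> x \<partial>lborel)"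
  proof (rule integral_dominated_convergence[where w = "\<lambda>x. B * norm (gradient \<phi> x)"])
    show "AE x in lborel. (\<lambda>n. H (F (s n) x) *\<^sub>R gradient \<phi> x) \<longlonglongrightarrow> H (b x) *\<^sub>R gradient \<phi> x"
      using Fb
    proof eventually_elim
      case (elim x)
      have "isCont H (b x)" using H(1) has_derivative_continuous by blast
      then show ?case using elim by (intro tendsto_scaleR tendsto_const isCont_tendsto_compose[of _ H])
    qed
    show "AE x in lborel. norm (H (F (s n) x) *\<^sub>R gradient \<phi> x) \<le> B * norm (gradient \<phi> x)" for n
      using B(2) by (auto intro!: AE_I2 mult_right_mono)
  qed (use i\<phi> in \<open>auto intro!: integrable_mult_right integrable_norm\<close>)
  have l2: "(\<lambda>n. \<integral>x. (\<phi> x * H' (F (s n) x) $ i) *\<^sub>R c i x \<partial>lborel) \<longlonglongrightarrow> (\<integral>x. (\<phi> x * H' (b x) $ i) *\<^sub>R c i x \<partial>lborel)" for i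
  proof (rule integral_dominated_convergence[where w = "\<lambda>x. (B\<phi> * B) * norm (c i x)"])
    show "AE x in lborel. (\<lambda>n. (\<phi> x * H' (F (s n) x) $ i) *\<^sub>R c i x) \<longlonglongrightarrow> (\<phi> x * H' (b x) $ i) *\<^sub>R c i x"
      using Fb
    proof eventually_elim
      case (elim x)
      have "isCont H' (b x)" using H(2) by (simp add: continuous_on_eq_continuous_at)
      then have "(\<lambda>n. H' (F (s n) x)) \<longlonglongrightarrow> H' (b x)" using elim by (rule isCont_tendsto_compose)
      then show ?case by (intro tendsto_scaleR tendsto_mult tendsto_const tendsto_vec_nth)
    qed
    show "AE x in lborel. norm ((\<phi> x * H' (F (s n) x) $ i) *\<^sub>R c i x) \<le> (B\<phi> * B) * norm (c i x)" for n
      unfolding norm_scaleR real_norm_def by (intro AE_I2 mult_right_mono k_bound) auto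
  qed (use c(1) in \<open>auto intro!: integrable_mult_right integrable_norm\<close>)
  have l3: "(\<lambda>n. \<integral>x. (\<phi> x * H' (F (s n) x) $ i) *\<^sub>R (M (s n) i x - c i x) \<partial>lborel) \<longlonglongrightarrow> 0" for i
  proof (rule Lim_null_comparison)
    have "(\<lambda>n. (B\<phi> * B) * (\<integral>x. norm (M (s n) i x - c i x) \<partial>lborel)) \<longlonglongrightarrow> (B\<phi> * B) * 0"
      unfolding M_def using LIMSEQ_subseq_LIMSEQ[OF mollify_L1(2)[OF \<eta> \<delta>0 c(1)] s(1)]
      by (intro tendsto_mult tendsto_const) (simp add: comp_def)
    then show "(\<lambda>n. (B\<phi> * B) * (\<integral>x. norm (M (s n) i x - c i x) \<partial>lborel)) \<longlonglongrightarrow> 0" by simp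
    show "\<forall>\<^sub>F n in sequentially. norm (\<integral>x. (\<phi> x * H' (F (s n) x) $ i) *\<^sub>R (M (s n) i x - c i x) \<partial>lborel)
       \<le> (B\<phi> * B) * (\<integral>x. norm (M (s n) i x - c i x) \<partial>lborel)"
    proof (rule always_eventually, rule allI)
      fix n
      have iMc: "integrable lborel (\<lambda>x. M (s n) i x - c i x)" unfolding M_def by (rule mollify_L1(1)[OF \<eta> \<delta>0 c(1)])
      have "norm (\<integral>x. (\<phi> x * H' (F (s n) x) $ i) *\<^sub>R (M (s n) i x - c i x) \<partial>lborel)
        \<le> (\<integral>x. norm ((\<phi> x * H' (F (s n) x) $ i) *\<^sub>R (M (s n) i x - c i x)) \<partial>lborel)"
        by (rule integral_norm_bound)
      also have "\<dots> \<le> (\<integral>x. (B\<phi> * B) * norm (M (s n) i x - c i x) \<partial>lborel)"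
      proof (rule integral_mono)
        show "integrable lborel (\<lambda>x. norm ((\<phi> x * H' (F (s n) x) $ i) *\<^sub>R (M (s n) i x - c i x)))"
          by (intro integrable_norm iM) simp
        show "norm ((\<phi> x * H' (F (s n) x) $ i) *\<^sub>R (M (s n) i x - c i x)) \<le> B\<phi> * B * norm (M (s n) i x - c i x)" for x
          unfolding norm_scaleR real_norm_def by (intro mult_right_mono k_bound) auto
      qed (use iM iMc in \<open>auto intro!: integrable_norm integrable_mult_right\<close>)
      finally show "norm (\<integral>x. (\<phi> x * H' (F (s n) x) $ i) *\<^sub>R (M (s n) i x - c i x) \<partial>lborel)
       \<le> (B\<phi> * B) * (\<integral>x. norm (M (s n) i x - c i x) \<partial>lborel)" by simp
    qed
  qed
  have "(\<integral>x. H (b x) *\<^sub>R gradient \<phi> x \<partial>lborel) = - (\<Sum>i\<in>UNIV. 0 + (\<integral>x. (\<phi> x * H' (b x) $ i) *\<^sub>R c i x \<partial>lborel))"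
  proof (rule LIMSEQ_unique[OF l1])
    show "(\<lambda>n. \<integral>x. H (F (s n) x) *\<^sub>R gradient \<phi> x \<partial>lborel) \<longlonglongrightarrow> - (\<Sum>i\<in>UNIV. 0 + (\<integral>x. (\<phi> x * H' (b x) $ i) *\<^sub>R c i x \<partial>lborel))"
      unfolding ibp by (intro tendsto_minus tendsto_sum tendsto_add l2 l3)
  qed
  also have "\<dots> = - (\<integral>x. (\<Sum>i\<in>UNIV. (\<phi> x * H' (b x) $ i) *\<^sub>R c i x) \<partial>lborel)"
    by (simp add: iM Bochner_Integration.integral_sum)
  finally have fin: "(\<integral>x. H (b x) *\<^sub>R gradient \<phi> x \<partial>lborel) = - (\<integral>x. (\<Sum>i\<in>UNIV. (\<phi> x * H' (b x) $ i) *\<^sub>R c i x) \<partial>lborel)" .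
  have bm: "k \<in> borel_measurable (lebesgue_on \<Omega>)" if "k \<in> borel_measurable borel" for k :: "'a \<Rightarrow> 'c::euclidean_space"
    using that by (intro measurable_restrict_space1 measurable_completion) simp
  note wm = has_weak_gradient_measurable[OF \<Omega> w]
  have [measurable]: "f \<in> borel_measurable (lebesgue_on \<Omega>)"
  proof -
    show ?thesis by (intro borel_measurable_vecI wm)
  qed
  have [measurable]: "\<phi> \<in> borel_measurable (lebesgue_on \<Omega>)" "gradient \<phi> \<in> borel_measurable (lebesgue_on \<Omega>)"
    by (intro bm; measurable)+
  have [measurable]: "g i \<in> borel_measurable (lebesgue_on \<Omega>)" for i by (rule wm)
  have Hm: "(\<lambda>y. H' y $ i) \<in> borel_measurable borel" for i
    by (intro borel_measurable_continuous_onI continuous_intros H(2))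
  have [measurable]: "(\<lambda>x. H' (f x) $ i) \<in> borel_measurable (lebesgue_on \<Omega>)"
    "(\<lambda>x. H' (b x) $ i) \<in> borel_measurable borel" for i
    by (rule measurable_compose[OF _ Hm], measurable)+
  have aeb: "AE x in lebesgue. x \<in> K \<longrightarrow> f x = b x"
  proof -
    have "AE x in lebesgue. \<forall>i. indicator K x *\<^sub>R (f x $ i) = a i x" using a(3) by (simp add: AE_all_countable)
    then show ?thesis by eventually_elim (auto simp: b_def vec_eq_iff)
  qed
  have aec: "AE x in lebesgue. x \<in> K \<longrightarrow> (\<forall>i. g i x = c i x)"
  proof -
    have "AE x in lebesgue. \<forall>i. indicator K x *\<^sub>R g i x = c i x" using c(3) by (simp add: AE_all_countable)
    then show ?thesis by eventually_elim auto
  qed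
  have zS: "\<phi> x = 0 \<and> gradient \<phi> x = 0" if "x \<notin> K" for x using C(6,7)[of x] SK' that by blast
  have "(LINT x|lebesgue_on \<Omega>. H (f x) *\<^sub>R gradient \<phi> x) = (\<integral>x. H (b x) *\<^sub>R gradient \<phi> x \<partial>lborel)"
  proof (rule integral_lebesgue_on_borel[OF \<Omega>s])
    show "AE x in lebesgue. indicator \<Omega> x *\<^sub>R H (f x) *\<^sub>R gradient \<phi> x = H (b x) *\<^sub>R gradient \<phi> x"
      using aeb
    proof eventually_elim
      case (elim x)
      then show ?case using zS[of x] K\<Omega> by (cases "x \<in> K") (auto simp: indicator_def)
    qed
  qed measurable
  moreover have "(LINT x|lebesgue_on \<Omega>. \<phi> x *\<^sub>R (\<Sum>i\<in>UNIV. H' (f x) $ i *\<^sub>R g i x)) = (\<integral>x. (\<Sum>i\<in>UNIV. (\<phi> x * H' (b x) $ i) *\<^sub>R c i x) \<partial>lborel)"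
  proof (rule integral_lebesgue_on_borel[OF \<Omega>s])
    show "AE x in lebesgue. indicator \<Omega> x *\<^sub>R \<phi> x *\<^sub>R (\<Sum>i\<in>UNIV. H' (f x) $ i *\<^sub>R g i x) = (\<Sum>i\<in>UNIV. (\<phi> x * H' (b x) $ i) *\<^sub>R c i x)"
      using aeb aec
    proof eventually_elim
      case (elim x)
      then show ?case using zS[of x] K\<Omega> by (cases "x \<in> K") (auto simp: indicator_def scaleR_sum_right)
    qed
  qed measurable
  ultimately show ?thesis using fin by simp
qed

section \<open>The weak product rule\<close>

lemma locally_integrable_continuous_scaleR:
  fixes k :: "'a::euclidean_space \<Rightarrow> real" and h :: "'a \<Rightarrow> 'b::euclidean_space"
  assumes "continuous_on \<Omega> k" "locally_integrable \<Omega> h"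
  shows "locally_integrable \<Omega> (\<lambda>x. k x *\<^sub>R h x)"
  unfolding locally_integrable_def
proof (intro allI impI)
  fix K assume K: "compact K \<and> K \<subseteq> \<Omega>"
  then have ck: "continuous_on K k" using assms(1) continuous_on_subset by blast
  have "bounded (k ` K)" using K ck by (intro compact_imp_bounded compact_continuous_image) auto
  then obtain B where B: "B > 0" "\<And>x. x \<in> K \<Longrightarrow> \<bar>k x\<bar> \<le> B" by (auto simp: bounded_pos)
  have "K \<in> sets borel" using K by (auto intro: borel_compact)
  then have "(\<lambda>x. indicator K x *\<^sub>R k x) \<in> borel_measurable borel"
    using ck by (rule borel_measurable_continuous_on_indicator)
  then have m: "(\<lambda>x. indicator K x *\<^sub>R k x) \<in> borel_measurable lebesgue"
    by (intro measurable_completion) simp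
  have i: "integrable lebesgue (\<lambda>x. indicator K x *\<^sub>R h x)"
    using assms(2) K by (auto simp: locally_integrable_def set_integrable_def)
  have "integrable lebesgue (\<lambda>x. (indicator K x *\<^sub>R k x) *\<^sub>R (indicator K x *\<^sub>R h x))"
    by (rule integrable_bounded_scaleR[OF i m, of B]) (use B in \<open>auto simp: indicator_def\<close>)
  also have "(\<lambda>x. (indicator K x *\<^sub>R k x) *\<^sub>R (indicator K x *\<^sub>R h x)) = (\<lambda>x. indicator K x *\<^sub>R k x *\<^sub>R h x)"
    by (auto simp: indicator_def)
  finally show "set_integrable lebesgue K (\<lambda>x. k x *\<^sub>R h x)" by (simp add: set_integrable_def)
qed

lemma locally_integrable_scaleR_continuous:
  fixes h :: "'a::euclidean_space \<Rightarrow> real" and k :: "'a \<Rightarrow> 'b::euclidean_space"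
  assumes "continuous_on \<Omega> k" "locally_integrable \<Omega> h"
  shows "locally_integrable \<Omega> (\<lambda>x. h x *\<^sub>R k x)"
proof -
  have *: "locally_integrable \<Omega> (\<lambda>x. (k x \<bullet> b) *\<^sub>R h x)" for b
    by (intro locally_integrable_continuous_scaleR assms continuous_intros)
  show ?thesis
    unfolding locally_integrable_def set_integrable_def
  proof (intro allI impI)
    fix K assume K: "compact K \<and> K \<subseteq> \<Omega>"
    have "integrable lebesgue (\<lambda>x. \<Sum>b\<in>Basis. (indicator K x *\<^sub>R (k x \<bullet> b) *\<^sub>R h x) *\<^sub>R b)"
      using *[unfolded locally_integrable_def set_integrable_def] K
      by (intro Bochner_Integration.integrable_sum integrable_scaleR_left) auto
    also have "(\<lambda>x. \<Sum>b\<in>Basis. (indicator K x *\<^sub>R (k x \<bullet> b) *\<^sub>R h x) *\<^sub>R b) = (\<lambda>x. indicator K x *\<^sub>R h x *\<^sub>R k x)"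
    proof
      fix x
      have "(\<Sum>b\<in>Basis. (indicator K x *\<^sub>R (k x \<bullet> b) *\<^sub>R h x) *\<^sub>R b) = (indicator K x * h x) *\<^sub>R (\<Sum>b\<in>Basis. (k x \<bullet> b) *\<^sub>R b)"
        by (simp add: scaleR_sum_right mult_ac)
      then show "(\<Sum>b\<in>Basis. (indicator K x *\<^sub>R (k x \<bullet> b) *\<^sub>R h x) *\<^sub>R b) = indicator K x *\<^sub>R h x *\<^sub>R k x"
        by (simp add: euclidean_representation)
    qed
    finally show "integrable lebesgue (\<lambda>x. indicator K x *\<^sub>R h x *\<^sub>R k x)" .
  qed
qed

lemma locally_integrable_add:
  assumes "locally_integrable \<Omega> f" "locally_integrable \<Omega> g"
  shows "locally_integrable \<Omega> (\<lambda>x. f x + g x)"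
  using assms by (auto simp: locally_integrable_def intro: set_integral_add)

lemma locally_integrable_const: "locally_integrable \<Omega> (\<lambda>x. c)"
proof -
  have "integrable lebesgue (\<lambda>x. indicator K x *\<^sub>R c)" if "compact K" for K :: "'a set"
    using lmeasurable_compact[OF that] by (intro integrable_scaleR_left) (auto simp: fmeasurable_def)
  then show ?thesis by (auto simp: locally_integrable_def set_integrable_def)
qed

lemma locally_integrable_imp_integrable:
  assumes \<Omega>: "open \<Omega>" and h: "locally_integrable \<Omega> h" and K: "compact K" "K \<subseteq> \<Omega>"
    and z: "\<And>x. x \<in> \<Omega> \<Longrightarrow> x \<notin> K \<Longrightarrow> h x = 0"
  shows "integrable (lebesgue_on \<Omega>) h"
proof -
  have "integrable lebesgue (\<lambda>x. indicator K x *\<^sub>R h x)"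
    using h K by (auto simp: locally_integrable_def set_integrable_def)
  also have "(\<lambda>x. indicator K x *\<^sub>R h x) = (\<lambda>x. indicator \<Omega> x *\<^sub>R h x)"
    using z K by (auto simp: indicator_def fun_eq_iff)
  finally show ?thesis using \<Omega> by (subst integrable_restrict_space) auto
qed

lemma has_weak_gradient_integrable:
  assumes \<Omega>: "open \<Omega>" and w: "has_weak_gradient \<Omega> f g" and \<phi>: "\<phi> \<in> C1c \<Omega>"
  shows "integrable (lebesgue_on \<Omega>) (\<lambda>x. f x *\<^sub>R gradient \<phi> x)" "integrable (lebesgue_on \<Omega>) (\<lambda>x. \<phi> x *\<^sub>R g x)"
proof -
  note C = C1cD[OF \<phi>]
  have c: "continuous_on \<Omega> \<phi>" "continuous_on \<Omega> (gradient \<phi>)" using C continuous_on_subset by blast+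
  have lf: "locally_integrable \<Omega> f" and lg: "locally_integrable \<Omega> g" using w by (auto simp: has_weak_gradient_def)
  show "integrable (lebesgue_on \<Omega>) (\<lambda>x. f x *\<^sub>R gradient \<phi> x)"
    by (rule locally_integrable_imp_integrable[OF \<Omega> locally_integrable_scaleR_continuous[OF c(2) lf] C(4,5)]) (simp add: C(7))
  show "integrable (lebesgue_on \<Omega>) (\<lambda>x. \<phi> x *\<^sub>R g x)"
    by (rule locally_integrable_imp_integrable[OF \<Omega> locally_integrable_continuous_scaleR[OF c(1) lg] C(4,5)]) (simp add: C(6))
qed

lemma has_weak_gradient_add:
  assumes \<Omega>: "open \<Omega>" and w: "has_weak_gradient \<Omega> f1 g1" "has_weak_gradient \<Omega> f2 g2"
  shows "has_weak_gradient \<Omega> (\<lambda>x. f1 x + f2 x) (\<lambda>x. g1 x + g2 x)"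
  unfolding has_weak_gradient_def
proof (intro conjI ballI)
  show "locally_integrable \<Omega> (\<lambda>x. f1 x + f2 x)" "locally_integrable \<Omega> (\<lambda>x. g1 x + g2 x)"
    using w by (auto simp: has_weak_gradient_def intro: locally_integrable_add)
  fix \<phi> :: "'a \<Rightarrow> real" assume \<phi>: "\<phi> \<in> C1c \<Omega>"
  note i = has_weak_gradient_integrable[OF \<Omega> w(1) \<phi>] has_weak_gradient_integrable[OF \<Omega> w(2) \<phi>]
  show "(LINT x|lebesgue_on \<Omega>. (f1 x + f2 x) *\<^sub>R gradient \<phi> x) = - (LINT x|lebesgue_on \<Omega>. \<phi> x *\<^sub>R (g1 x + g2 x))"
    using w \<phi> i by (simp add: has_weak_gradient_def scaleR_add_left scaleR_add_right)
qed

lemma integral_gradient_C1c: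
  fixes \<phi> :: "'a::euclidean_space \<Rightarrow> real"
  assumes "\<phi> \<in> C1c \<Omega>"
  shows "(\<integral>x. gradient \<phi> x \<partial>lborel) = 0"
proof -
  note C = C1cD[OF assms]
  obtain r B where "\<forall>x. norm x \<ge> r \<longrightarrow> \<phi> x = 0 \<and> gradient \<phi> x = 0" "\<forall>x. norm (gradient \<phi> x) \<le> B"
    using C1c_bounded[OF assms] by blast
  then show ?thesis
    using C by (intro integral_gradient_zero[where B = B and r = r and \<psi> = \<phi>]) (auto intro: borel_measurable_continuous_onI)
qed

lemma has_weak_gradient_const:
  assumes \<Omega>: "open \<Omega>"
  shows "has_weak_gradient \<Omega> (\<lambda>x. c) (\<lambda>x. 0)"
  unfolding has_weak_gradient_def
proof (intro conjI ballI locally_integrable_const)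
  fix \<phi> :: "'a \<Rightarrow> real" assume \<phi>: "\<phi> \<in> C1c \<Omega>"
  note C = C1cD[OF \<phi>]
  have "(LINT x|lebesgue_on \<Omega>. c *\<^sub>R gradient \<phi> x) = (\<integral>x. c *\<^sub>R gradient \<phi> x \<partial>lborel)"
  proof (rule integral_lebesgue_on_borel)
    have [measurable]: "gradient \<phi> \<in> borel_measurable borel" using C by (intro borel_measurable_continuous_onI)
    show "(\<lambda>x. c *\<^sub>R gradient \<phi> x) \<in> borel_measurable borel" by measurable
    then show "(\<lambda>x. c *\<^sub>R gradient \<phi> x) \<in> borel_measurable (lebesgue_on \<Omega>)"
      by (intro measurable_restrict_space1 measurable_completion) simp
    have "gradient \<phi> x = 0" if "x \<notin> \<Omega>" for x using C(5) C(7)[of x] that by blast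
    then show "AE x in lebesgue. indicator \<Omega> x *\<^sub>R c *\<^sub>R gradient \<phi> x = c *\<^sub>R gradient \<phi> x"
      by (auto simp: indicator_def)
  qed (use \<Omega> in auto)
  then show "(LINT x|lebesgue_on \<Omega>. c *\<^sub>R gradient \<phi> x) = - (LINT x|lebesgue_on \<Omega>. \<phi> x *\<^sub>R 0)"
    using integral_gradient_C1c[OF \<phi>] by simp
qed

text \<open>
  Test the weak gradient of \<open>f\<close> with \<open>a \<phi>\<close>. It is a \<open>C\<^sup>1\<close> function on the whole space, although \<open>a\<close> is
  differentiable in \<open>\<Omega>\<close> only, because \<open>\<phi>\<close> has compact support in \<open>\<Omega>\<close>.
\<close>

lemma has_weak_gradient_mult:
  fixes a :: "'a::euclidean_space \<Rightarrow> real"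
  assumes \<Omega>: "open \<Omega>" and a: "\<And>x. x \<in> \<Omega> \<Longrightarrow> (a has_derivative (\<lambda>h. a' x \<bullet> h)) (at x)" "continuous_on \<Omega> a'"
    and w: "has_weak_gradient \<Omega> f g"
  shows "has_weak_gradient \<Omega> (\<lambda>x. a x * f x) (\<lambda>x. a x *\<^sub>R g x + f x *\<^sub>R a' x)"
  unfolding has_weak_gradient_def
proof (intro conjI ballI)
  have ca: "continuous_on \<Omega> a" using a(1) \<Omega> by (meson continuous_at_imp_continuous_on has_derivative_continuous)
  have lf: "locally_integrable \<Omega> f" and lg: "locally_integrable \<Omega> g" using w by (auto simp: has_weak_gradient_def)
  show l1: "locally_integrable \<Omega> (\<lambda>x. a x * f x)"
    using locally_integrable_continuous_scaleR[OF ca lf] by simp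
  have l2: "locally_integrable \<Omega> (\<lambda>x. a x *\<^sub>R g x)" by (rule locally_integrable_continuous_scaleR[OF ca lg])
  have l3: "locally_integrable \<Omega> (\<lambda>x. f x *\<^sub>R a' x)" by (rule locally_integrable_scaleR_continuous[OF a(2) lf])
  show "locally_integrable \<Omega> (\<lambda>x. a x *\<^sub>R g x + f x *\<^sub>R a' x)" by (rule locally_integrable_add[OF l2 l3])
  fix \<phi> :: "'a \<Rightarrow> real" assume \<phi>: "\<phi> \<in> C1c \<Omega>"
  note C = C1cD[OF \<phi>]
  let ?S = "support \<phi>"
  have oS: "open (- ?S)" using compact_imp_closed[OF C(4)] by (rule open_Compl)
  define \<theta> where "\<theta> x = a x * \<phi> x" for x
  define \<theta>' where "\<theta>' x = a x *\<^sub>R gradient \<phi> x + \<phi> x *\<^sub>R a' x" for x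
  have z: "\<theta> x = 0" "\<theta>' x = 0" if "x \<notin> ?S" for x using C(6,7)[OF that] by (auto simp: \<theta>_def \<theta>'_def)
  have d: "(\<theta> has_derivative (\<lambda>h. \<theta>' x \<bullet> h)) (at x)" for x
  proof (cases "x \<in> ?S")
    case True
    then have "x \<in> \<Omega>" using C by auto
    from has_derivative_mult[OF a(1)[OF this] C(1)]
    show ?thesis unfolding \<theta>_def[abs_def] by (rule has_derivative_eq_rhs) (auto simp: \<theta>'_def inner_add_left)
  next
    case False
    have "((\<lambda>x. 0) has_derivative (\<lambda>h. 0)) (at x)" by simp
    then have "(\<theta> has_derivative (\<lambda>h. 0)) (at x)"
      by (rule has_derivative_transform_within_open[OF _ oS]) (use False z in auto)
    then show ?thesis using z(2)[OF False] by simp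
  qed
  have "continuous_on (\<Omega> \<union> - ?S) \<theta>'"
  proof (rule continuous_on_open_Un[OF \<Omega> oS])
    show "continuous_on \<Omega> \<theta>'" unfolding \<theta>'_def
      by (intro continuous_intros ca a(2) continuous_on_subset[OF C(2)] continuous_on_subset[OF C(3)]) auto
    show "continuous_on (- ?S) \<theta>'" by (rule continuous_on_eq[OF continuous_on_const[of _ 0]]) (simp add: z(2))
  qed
  moreover have "\<Omega> \<union> - ?S = UNIV" using C by auto
  ultimately have c: "continuous_on UNIV \<theta>'" by simp
  have \<theta>: "\<theta> \<in> C1c \<Omega>" by (rule C1cI[OF d c C(4,5) z(1)])
  have gr: "gradient \<theta> = \<theta>'" using gradient_eqI[OF d] by auto
  have "(LINT x|lebesgue_on \<Omega>. f x *\<^sub>R gradient \<theta> x) = - (LINT x|lebesgue_on \<Omega>. \<theta> x *\<^sub>R g x)"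
    using w \<theta> by (auto simp: has_weak_gradient_def)
  moreover have c\<phi>: "continuous_on \<Omega> \<phi>" "continuous_on \<Omega> (gradient \<phi>)" using C continuous_on_subset by blast+
  have i1: "integrable (lebesgue_on \<Omega>) (\<lambda>x. (a x * f x) *\<^sub>R gradient \<phi> x)"
    by (rule locally_integrable_imp_integrable[OF \<Omega> locally_integrable_scaleR_continuous[OF c\<phi>(2) l1] C(4,5)]) (simp add: C(7))
  have i2: "integrable (lebesgue_on \<Omega>) (\<lambda>x. \<phi> x *\<^sub>R f x *\<^sub>R a' x)"
    by (rule locally_integrable_imp_integrable[OF \<Omega> locally_integrable_continuous_scaleR[OF c\<phi>(1) l3] C(4,5)]) (simp add: C(6))
  have i3: "integrable (lebesgue_on \<Omega>) (\<lambda>x. \<phi> x *\<^sub>R a x *\<^sub>R g x)"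
    by (rule locally_integrable_imp_integrable[OF \<Omega> locally_integrable_continuous_scaleR[OF c\<phi>(1) l2] C(4,5)]) (simp add: C(6))
  have "(LINT x|lebesgue_on \<Omega>. f x *\<^sub>R gradient \<theta> x) =
     (LINT x|lebesgue_on \<Omega>. (a x * f x) *\<^sub>R gradient \<phi> x + \<phi> x *\<^sub>R f x *\<^sub>R a' x)"
    unfolding gr \<theta>'_def by (intro Bochner_Integration.integral_cong) (auto simp: scaleR_add_right mult_ac)
  also have "\<dots> = (LINT x|lebesgue_on \<Omega>. (a x * f x) *\<^sub>R gradient \<phi> x) + (LINT x|lebesgue_on \<Omega>. \<phi> x *\<^sub>R f x *\<^sub>R a' x)"
    by (rule Bochner_Integration.integral_add[OF i1 i2])
  moreover have "(LINT x|lebesgue_on \<Omega>. \<theta> x *\<^sub>R g x) = (LINT x|lebesgue_on \<Omega>. \<phi> x *\<^sub>R a x *\<^sub>R g x)"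
    unfolding \<theta>_def by (intro Bochner_Integration.integral_cong) (auto simp: mult_ac)
  moreover have "(LINT x|lebesgue_on \<Omega>. \<phi> x *\<^sub>R (a x *\<^sub>R g x + f x *\<^sub>R a' x)) =
     (LINT x|lebesgue_on \<Omega>. \<phi> x *\<^sub>R a x *\<^sub>R g x) + (LINT x|lebesgue_on \<Omega>. \<phi> x *\<^sub>R f x *\<^sub>R a' x)"
    unfolding scaleR_add_right by (rule Bochner_Integration.integral_add[OF i3 i2])
  ultimately show "(LINT x|lebesgue_on \<Omega>. (a x * f x) *\<^sub>R gradient \<phi> x) =
      - (LINT x|lebesgue_on \<Omega>. \<phi> x *\<^sub>R (a x *\<^sub>R g x + f x *\<^sub>R a' x))"
    by (simp add: algebra_simps eq_neg_iff_add_eq_0)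
qed

lemma C1_closure_functional:
  fixes f :: "'a::euclidean_space \<Rightarrow> 'b::real_normed_vector"
  assumes "C1_closure \<Omega> f" and L: "bounded_linear (L :: 'b \<Rightarrow> real)"
  shows "\<exists>a'. continuous_on \<Omega> a' \<and> (\<forall>x\<in>\<Omega>. ((\<lambda>x. L (f x)) has_derivative (\<lambda>h. a' x \<bullet> h)) (at x))"
proof -
  obtain f' :: "'a \<Rightarrow> 'a \<Rightarrow>\<^sub>L 'b" where c: "continuous_on (closure \<Omega>) f'"
    and d: "\<And>x. x \<in> \<Omega> \<Longrightarrow> (f has_derivative blinfun_apply (f' x)) (at x)"
    using assms(1) by (auto simp: C1_closure_def)
  define a' where "a' x = (\<Sum>b\<in>Basis. L (f' x b) *\<^sub>R b)" for x
  have c': "continuous_on \<Omega> f'" using c by (rule continuous_on_subset) (rule closure_subset)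
  have "continuous_on \<Omega> a'" unfolding a'_def
    by (intro continuous_intros bounded_linear.continuous_on[OF L] c')
  moreover have "((\<lambda>x. L (f x)) has_derivative (\<lambda>h. a' x \<bullet> h)) (at x)" if "x \<in> \<Omega>" for x
  proof -
    have D: "((\<lambda>x. L (f x)) has_derivative (\<lambda>h. L (f' x h))) (at x)"
      by (rule bounded_linear.has_derivative[OF L d[OF that]])
    have "gradient (\<lambda>x. L (f x)) x = a' x"
      unfolding gradient_def frechet_derivative_at[OF D, symmetric] a'_def ..
    then show ?thesis using has_derivative_gradient[OF D] by simp
  qed
  ultimately show ?thesis by blast
qed

lemma has_weak_gradient_sum:
  assumes \<Omega>: "open \<Omega>" and "finite J" and w: "\<And>j. j \<in> J \<Longrightarrow> \<exists>g. has_weak_gradient \<Omega> (f j) g"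
  shows "\<exists>g. has_weak_gradient \<Omega> (\<lambda>x. \<Sum>j\<in>J. f j x) g"
  using assms(2,3)
proof (induction J rule: finite_induct)
  case empty
  then show ?case using has_weak_gradient_const[OF \<Omega>, of 0] by auto
next
  case (insert j J)
  then show ?case using has_weak_gradient_add[OF \<Omega>] by (simp, metis)
qed

text \<open>
  The product rule, with the function 1 in place of \<open>u\<close> for the term \<open>m\<close>, shows that a weak gradient
  exists; so the choice in \<open>weak_gradient\<close> returns one.
\<close>

lemma fitness_has_weak_gradient:
  fixes m :: "'a::euclidean_space \<Rightarrow> real ^ 'n"
  assumes \<Omega>: "open \<Omega>" and m: "C1_closure \<Omega> m" and A: "C1_closure \<Omega> A"
    and u: "\<And>j. \<exists>g. has_weak_gradient \<Omega> (\<lambda>x. u x $ j) g"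
  shows "has_weak_gradient \<Omega> (fitness m A u i) (weak_gradient \<Omega> (fitness m A u i))"
proof -
  have "bounded_linear (\<lambda>v :: real ^ 'n. v $ i)" by (rule bounded_linear_vec_nth)
  from C1_closure_functional[OF m this]
  obtain m' where m': "continuous_on \<Omega> m'" "\<And>x. x \<in> \<Omega> \<Longrightarrow> ((\<lambda>x. m x $ i) has_derivative (\<lambda>h. m' x \<bullet> h)) (at x)" by blast
  have 1: "\<exists>g. has_weak_gradient \<Omega> (\<lambda>x. m x $ i) g"
    using has_weak_gradient_mult[OF \<Omega> m'(2,1) has_weak_gradient_const[OF \<Omega>, of 1]] by auto
  have 2: "\<exists>g. has_weak_gradient \<Omega> (\<lambda>x. - (A x $ i $ j) * u x $ j) g" for j
  proof -
    have "bounded_linear (\<lambda>v :: real ^ 'n ^ 'n. - (v $ i $ j))"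
      by (intro bounded_linear_minus bounded_linear_compose[OF bounded_linear_vec_nth bounded_linear_vec_nth])
    from C1_closure_functional[OF A this]
    obtain a' where a': "continuous_on \<Omega> a'" "\<And>x. x \<in> \<Omega> \<Longrightarrow> ((\<lambda>x. - (A x $ i $ j)) has_derivative (\<lambda>h. a' x \<bullet> h)) (at x)" by blast
    obtain g where "has_weak_gradient \<Omega> (\<lambda>x. u x $ j) g" using u by blast
    from has_weak_gradient_mult[OF \<Omega> a'(2,1) this] show ?thesis by blast
  qed
  obtain g1 where g1: "has_weak_gradient \<Omega> (\<lambda>x. m x $ i) g1" using 1 by blast
  obtain g2 where g2: "has_weak_gradient \<Omega> (\<lambda>x. \<Sum>j\<in>UNIV. - (A x $ i $ j) * u x $ j) g2"
    using has_weak_gradient_sum[OF \<Omega> finite_class.finite_UNIV, of "\<lambda>j x. - (A x $ i $ j) * u x $ j"] 2 by blast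
  have "fitness m A u i = (\<lambda>x. m x $ i + (\<Sum>j\<in>UNIV. - (A x $ i $ j) * u x $ j))"
    by (auto simp: fitness_def sum_negf)
  then have "has_weak_gradient \<Omega> (fitness m A u i) (\<lambda>x. g1 x + g2 x)"
    using has_weak_gradient_add[OF \<Omega> g1 g2] by simp
  then show ?thesis unfolding weak_gradient_def by (rule someI[of "has_weak_gradient \<Omega> (fitness m A u i)"])
qed

section \<open>A linear form of the isoperimetric inequality\<close>

lemma C1c_component:
  fixes T :: "'a::euclidean_space \<Rightarrow> 'a"
  assumes T: "T \<in> C1c \<Omega>"
  shows "(\<lambda>x. T x \<bullet> b) \<in> C1c \<Omega>"
    and "divergence T x = (\<Sum>b\<in>Basis. gradient (\<lambda>x. T x \<bullet> b) x \<bullet> b)"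
proof -
  have cl: "C1_closure UNIV T" and K: "compact (support T)" "support T \<subseteq> \<Omega>" using T by (auto simp: C1c_def)
  show "(\<lambda>x. T x \<bullet> b) \<in> C1c \<Omega>" for b
  proof -
    obtain a' where a': "continuous_on UNIV a'" "\<And>x. ((\<lambda>x. T x \<bullet> b) has_derivative (\<lambda>h. a' x \<bullet> h)) (at x)"
      using C1_closure_functional[OF cl bounded_linear_inner_left[of b]] by auto
    have "T x \<bullet> b = 0" if "x \<notin> support T" for x
    proof -
      have "x \<notin> {x. T x \<noteq> 0}" using that closure_subset[of "{x. T x \<noteq> 0}"] unfolding support_def by blast
      then show ?thesis by simp
    qed
    then show ?thesis by (rule C1cI[OF a'(2,1) K])
  qed
  obtain T' :: "'a \<Rightarrow> 'a \<Rightarrow>\<^sub>L 'a" where "\<And>x. (T has_derivative blinfun_apply (T' x)) (at x)"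
    using cl by (auto simp: C1_closure_def)
  then have d: "(T has_derivative blinfun_apply (T' x)) (at x)" .
  show "divergence T x = (\<Sum>b\<in>Basis. gradient (\<lambda>x. T x \<bullet> b) x \<bullet> b)"
    unfolding divergence_def frechet_derivative_at[OF d, symmetric]
  proof (rule sum.cong)
    fix b :: 'a
    have D: "((\<lambda>x. T x \<bullet> b) has_derivative (\<lambda>h. T' x h \<bullet> b)) (at x)"
      by (rule bounded_linear.has_derivative[OF bounded_linear_inner_left d])
    have "gradient (\<lambda>x. T x \<bullet> b) x \<bullet> b = T' x b \<bullet> b"
      using has_derivative_unique[OF has_derivative_gradient[OF D] D] by metis
    then show "T' x b \<bullet> b = gradient (\<lambda>x. T x \<bullet> b) x \<bullet> b" ..
  qed simp
qed

lemma divergence_props: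
  fixes T :: "'a::euclidean_space \<Rightarrow> 'a"
  assumes T: "T \<in> C1c \<Omega>"
  shows "integrable lebesgue (divergence T)" "(LINT x|lebesgue. divergence T x) = 0" "x \<notin> \<Omega> \<Longrightarrow> divergence T x = 0"
    "integrable lborel (divergence T)"
proof -
  note Tb = C1c_component(1)[OF T]
  have i: "integrable lborel (gradient (\<lambda>x. T x \<bullet> b))" for b
  proof -
    obtain r where "\<forall>x. norm x \<ge> r \<longrightarrow> gradient (\<lambda>x. T x \<bullet> b) x = 0" using C1c_bounded[OF Tb] by blast
    then show ?thesis using C1cD(2)[OF Tb] by (intro integrable_continuous_compact_support[of _ r]) auto
  qed
  have eq: "divergence T = (\<lambda>x. \<Sum>b\<in>Basis. gradient (\<lambda>x. T x \<bullet> b) x \<bullet> b)"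
    using C1c_component(2)[OF T] by auto
  show il: "integrable lborel (divergence T)" unfolding eq using i by auto
  then have m: "divergence T \<in> borel_measurable lborel" by auto
  show "integrable lebesgue (divergence T)" using il integrable_completion[OF m] by simp
  have "(LINT x|lebesgue. divergence T x) = (\<integral>x. divergence T x \<partial>lborel)" using m by (rule integral_completion)
  also have "\<dots> = (\<Sum>b\<in>Basis. (\<integral>x. gradient (\<lambda>x. T x \<bullet> b) x \<partial>lborel) \<bullet> b)"
    unfolding eq using i by (simp add: Bochner_Integration.integral_sum)
  also have "\<dots> = 0" using integral_gradient_C1c[OF Tb] by simp
  finally show "(LINT x|lebesgue. divergence T x) = 0" .
  show "x \<notin> \<Omega> \<Longrightarrow> divergence T x = 0" unfolding eq using C1cD(5,7)[OF Tb] by (intro sum.neutral ballI) (metis inner_zero_left subsetD)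
qed

text \<open>
  Bounded measure makes \<open>\<bar>E\<bar>\<close> at most \<open>\<bar>E\<bar> powr ((d - 1) / d) * \<bar>\<Omega>\<bar> powr (1 / d)\<close>, so the isoperimetric
  inequality bounds \<open>\<bar>E\<bar>\<close> linearly by the perimeter if \<open>\<bar>E\<bar> \<le> \<bar>\<Omega>\<bar> / 2\<close>. Otherwise it is applied to
  the complement, whose Gauss--Green functional is the negative of that of \<open>E\<close>, because the divergence of a test field has
  integral zero over \<open>\<Omega>\<close>. A bound on the absolute value of the functional serves both cases.
\<close>

lemma isoperimetric_linear:
  fixes \<Omega> :: "'a::euclidean_space set"
  assumes \<Omega>: "open \<Omega>" "bounded \<Omega>" and iso: "relative_isoperimetric \<Omega>"
  shows "\<exists>C>0. \<forall>E\<in>sets lebesgue. \<forall>M. E \<subseteq> \<Omega> \<longrightarrow>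
     (\<forall>T\<in>C1c \<Omega>. (\<forall>x. norm (T x) \<le> 1) \<longrightarrow> \<bar>gauss_green E T\<bar> \<le> M) \<longrightarrow>
     measure lebesgue E \<le> C * M \<or> measure lebesgue (\<Omega> - E) \<le> C * M"
proof -
  let ?d = "real DIM('a)"
  let ?\<mu> = "measure lebesgue"
  have fin: "\<Omega> \<in> lmeasurable" using \<Omega> by (simp add: lmeasurable_open)
  obtain c where c: "c > 0" and cE: "\<And>E. E \<in> sets lebesgue \<Longrightarrow> E \<subseteq> \<Omega> \<Longrightarrow> locally_finite_perimeter E \<Omega> \<Longrightarrow>
     ?\<mu> E \<le> ?\<mu> \<Omega> / 2 \<Longrightarrow> ereal (c * ?\<mu> E powr ((?d - 1) / ?d)) \<le> relative_perimeter E \<Omega>"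
    using iso unfolding relative_isoperimetric_def by blast
  define C where "C = (?\<mu> \<Omega> powr (1 / ?d) + 1) / c"
  have C: "C > 0" using c by (simp add: C_def add_nonneg_pos)
  have main: "?\<mu> E \<le> C * M"
    if E: "E \<in> sets lebesgue" "E \<subseteq> \<Omega>" and half: "?\<mu> E \<le> ?\<mu> \<Omega> / 2"
      and M: "\<And>T. T \<in> C1c \<Omega> \<Longrightarrow> (\<And>x. norm (T x) \<le> 1) \<Longrightarrow> gauss_green E T \<le> M" for E M
  proof -
    have per: "relative_perimeter E V \<le> ereal M" if "V \<subseteq> \<Omega>" for V
      unfolding relative_perimeter_def total_variation_def
    proof (rule SUP_least)
      fix T :: "'a \<Rightarrow> 'a" assume T: "T \<in> {T \<in> C1c V. \<forall>x. norm (T x) \<le> 1}"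
      then have "T \<in> C1c \<Omega>" using that by (auto simp: C1c_def)
      with T show "ereal (gauss_green E T) \<le> ereal M" using M by auto
    qed
    have "relative_perimeter E V < \<infinity>" if "closure V \<subseteq> \<Omega>" for V
      using per[of V] closure_subset that by (metis ereal_infty_less(1) ereal_less_eq(1) less_ereal.simps(4) order_le_less_trans subset_trans)
    then have "locally_finite_perimeter E \<Omega>" by (auto simp: locally_finite_perimeter_def)
    from cE[OF E this half] per[of \<Omega>] have le: "c * ?\<mu> E powr ((?d - 1) / ?d) \<le> M"
      by (meson ereal_less_eq(3) order_trans subset_refl)
    have M0: "M \<ge> 0" using le c by (meson mult_nonneg_nonneg less_imp_le order_trans powr_ge_zero)
    show ?thesis
    proof (cases "?\<mu> E = 0")
      case False
      then have pos: "?\<mu> E > 0" by (simp add: zero_less_measure_iff)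
      have "?\<mu> E = ?\<mu> E powr ((?d - 1) / ?d + 1 / ?d)" using pos by (simp add: add_divide_distrib[symmetric])
      also have "\<dots> = ?\<mu> E powr ((?d - 1) / ?d) * ?\<mu> E powr (1 / ?d)" by (rule powr_add)
      also have "\<dots> \<le> (M / c) * (?\<mu> \<Omega> powr (1 / ?d))"
      proof (intro mult_mono powr_mono2)
        show "?\<mu> E powr ((?d - 1) / ?d) \<le> M / c" using le c by (simp add: field_simps)
        show "?\<mu> E \<le> ?\<mu> \<Omega>" using E fin by (intro measure_mono_fmeasurable)
      qed (use M0 c in auto)
      also have "\<dots> \<le> C * M" using M0 c by (simp add: C_def field_simps)
      finally show ?thesis .
    qed (use M0 C in auto)
  qed
  show ?thesis
  proof (intro exI[of _ C] conjI C ballI allI impI)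
    fix E M assume E: "E \<in> sets lebesgue" "E \<subseteq> \<Omega>"
      and M: "\<forall>T\<in>C1c \<Omega>. (\<forall>x. norm (T x) \<le> 1) \<longrightarrow> \<bar>gauss_green E T\<bar> \<le> M"
    show "?\<mu> E \<le> C * M \<or> ?\<mu> (\<Omega> - E) \<le> C * M"
    proof (cases "?\<mu> E \<le> ?\<mu> \<Omega> / 2")
      case True
      have "?\<mu> E \<le> C * M" by (rule main[OF E True]) (use M abs_le_D1 in blast)
      then show ?thesis ..
    next
      case False
      have \<Omega>s: "\<Omega> \<in> sets lebesgue" using fin by auto
      have "?\<mu> (\<Omega> - E) = ?\<mu> \<Omega> - ?\<mu> E" using E fin by (intro measurable_measure_Diff) auto
      then have half: "?\<mu> (\<Omega> - E) \<le> ?\<mu> \<Omega> / 2" using False by simp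
      have "gauss_green (\<Omega> - E) T = - gauss_green E T" if T: "T \<in> C1c \<Omega>" for T
      proof -
        note dp = divergence_props[OF T]
        have ii: "integrable lebesgue (\<lambda>x. indicator S x *\<^sub>R divergence T x)" if "S \<in> sets lebesgue" for S
          using that dp(1) by (rule integrable_mult_indicator)
        have "gauss_green E T + gauss_green (\<Omega> - E) T =
          (LINT x|lebesgue. indicator E x *\<^sub>R divergence T x + indicator (\<Omega> - E) x *\<^sub>R divergence T x)"
          unfolding gauss_green_def set_lebesgue_integral_def
          by (rule Bochner_Integration.integral_add[symmetric]; intro ii) (use E \<Omega>s in auto)
        also have "\<dots> = (LINT x|lebesgue. divergence T x)"
          using dp(3) E by (intro Bochner_Integration.integral_cong) (auto simp: indicator_def)
        finally show ?thesis using dp(2) by simp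
      qed
      then have "gauss_green (\<Omega> - E) T \<le> M" if "T \<in> C1c \<Omega>" "\<And>x. norm (T x) \<le> 1" for T
        using M that abs_le_D2 by metis
      then have "?\<mu> (\<Omega> - E) \<le> C * M"
        using E \<Omega>s half by (intro main) auto
      then show ?thesis ..
    qed
  qed
qed


section \<open>Cutoff functions\<close>

text \<open>
  The integral of the tent function on \<open>{0..1}\<close> with maximum 2.
\<close>

definition smoothstep :: "real \<Rightarrow> real" where
  "smoothstep s = 2 * (max 0 s)\<^sup>2 - 4 * (max 0 (s - 1/2))\<^sup>2 + 2 * (max 0 (s - 1))\<^sup>2"

definition smoothstep' :: "real \<Rightarrow> real" where
  "smoothstep' s = 4 * max 0 s - 8 * max 0 (s - 1/2) + 4 * max 0 (s - 1)"

lemma smoothstep_deriv: "(smoothstep has_real_derivative smoothstep' s) (at s)"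
proof -
  have q: "((\<lambda>s. (max 0 (s - c))\<^sup>2) has_real_derivative 2 * max 0 (s - c)) (at s)" for c
  proof -
    have "((\<lambda>s. s - c) has_real_derivative 1) (at s)" by (auto intro!: derivative_eq_intros)
    from DERIV_chain2[where f = "\<lambda>s. (max 0 s)\<^sup>2" and g = "\<lambda>s. s - c", OF has_real_derivative_pos_part_square this]
    show ?thesis by simp
  qed
  show ?thesis
    unfolding smoothstep_def[abs_def]
    by (rule DERIV_cong[OF DERIV_add[OF DERIV_diff[OF DERIV_cmult[OF q[of 0, simplified]] DERIV_cmult[OF q]] DERIV_cmult[OF q]]])
      (simp add: smoothstep'_def)
qed

lemma smoothstep_0: "s \<le> 0 \<Longrightarrow> smoothstep s = 0"
  by (simp add: smoothstep_def max_def)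

lemma smoothstep_1: "s \<ge> 1 \<Longrightarrow> smoothstep s = 1"
  by (simp add: smoothstep_def max_def power2_eq_square algebra_simps)

lemma smoothstep_bounds: "0 \<le> smoothstep s" "smoothstep s \<le> 1"
proof -
  consider "s \<le> 0" | "0 < s" "s \<le> 1/2" | "1/2 < s" "s < 1" | "s \<ge> 1" by linarith
  then have "0 \<le> smoothstep s \<and> smoothstep s \<le> 1"
  proof cases
    case 2
    then have "smoothstep s = 2 * s\<^sup>2" by (simp add: smoothstep_def max_def)
    moreover have "s\<^sup>2 \<le> (1/2)\<^sup>2" using 2 by (intro power_mono) auto
    ultimately show ?thesis by (simp add: power2_eq_square)
  next
    case 3
    then have "smoothstep s = 1 - 2 * (1 - s)\<^sup>2" by (simp add: smoothstep_def max_def power2_eq_square algebra_simps)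
    moreover have "(1 - s)\<^sup>2 \<le> (1/2)\<^sup>2" using 3 by (intro power_mono) auto
    ultimately show ?thesis by (simp add: power2_eq_square)
  qed (simp_all add: smoothstep_0 smoothstep_1)
  then show "0 \<le> smoothstep s" "smoothstep s \<le> 1" by auto
qed

lemma smoothstep'_bound: "\<bar>smoothstep' s\<bar> \<le> 2"
  by (auto simp: smoothstep'_def max_def abs_if)

lemma smoothstep'_0: "s \<le> 0 \<or> s \<ge> 1 \<Longrightarrow> smoothstep' s = 0"
  by (auto simp: smoothstep'_def max_def)

text \<open>
  A smoothed indicator of \<open>{s. \<bar>s\<bar> \<le> t}\<close> or of \<open>{s. s > t}\<close>. In both cases the transition takes place
  within \<open>t < \<bar>s\<bar> < t + \<epsilon>\<close>, outside the closed interval, so that the limit for \<open>\<epsilon> \<rightarrow> 0\<close> is the exact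
  indicator at the points \<open>\<bar>s\<bar> = t\<close> too.
\<close>

definition cutoff :: "bool \<Rightarrow> real \<Rightarrow> real \<Rightarrow> real \<Rightarrow> real" where
  "cutoff k t \<epsilon> s = (if k then (1 - smoothstep ((s - t) / \<epsilon>)) * (1 - smoothstep ((- s - t) / \<epsilon>))
     else smoothstep ((s - t) / \<epsilon>))"

definition cutoff' :: "bool \<Rightarrow> real \<Rightarrow> real \<Rightarrow> real \<Rightarrow> real" where
  "cutoff' k t \<epsilon> s = (if k then - (smoothstep' ((s - t) / \<epsilon>) / \<epsilon>) * (1 - smoothstep ((- s - t) / \<epsilon>))
       + (1 - smoothstep ((s - t) / \<epsilon>)) * (smoothstep' ((- s - t) / \<epsilon>) / \<epsilon>)
     else smoothstep' ((s - t) / \<epsilon>) / \<epsilon>)"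

lemma cutoff_deriv: "(cutoff k t \<epsilon> has_real_derivative cutoff' k t \<epsilon> s) (at s)"
proof -
  have 1: "((\<lambda>s. smoothstep ((s - t) / \<epsilon>)) has_real_derivative smoothstep' ((s - t) / \<epsilon>) * (1 / \<epsilon>)) (at s)"
    by (rule DERIV_chain2[OF smoothstep_deriv]) (auto intro!: derivative_eq_intros simp: divide_inverse)
  have 2: "((\<lambda>s. smoothstep ((- s - t) / \<epsilon>)) has_real_derivative smoothstep' ((- s - t) / \<epsilon>) * (- 1 / \<epsilon>)) (at s)"
    by (rule DERIV_chain2[OF smoothstep_deriv]) (auto intro!: derivative_eq_intros simp: divide_inverse)
  show ?thesis
    unfolding cutoff_def[abs_def] cutoff'_def
  proof (cases k)
    case True
    have "((\<lambda>s. (1 - smoothstep ((s - t) / \<epsilon>)) * (1 - smoothstep ((- s - t) / \<epsilon>))) has_real_derivative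
       (0 - smoothstep' ((s - t) / \<epsilon>) * (1 / \<epsilon>)) * (1 - smoothstep ((- s - t) / \<epsilon>)) +
       (0 - smoothstep' ((- s - t) / \<epsilon>) * (- 1 / \<epsilon>)) * (1 - smoothstep ((s - t) / \<epsilon>))) (at s)"
      by (rule DERIV_mult[OF DERIV_diff[OF DERIV_const 1] DERIV_diff[OF DERIV_const 2]])
    then show "((\<lambda>s. if k then (1 - smoothstep ((s - t) / \<epsilon>)) * (1 - smoothstep ((- s - t) / \<epsilon>))
       else smoothstep ((s - t) / \<epsilon>)) has_real_derivative
       (if k then - (smoothstep' ((s - t) / \<epsilon>) / \<epsilon>) * (1 - smoothstep ((- s - t) / \<epsilon>))
       + (1 - smoothstep ((s - t) / \<epsilon>)) * (smoothstep' ((- s - t) / \<epsilon>) / \<epsilon>)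
       else smoothstep' ((s - t) / \<epsilon>) / \<epsilon>)) (at s)"
      using True by (simp add: mult.commute)
  qed (use 1 in simp)
qed

lemma cutoff_bounds: "0 \<le> cutoff k t \<epsilon> s" "cutoff k t \<epsilon> s \<le> 1"
  using smoothstep_bounds by (auto simp: cutoff_def mult_le_one)

lemma cutoff_continuous: "continuous_on UNIV (cutoff k t \<epsilon>)" "continuous_on UNIV (cutoff' k t \<epsilon>)"
proof -
  show "continuous_on UNIV (cutoff k t \<epsilon>)"
    using cutoff_deriv by (meson DERIV_isCont continuous_at_imp_continuous_on)
  have 1: "continuous_on UNIV smoothstep" "continuous_on UNIV smoothstep'"
    unfolding smoothstep_def smoothstep'_def by (intro continuous_intros)+
  have 2: "continuous_on UNIV (\<lambda>s. (s - t) / \<epsilon>)" "continuous_on UNIV (\<lambda>s. (- s - t) / \<epsilon>)"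
    unfolding divide_inverse by (intro continuous_intros)+
  note 3 = continuous_on_compose2[OF 1(1) 2(1)] continuous_on_compose2[OF 1(1) 2(2)]
    continuous_on_compose2[OF 1(2) 2(1)] continuous_on_compose2[OF 1(2) 2(2)]
  show "continuous_on UNIV (cutoff' k t \<epsilon>)"
    unfolding cutoff'_def divide_inverse[of "smoothstep' _"] by (cases k) (simp_all, (intro continuous_intros 3 subset_UNIV)+)
qed

lemma cutoff'_bound:
  assumes "\<epsilon> > 0" "t \<ge> 0"
  shows "\<bar>cutoff' k t \<epsilon> s\<bar> \<le> 4 / \<epsilon> * indicator {s. t < \<bar>s\<bar> \<and> \<bar>s\<bar> \<le> t + \<epsilon>} s"
proof (cases "t < \<bar>s\<bar> \<and> \<bar>s\<bar> \<le> t + \<epsilon>")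
  case True
  have d: "\<bar>smoothstep' r / \<epsilon>\<bar> \<le> 2 / \<epsilon>" for r
    using smoothstep'_bound[of r] assms by (simp add: divide_right_mono)
  have p: "\<bar>smoothstep' r / \<epsilon> * (1 - smoothstep q)\<bar> \<le> 2 / \<epsilon> * 1" for r q
    unfolding abs_mult using d[of r] smoothstep_bounds[of q] assms by (intro mult_mono) auto
  have "\<bar>cutoff' k t \<epsilon> s\<bar> \<le> 2 / \<epsilon> + 2 / \<epsilon>"
  proof (cases k)
    case True
    have "cutoff' k t \<epsilon> s = smoothstep' ((- s - t) / \<epsilon>) / \<epsilon> * (1 - smoothstep ((s - t) / \<epsilon>))
       - smoothstep' ((s - t) / \<epsilon>) / \<epsilon> * (1 - smoothstep ((- s - t) / \<epsilon>))"
      using True by (simp add: cutoff'_def)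
    then show ?thesis using p[of "(- s - t) / \<epsilon>" "(s - t) / \<epsilon>"] p[of "(s - t) / \<epsilon>" "(- s - t) / \<epsilon>"] by linarith
  next
    case False
    have "2 / \<epsilon> \<ge> 0" using assms by simp
    moreover have "cutoff' k t \<epsilon> s = smoothstep' ((s - t) / \<epsilon>) / \<epsilon>" using False by (simp add: cutoff'_def)
    ultimately show ?thesis using d[of "(s - t) / \<epsilon>"] by linarith
  qed
  then show ?thesis using True by simp
next
  case False
  then have "\<bar>s\<bar> \<le> t \<or> \<bar>s\<bar> > t + \<epsilon>" by auto
  then have "(s - t) / \<epsilon> \<le> 0 \<or> (s - t) / \<epsilon> \<ge> 1" "(- s - t) / \<epsilon> \<le> 0 \<or> (- s - t) / \<epsilon> \<ge> 1"
    using assms by (auto simp: field_simps abs_if split: if_splits)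
  then have "cutoff' k t \<epsilon> s = 0" using smoothstep'_0 by (simp add: cutoff'_def)
  then show ?thesis using False by simp
qed

lemma cutoff_nonzero:
  assumes "\<epsilon> > 0" "t \<ge> 0" "cutoff k t \<epsilon> s \<noteq> 0"
  shows "s \<ge> - (t + \<epsilon>)"
proof (rule ccontr)
  assume "\<not> s \<ge> - (t + \<epsilon>)"
  then have "(- s - t) / \<epsilon> \<ge> 1" "(s - t) / \<epsilon> \<le> 0" using assms by (auto simp: field_simps)
  then have "cutoff k t \<epsilon> s = 0" by (simp add: cutoff_def smoothstep_1 smoothstep_0)
  with assms show False by simp
qed

lemma cutoff_tendsto:
  assumes t: "t \<ge> 0" and \<epsilon>: "\<And>n. \<epsilon> n > 0" "\<epsilon> \<longlonglongrightarrow> 0"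
  shows "(\<lambda>n. cutoff k t (\<epsilon> n) s) \<longlonglongrightarrow> (if (if k then \<bar>s\<bar> \<le> t else s > t) then 1 else 0)"
proof -
  have big: "eventually (\<lambda>n. smoothstep (r / \<epsilon> n) = 1) sequentially" if "r > 0" for r
  proof -
    have "eventually (\<lambda>n. \<epsilon> n < r) sequentially" by (rule order_tendstoD(2)[OF \<epsilon>(2) that])
    then show ?thesis
    proof eventually_elim
      case (elim n)
      then have "r / \<epsilon> n \<ge> 1" using \<epsilon>(1)[of n] by simp
      then show ?case by (rule smoothstep_1)
    qed
  qed
  have small: "smoothstep (r / \<epsilon> n) = 0" if "r \<le> 0" for r n
    using that \<epsilon>(1)[of n] by (intro smoothstep_0) (simp add: divide_nonpos_pos)
  show ?thesis
  proof (cases "s > t")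
    case True
    then have "eventually (\<lambda>n. smoothstep ((s - t) / \<epsilon> n) = 1) sequentially" by (intro big) simp
    then have "eventually (\<lambda>n. cutoff k t (\<epsilon> n) s = (if (if k then \<bar>s\<bar> \<le> t else s > t) then 1 else 0)) sequentially"
      by eventually_elim (use True t in \<open>auto simp: cutoff_def\<close>)
    then show ?thesis by (rule tendsto_eventually)
  next
    case F1: False
    show ?thesis
    proof (cases "- s > t")
      case True
      then have "eventually (\<lambda>n. smoothstep ((- s - t) / \<epsilon> n) = 1) sequentially" by (intro big) simp
      then have "eventually (\<lambda>n. cutoff k t (\<epsilon> n) s = (if (if k then \<bar>s\<bar> \<le> t else s > t) then 1 else 0)) sequentially"
        by eventually_elim (use True t F1 small[of "s - t"] in \<open>auto simp: cutoff_def\<close>)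
      then show ?thesis by (rule tendsto_eventually)
    next
      case False
      then show ?thesis using F1 small[of "s - t"] small[of "- s - t"] by (auto simp: cutoff_def)
    qed
  qed
qed

section \<open>Choosing a level\<close>

text \<open>
  If every point had a right neighbourhood in which the difference quotients exceed the average slope
  \<open>M\<close>, then the growth of \<open>V\<close> would exceed \<open>M (s - a)\<close> for small \<open>s - a\<close>, hence up to \<open>b\<close>: the supremum of the
  points up to which it does so satisfies the inequality by monotonicity, and can be increased if it
  is less than \<open>b\<close>.
\<close>

lemma exists_slope_le_average:
  fixes V :: "real \<Rightarrow> real"
  assumes ab: "a < b" and V: "mono_on {a..b} V"
  shows "\<exists>t. a \<le> t \<and> t < b \<and>
    (\<forall>\<delta>>0. \<exists>\<epsilon>. 0 < \<epsilon> \<and> \<epsilon> < \<delta> \<and> V (t + \<epsilon>) - V t \<le> (V b - V a) / (b - a) * \<epsilon>)"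
proof (rule ccontr)
  define M where "M = (V b - V a) / (b - a)"
  assume "\<not> ?thesis"
  then have ex: "\<exists>\<delta>>0. \<forall>\<epsilon>. 0 < \<epsilon> \<and> \<epsilon> < \<delta> \<longrightarrow> V (t + \<epsilon>) - V t > M * \<epsilon>" if "a \<le> t" "t < b" for t
    using that unfolding M_def[symmetric] by (meson not_le)
  obtain \<delta> where \<delta>: "\<delta> > 0" "\<And>\<epsilon>. 0 < \<epsilon> \<Longrightarrow> \<epsilon> < \<delta> \<Longrightarrow> V (a + \<epsilon>) - V a > M * \<epsilon>" using ex[of a] ab by auto
  define e where "e = min (\<delta> / 2) (b - a)"
  have e: "0 < e" "e < \<delta>" "a + e \<le> b" using \<delta>(1) ab by (auto simp: e_def min_def)
  \<comment> \<open>A first step with strict gain; after it the weak inequality is propagated from \<open>c\<close> to \<open>b\<close>.\<close>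
  define c where "c = a + e"
  have c: "a \<le> c" "c \<le> b" using e by (auto simp: c_def)
  have Vc: "V c - V a > M * (c - a)" using \<delta>(2)[OF e(1,2)] by (simp add: c_def)
  define S where "S = {s \<in> {c..b}. V s - V c \<ge> M * (s - c)}"
  have cS: "c \<in> S" using c by (simp add: S_def)
  have bdd: "bdd_above S" by (auto simp: S_def intro!: bdd_aboveI[of _ b])
  define s where "s = Sup S"
  have sle: "x \<le> s" if "x \<in> S" for x unfolding s_def using that bdd by (rule cSup_upper)
  have sb: "s \<le> b" unfolding s_def by (rule cSup_least) (use cS in \<open>auto simp: S_def\<close>)
  have cs: "c \<le> s" by (rule sle[OF cS])
  have "V s - V c \<ge> M * (s - c)"
  proof (rule field_le_epsilon)
    fix \<eta> :: real assume \<eta>: "\<eta> > 0"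
    define r where "r = \<eta> / (\<bar>M\<bar> + 1)"
    have r: "r > 0" using \<eta> by (simp add: r_def add_nonneg_pos)
    have "s - r < Sup S" using r by (simp add: s_def)
    then obtain x where x: "x \<in> S" "s - r < x" using less_cSup_iff[OF _ bdd] cS by blast
    have "V x \<le> V s" using V x(1) sle[OF x(1)] sb c by (auto simp: mono_on_def S_def)
    moreover have "V x - V c \<ge> M * (x - c)" using x(1) by (simp add: S_def)
    moreover have "M * (s - x) \<le> \<eta>"
    proof -
      have "M * (s - x) \<le> \<bar>M\<bar> * r" using sle[OF x(1)] x(2) by (intro mult_mono) auto
      also have "\<dots> \<le> \<eta>" using \<eta> by (simp add: r_def field_simps)
      finally show ?thesis .
    qed
    ultimately show "M * (s - c) \<le> V s - V c + \<eta>" by (simp add: algebra_simps)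
  qed
  then have Vs: "V s - V c \<ge> M * (s - c)" .
  have "s = b"
  proof (rule ccontr)
    assume "s \<noteq> b"
    then have "s < b" using sb by simp
    obtain \<delta>' where \<delta>': "\<delta>' > 0" "\<And>\<epsilon>. 0 < \<epsilon> \<Longrightarrow> \<epsilon> < \<delta>' \<Longrightarrow> V (s + \<epsilon>) - V s > M * \<epsilon>"
      using ex[of s] c cs \<open>s < b\<close> by auto
    define \<epsilon> where "\<epsilon> = min (\<delta>' / 2) (b - s)"
    have \<epsilon>: "0 < \<epsilon>" "\<epsilon> < \<delta>'" "s + \<epsilon> \<le> b" using \<delta>'(1) \<open>s < b\<close> by (auto simp: \<epsilon>_def min_def)
    have "s + \<epsilon> \<in> S" using \<delta>'(2)[OF \<epsilon>(1,2)] Vs \<epsilon> cs by (auto simp: S_def algebra_simps)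
    then show False using sle \<epsilon>(1) by fastforce
  qed
  then have "V b - V c \<ge> M * (b - c)" using Vs by simp
  with Vc have "V b - V a > M * (b - a)" by (simp add: algebra_simps)
  moreover have "M * (b - a) = V b - V a" using ab by (simp add: M_def)
  ultimately show False by simp
qed

section \<open>Perimeter of the regions around the steady states\<close>

definition cutoff_prod :: "'n set \<Rightarrow> real \<Rightarrow> real \<Rightarrow> real ^ 'n \<Rightarrow> real" where
  "cutoff_prod K t \<epsilon> y = (\<Prod>i\<in>UNIV. cutoff (i \<in> K) t \<epsilon> (y $ i))"

definition cutoff_prod' :: "'n set \<Rightarrow> real \<Rightarrow> real \<Rightarrow> real ^ 'n \<Rightarrow> real ^ 'n" where
  "cutoff_prod' K t \<epsilon> y = (\<chi> i. cutoff' (i \<in> K) t \<epsilon> (y $ i) * (\<Prod>j\<in>UNIV - {i}. cutoff (j \<in> K) t \<epsilon> (y $ j)))"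

lemma cutoff_prod_deriv: "(cutoff_prod K t \<epsilon> has_derivative (\<lambda>h. cutoff_prod' K t \<epsilon> y \<bullet> h)) (at y)"
proof -
  have "((\<lambda>y. cutoff (i \<in> K) t \<epsilon> (y $ i)) has_derivative (\<lambda>h. cutoff' (i \<in> K) t \<epsilon> (y $ i) * (h $ i))) (at y)" for i
    by (rule has_derivative_compose[OF bounded_linear.has_derivative[OF bounded_linear_vec_nth has_derivative_ident] cutoff_deriv[unfolded has_field_derivative_def]])
  then have "((\<lambda>y. \<Prod>i\<in>UNIV. cutoff (i \<in> K) t \<epsilon> (y $ i)) has_derivative
     (\<lambda>h. \<Sum>i\<in>UNIV. cutoff' (i \<in> K) t \<epsilon> (y $ i) * (h $ i) * (\<Prod>j\<in>UNIV - {i}. cutoff (j \<in> K) t \<epsilon> (y $ j)))) (at y)"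
    by (rule has_derivative_prod)
  then show ?thesis unfolding cutoff_prod_def[abs_def]
    by (rule has_derivative_eq_rhs) (simp add: cutoff_prod'_def inner_vec_def mult_ac)
qed

lemma cutoff_prod_continuous: "continuous_on UNIV (cutoff_prod K t \<epsilon>)"
  by (rule has_derivative_continuous_on) (rule has_derivative_at_withinI[OF cutoff_prod_deriv])

lemma cutoff_prod'_continuous: "continuous_on UNIV (cutoff_prod' K t \<epsilon> :: real ^ 'n::finite \<Rightarrow> _)"
proof -
  have "continuous_on UNIV (\<lambda>y :: real ^ 'n. cutoff k t \<epsilon> (y $ i))" "continuous_on UNIV (\<lambda>y :: real ^ 'n. cutoff' k t \<epsilon> (y $ i))" for k and i :: 'n
    by (intro continuous_on_compose2[OF cutoff_continuous(1)] continuous_on_compose2[OF cutoff_continuous(2)] continuous_intros; simp)+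
  then show ?thesis unfolding cutoff_prod'_def by (intro continuous_intros)
qed

lemma cutoff_prod_bounds: "0 \<le> cutoff_prod K t \<epsilon> y" "cutoff_prod K t \<epsilon> y \<le> 1"
  unfolding cutoff_prod_def using cutoff_bounds by (auto intro!: prod_nonneg prod_le_1)

lemma cutoff_prod'_bound:
  assumes "\<epsilon> > 0" "t \<ge> 0"
  shows "\<bar>cutoff_prod' K t \<epsilon> y $ i\<bar> \<le> 4 / \<epsilon> * indicator {y. t < \<bar>y $ i\<bar> \<and> \<bar>y $ i\<bar> \<le> t + \<epsilon> \<and> (\<forall>j. y $ j \<ge> - (t + \<epsilon>))} y"
proof (cases "\<forall>j. y $ j \<ge> - (t + \<epsilon>)")
  case True
  have p: "0 \<le> (\<Prod>j\<in>UNIV - {i}. cutoff (j \<in> K) t \<epsilon> (y $ j))" "(\<Prod>j\<in>UNIV - {i}. cutoff (j \<in> K) t \<epsilon> (y $ j)) \<le> 1"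
    using cutoff_bounds by (auto intro!: prod_nonneg prod_le_1)
  have "\<bar>cutoff_prod' K t \<epsilon> y $ i\<bar> \<le> \<bar>cutoff' (i \<in> K) t \<epsilon> (y $ i)\<bar> * 1"
    unfolding cutoff_prod'_def using p by (simp add: abs_mult mult_left_le)
  also have "\<dots> \<le> 4 / \<epsilon> * indicator {s. t < \<bar>s\<bar> \<and> \<bar>s\<bar> \<le> t + \<epsilon>} (y $ i)"
    using cutoff'_bound[OF assms] by simp
  finally show ?thesis using True by (simp add: indicator_def)
next
  case False
  then obtain j where j: "\<not> y $ j \<ge> - (t + \<epsilon>)" by blast
  have "cutoff_prod' K t \<epsilon> y $ i = 0"
  proof (cases "j = i")
    case True
    then have "\<not> \<bar>y $ i\<bar> \<le> t + \<epsilon>" using j by auto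
    then have "\<bar>cutoff' (i \<in> K) t \<epsilon> (y $ i)\<bar> \<le> 0" using cutoff'_bound[OF assms, of "i \<in> K" "y $ i"] by simp
    then show ?thesis by (simp add: cutoff_prod'_def)
  next
    case False
    then have "(\<Prod>j\<in>UNIV - {i}. cutoff (j \<in> K) t \<epsilon> (y $ j)) = 0"
      using cutoff_nonzero[OF assms] j by (intro prod_zero) auto
    then show ?thesis by (simp add: cutoff_prod'_def)
  qed
  then show ?thesis using assms by (simp add: indicator_def)
qed

text \<open>
  A point of \<open>\<Omega>\<close> with all \<open>f\<^sub>i \<ge> - t\<close> lies in exactly one of these regions, that of
  \<open>K = {i. f\<^sub>i \<le> t}\<close>.
\<close>

definition level_region :: "('a \<Rightarrow> real ^ 'n) \<Rightarrow> 'n set \<Rightarrow> real \<Rightarrow> 'a set \<Rightarrow> 'a set" where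
  "level_region f K t \<Omega> = {x \<in> \<Omega>. \<forall>i. if i \<in> K then \<bar>f x $ i\<bar> \<le> t else f x $ i > t}"

lemma cutoff_prod_tendsto:
  assumes "t \<ge> 0" "\<And>n. \<epsilon> n > 0" "\<epsilon> \<longlonglongrightarrow> 0" "x \<in> \<Omega>"
  shows "(\<lambda>n. cutoff_prod K t (\<epsilon> n) (f x)) \<longlonglongrightarrow> indicator (level_region f K t \<Omega>) x"
proof -
  let ?P = "\<lambda>i. if i \<in> K then \<bar>f x $ i\<bar> \<le> t else f x $ i > t"
  have "(\<lambda>n. cutoff_prod K t (\<epsilon> n) (f x)) \<longlonglongrightarrow> (\<Prod>i\<in>UNIV. if ?P i then 1 else 0)"
    unfolding cutoff_prod_def by (intro tendsto_prod cutoff_tendsto assms)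
  moreover have "(\<Prod>i\<in>UNIV. if ?P i then 1 else (0::real)) = indicator (level_region f K t \<Omega>) x"
  proof (cases "\<forall>i. ?P i")
    case True
    then have "x \<in> level_region f K t \<Omega>" using assms(4) by (simp add: level_region_def)
    moreover have "(\<Prod>i\<in>UNIV. if ?P i then 1 else (0::real)) = 1" using True by (intro prod.neutral) simp
    ultimately show ?thesis by simp
  next
    case False
    then have "x \<notin> level_region f K t \<Omega>" by (auto simp: level_region_def)
    moreover obtain i where "\<not> ?P i" using False by blast
    then have "\<exists>i\<in>UNIV. (if ?P i then 1 else (0::real)) = 0" by (intro bexI[of _ i]) simp_all
    then have "(\<Prod>i\<in>UNIV. if ?P i then 1 else (0::real)) = 0" by (intro prod_zero) auto
    ultimately show ?thesis by simp
  qed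
  ultimately show ?thesis by simp
qed

lemma level_region_measurable:
  fixes f :: "'a::euclidean_space \<Rightarrow> real ^ 'n"
  assumes \<Omega>: "open \<Omega>" and f: "\<And>i. (\<lambda>x. f x $ i) \<in> borel_measurable (lebesgue_on \<Omega>)"
  shows "level_region f K t \<Omega> \<in> sets lebesgue"
proof -
  have [measurable]: "\<And>i. (\<lambda>x. f x $ i) \<in> borel_measurable (lebesgue_on \<Omega>)" by (rule f)
  have 1: "{x \<in> space (lebesgue_on \<Omega>). if i \<in> K then \<bar>f x $ i\<bar> \<le> t else f x $ i > t} \<in> sets (lebesgue_on \<Omega>)" for i
  proof -
    have "{x \<in> space (lebesgue_on \<Omega>). \<bar>f x $ i\<bar> \<le> t} \<in> sets (lebesgue_on \<Omega>)"
      "{x \<in> space (lebesgue_on \<Omega>). f x $ i > t} \<in> sets (lebesgue_on \<Omega>)" by measurable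
    then show ?thesis by (cases "i \<in> K") simp_all
  qed
  have "level_region f K t \<Omega> = (\<Inter>i\<in>UNIV. {x \<in> space (lebesgue_on \<Omega>). if i \<in> K then \<bar>f x $ i\<bar> \<le> t else f x $ i > t})"
    by (auto simp: level_region_def)
  also have "\<dots> \<in> sets (lebesgue_on \<Omega>)" by (intro sets.finite_INT 1) auto
  finally show ?thesis using \<Omega> by (subst (asm) sets_restrict_space_iff) auto
qed

text \<open>
  Integrate \<open>div T\<close> against the smoothed indicator of the region. By the chain rule this is an
  integral over the layers \<open>t < \<bar>f\<^sub>i\<bar> \<le> t + \<epsilon>\<close>, within the set where all \<open>f\<^sub>j \<ge> - s\<close>, of gradients \<open>g i\<close>
  times a slope of order \<open>1 / \<epsilon>\<close>. There \<open>W\<close> dominates the gradients, and \<open>\<epsilon>\<close> can be chosen arbitrarily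
  small such that the layers carry at most \<open>M \<epsilon>\<close> of \<open>W\<close>.
\<close>

lemma gauss_green_level_region_le:
  fixes f :: "'a::euclidean_space \<Rightarrow> real ^ 'n"
  assumes \<Omega>: "open \<Omega>" and w: "\<And>i. has_weak_gradient \<Omega> (\<lambda>x. f x $ i) (g i)"
    and t: "t \<ge> 0" "t < s"
    and W: "integrable (lebesgue_on \<Omega>) W" "AE x in lebesgue_on \<Omega>. W x \<ge> 0"
    and bnd: "AE x in lebesgue_on \<Omega>. \<forall>i. t < \<bar>f x $ i\<bar> \<and> \<bar>f x $ i\<bar> \<le> s \<and> (\<forall>j. f x $ j \<ge> - s) \<longrightarrow> norm (g i x) \<le> W x"
    and inc: "\<And>\<delta>. \<delta> > 0 \<Longrightarrow> \<exists>\<epsilon>. 0 < \<epsilon> \<and> \<epsilon> < \<delta> \<and>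
       (\<Sum>i\<in>UNIV. (LINT x|lebesgue_on \<Omega>. indicator {x. t < \<bar>f x $ i\<bar> \<and> \<bar>f x $ i\<bar> \<le> t + \<epsilon>} x * W x)) \<le> M * \<epsilon>"
    and T: "T \<in> C1c \<Omega>" "\<And>x. norm (T x) \<le> 1"
  shows "\<bar>gauss_green (level_region f K t \<Omega>) T\<bar> \<le> 4 * M"
proof -
  let ?L = "lebesgue_on \<Omega>"
  note wm = has_weak_gradient_measurable[OF \<Omega> w]
  have [measurable]: "f \<in> borel_measurable ?L" by (intro borel_measurable_vecI wm)
  have [measurable]: "g i \<in> borel_measurable ?L" "(\<lambda>x. f x $ i) \<in> borel_measurable ?L" for i by (rule wm)+
  have [measurable]: "W \<in> borel_measurable ?L" using W(1) by auto
  note Tb = C1c_component(1)[OF T(1)]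
  have bm: "k \<in> borel_measurable ?L" if "k \<in> borel_measurable borel" for k :: "'a \<Rightarrow> 'c::euclidean_space"
    using that by (intro measurable_restrict_space1 measurable_completion) simp
  have [measurable]: "(\<lambda>x. T x \<bullet> b) \<in> borel_measurable ?L" "gradient (\<lambda>x. T x \<bullet> b) \<in> borel_measurable ?L" for b
    using C1cD(2,3)[OF Tb] by (intro bm borel_measurable_continuous_onI; simp)+
  have dm[measurable]: "divergence T \<in> borel_measurable ?L"
    using divergence_props(4)[OF T(1)] by (intro bm) auto
  have ex: "\<forall>n. \<exists>\<epsilon>. 0 < \<epsilon> \<and> \<epsilon> < min (s - t) (inverse (real (Suc n))) \<and>
     (\<Sum>i\<in>UNIV. (LINT x|?L. indicator {x. t < \<bar>f x $ i\<bar> \<and> \<bar>f x $ i\<bar> \<le> t + \<epsilon>} x * W x)) \<le> M * \<epsilon>"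
    using t(2) by (intro allI inc) simp
  from choice[OF ex] obtain \<epsilon> where \<epsilon>: "\<And>n. 0 < \<epsilon> n" "\<And>n. \<epsilon> n < min (s - t) (inverse (real (Suc n)))"
     "\<And>n. (\<Sum>i\<in>UNIV. (LINT x|?L. indicator {x. t < \<bar>f x $ i\<bar> \<and> \<bar>f x $ i\<bar> \<le> t + \<epsilon> n} x * W x)) \<le> M * \<epsilon> n" by blast
  have \<epsilon>0: "\<epsilon> \<longlonglongrightarrow> 0"
  proof (rule Lim_null_comparison[OF _ LIMSEQ_inverse_real_of_nat])
    show "\<forall>\<^sub>F n in sequentially. norm (\<epsilon> n) \<le> inverse (real (Suc n))"
      using \<epsilon>(1,2) by (intro always_eventually allI) (metis abs_of_pos less_imp_le min_less_iff_conj real_norm_def)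
  qed
  have est: "\<bar>LINT x|?L. cutoff_prod K t (\<epsilon> n) (f x) * divergence T x\<bar> \<le> 4 * M" for n
  proof -
    let ?e = "\<epsilon> n"
    let ?H = "cutoff_prod K t ?e" and ?H' = "cutoff_prod' K t ?e"
    define G where "G x = (\<Sum>i\<in>UNIV. ?H' (f x) $ i *\<^sub>R g i x)" for x
    define B where "B = max 1 (\<Sum>i\<in>(UNIV::'n set). 4 / ?e)"
    have H'B: "norm (?H' y) \<le> B" for y
    proof -
      have "norm (?H' y) \<le> (\<Sum>i\<in>UNIV. \<bar>?H' y $ i\<bar>)" by (rule norm_le_l1_cart)
      also have "\<dots> \<le> (\<Sum>i\<in>(UNIV::'n set). 4 / ?e)"
      proof (rule sum_mono)
        fix i
        have "\<bar>?H' y $ i\<bar> \<le> 4 / ?e * indicator {y. t < \<bar>y $ i\<bar> \<and> \<bar>y $ i\<bar> \<le> t + ?e \<and> (\<forall>j. y $ j \<ge> - (t + ?e))} y"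
          by (rule cutoff_prod'_bound[OF \<epsilon>(1) t(1)])
        also have "\<dots> \<le> 4 / ?e" using \<epsilon>(1)[of n] by (auto simp: indicator_def)
        finally show "\<bar>?H' y $ i\<bar> \<le> 4 / ?e" .
      qed
      finally show ?thesis by (simp add: B_def)
    qed
    have HB: "\<bar>?H y\<bar> \<le> B" for y using cutoff_prod_bounds[of K t ?e y] by (simp add: B_def)
    have chain: "(LINT x|?L. ?H (f x) *\<^sub>R gradient (\<lambda>x. T x \<bullet> b) x) = - (LINT x|?L. (T x \<bullet> b) *\<^sub>R G x)" for b
      unfolding G_def by (rule weak_chain_rule[OF \<Omega> w cutoff_prod_deriv cutoff_prod'_continuous H'B HB Tb])
    have "?H \<in> borel_measurable borel" by (intro borel_measurable_continuous_onI cutoff_prod_continuous)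
    then have Hm[measurable]: "(\<lambda>x. ?H (f x)) \<in> borel_measurable ?L" by measurable
    have [measurable]: "(\<lambda>x. ?H' (f x) $ i) \<in> borel_measurable ?L" for i
    proof -
      have "(\<lambda>y. ?H' y $ i) \<in> borel_measurable borel" by (intro borel_measurable_continuous_onI continuous_intros cutoff_prod'_continuous)
      then show ?thesis by measurable
    qed
    have [measurable]: "G \<in> borel_measurable ?L" unfolding G_def[abs_def] by measurable
    let ?I = "\<lambda>i x. indicator {x. t < \<bar>f x $ i\<bar> \<and> \<bar>f x $ i\<bar> \<le> t + ?e} x * W x"
    have iI: "integrable ?L (?I i)" for i
    proof (rule Bochner_Integration.integrable_bound[OF W(1)])
      have "{x \<in> space ?L. t < \<bar>f x $ i\<bar> \<and> \<bar>f x $ i\<bar> \<le> t + ?e} \<in> sets ?L" by measurable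
      then have "(\<lambda>x. indicator {x \<in> space ?L. t < \<bar>f x $ i\<bar> \<and> \<bar>f x $ i\<bar> \<le> t + ?e} x * W x) \<in> borel_measurable ?L" by measurable
      then show "?I i \<in> borel_measurable ?L" by (rule measurable_cong[THEN iffD1, rotated]) (auto simp: indicator_def)
    qed (auto simp: indicator_def)
    have Gb: "AE x in ?L. norm (G x) \<le> 4 / ?e * (\<Sum>i\<in>UNIV. ?I i x)"
      using W(2) bnd
    proof eventually_elim
      case (elim x)
      have "norm (G x) \<le> (\<Sum>i\<in>UNIV. \<bar>?H' (f x) $ i\<bar> * norm (g i x))"
        unfolding G_def by (rule order_trans[OF norm_sum]) simp
      also have "\<dots> \<le> (\<Sum>i\<in>UNIV. 4 / ?e * ?I i x)"
      proof (rule sum_mono)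
        fix i
        have Hb: "\<bar>?H' (f x) $ i\<bar> \<le> 4 / ?e * indicator {y. t < \<bar>y $ i\<bar> \<and> \<bar>y $ i\<bar> \<le> t + ?e \<and> (\<forall>j. y $ j \<ge> - (t + ?e))} (f x)"
          by (rule cutoff_prod'_bound[OF \<epsilon>(1) t(1)])
        show "\<bar>?H' (f x) $ i\<bar> * norm (g i x) \<le> 4 / ?e * ?I i x"
        proof (cases "t < \<bar>f x $ i\<bar> \<and> \<bar>f x $ i\<bar> \<le> t + ?e \<and> (\<forall>j. f x $ j \<ge> - (t + ?e))")
          case True
          have es: "t + ?e \<le> s" using \<epsilon>(2)[of n] by simp
          have "f x $ j \<ge> - s" for j using True es by (smt (verit))
          then have "norm (g i x) \<le> W x" using elim(2) True es by force
          then have "\<bar>?H' (f x) $ i\<bar> * norm (g i x) \<le> 4 / ?e * W x" using Hb True elim(1) \<epsilon>(1)[of n] by (intro mult_mono) auto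
          then show ?thesis using True by simp
        next
          case False
          then have "indicator {y. t < \<bar>y $ i\<bar> \<and> \<bar>y $ i\<bar> \<le> t + ?e \<and> (\<forall>j. y $ j \<ge> - (t + ?e))} (f x) = (0::real)"
            by (simp add: indicator_def)
          with Hb have "\<bar>?H' (f x) $ i\<bar> = 0" by simp
          then show ?thesis using elim(1) \<epsilon>(1)[of n] by (simp add: indicator_def)
        qed
      qed
      finally show ?case by (simp only: sum_distrib_left)
    qed
    have iS: "integrable ?L (\<lambda>x. 4 / ?e * (\<Sum>i\<in>UNIV. ?I i x))" using iI by (intro integrable_mult_right Bochner_Integration.integrable_sum)
    have TG: "AE x in ?L. norm ((T x \<bullet> b) *\<^sub>R G x) \<le> norm (4 / ?e * (\<Sum>i\<in>UNIV. ?I i x))" if "b \<in> Basis" for b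
      using Gb
    proof eventually_elim
      case (elim x)
      have "\<bar>T x \<bullet> b\<bar> \<le> 1" using Basis_le_norm[OF that, of "T x"] T(2)[of x] by linarith
      then have "\<bar>T x \<bullet> b\<bar> * norm (G x) \<le> 1 * norm (G x)" by (rule mult_right_mono) simp
      then have "norm ((T x \<bullet> b) *\<^sub>R G x) \<le> 4 / ?e * (\<Sum>i\<in>UNIV. ?I i x)"
        unfolding norm_scaleR real_norm_def using elim by linarith
      then show ?case unfolding real_norm_def by (rule order_trans[OF _ abs_ge_self])
    qed
    have iTG: "integrable ?L (\<lambda>x. (T x \<bullet> b) *\<^sub>R G x)" if "b \<in> Basis" for b
      by (rule Bochner_Integration.integrable_bound[OF iS _ TG[OF that]]) measurable
    have iHg: "integrable ?L (\<lambda>x. ?H (f x) *\<^sub>R gradient (\<lambda>x. T x \<bullet> b) x)" for b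
    proof (rule integrable_bounded_scaleR[OF _ Hm HB])
      show "integrable ?L (gradient (\<lambda>x. T x \<bullet> b))"
        using has_weak_gradient_integrable(1)[OF \<Omega> has_weak_gradient_const[OF \<Omega>, of 1] Tb] by simp
    qed
    have eq: "(LINT x|?L. ?H (f x) * divergence T x) = - (LINT x|?L. (\<Sum>b\<in>Basis. (T x \<bullet> b) *\<^sub>R G x \<bullet> b))"
    proof -
      have "(LINT x|?L. ?H (f x) * divergence T x) = (LINT x|?L. (\<Sum>b\<in>Basis. (?H (f x) *\<^sub>R gradient (\<lambda>x. T x \<bullet> b) x) \<bullet> b))"
        by (simp add: C1c_component(2)[OF T(1)] sum_distrib_left)
      also have "\<dots> = (\<Sum>b\<in>Basis. (LINT x|?L. ?H (f x) *\<^sub>R gradient (\<lambda>x. T x \<bullet> b) x) \<bullet> b)"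
        using iHg by (subst Bochner_Integration.integral_sum) (auto simp del: inner_scaleR_left)
      also have "\<dots> = - (\<Sum>b\<in>Basis. (LINT x|?L. (T x \<bullet> b) *\<^sub>R G x) \<bullet> b)"
        by (simp add: chain sum_negf)
      also have "(\<Sum>b\<in>Basis. (LINT x|?L. (T x \<bullet> b) *\<^sub>R G x) \<bullet> b) = (LINT x|?L. (\<Sum>b\<in>Basis. (T x \<bullet> b) *\<^sub>R G x \<bullet> b))"
        using iTG by (subst Bochner_Integration.integral_sum) (auto simp del: inner_scaleR_left)
      finally show ?thesis .
    qed
    have iner: "(\<Sum>b\<in>Basis. (T x \<bullet> b) *\<^sub>R G x \<bullet> b) = T x \<bullet> G x" for x
      by (subst (2) euclidean_inner) simp
    have "integrable ?L (\<lambda>x. (\<Sum>b\<in>Basis. (T x \<bullet> b) *\<^sub>R G x \<bullet> b))"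
      using iTG by (intro Bochner_Integration.integrable_sum integrable_inner_left) auto
    then have iin: "integrable ?L (\<lambda>x. T x \<bullet> G x)" by (simp only: iner)
    have "\<bar>LINT x|?L. ?H (f x) * divergence T x\<bar> = norm (LINT x|?L. T x \<bullet> G x)" unfolding eq iner by simp
    also have "\<dots> \<le> (LINT x|?L. norm (T x \<bullet> G x))" by (rule integral_norm_bound)
    also have "\<dots> \<le> (LINT x|?L. 4 / ?e * (\<Sum>i\<in>UNIV. ?I i x))"
    proof (rule integral_mono_AE)
      show "AE x in ?L. norm (T x \<bullet> G x) \<le> 4 / ?e * (\<Sum>i\<in>UNIV. ?I i x)"
        using Gb
      proof eventually_elim
        case (elim x)
        have "\<bar>T x \<bullet> G x\<bar> \<le> norm (T x) * norm (G x)" by (rule Cauchy_Schwarz_ineq2)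
        also have "\<dots> \<le> 1 * norm (G x)" using T(2) by (intro mult_right_mono) auto
        finally show ?case unfolding real_norm_def using elim by linarith
      qed
    qed (use iin iS in \<open>auto intro!: integrable_norm\<close>)
    also have "\<dots> = 4 / ?e * (\<Sum>i\<in>UNIV. LINT x|?L. ?I i x)"
      by (simp only: integral_mult_right_zero Bochner_Integration.integral_sum[OF iI])
    also have "\<dots> \<le> 4 / ?e * (M * ?e)" using \<epsilon>(1,3)[of n] by (intro mult_left_mono) auto
    also have "\<dots> = 4 * M" using \<epsilon>(1)[of n] by simp
    finally show ?thesis .
  qed
  have idiv: "integrable ?L (divergence T)"
    using integrable_mult_indicator[OF _ divergence_props(1)[OF T(1)], of \<Omega>] \<Omega> by (subst integrable_restrict_space) auto
  have "(\<lambda>n. LINT x|?L. cutoff_prod K t (\<epsilon> n) (f x) * divergence T x) \<longlonglongrightarrow> (LINT x|?L. indicator (level_region f K t \<Omega>) x * divergence T x)"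
  proof (rule integral_dominated_convergence[where w = "\<lambda>x. \<bar>divergence T x\<bar>"])
    show "AE x in ?L. (\<lambda>n. cutoff_prod K t (\<epsilon> n) (f x) * divergence T x) \<longlonglongrightarrow> indicator (level_region f K t \<Omega>) x * divergence T x"
      by (intro AE_I2 tendsto_mult tendsto_const cutoff_prod_tendsto t \<epsilon>(1) \<epsilon>0) simp
    show "AE x in ?L. norm (cutoff_prod K t (\<epsilon> n) (f x) * divergence T x) \<le> \<bar>divergence T x\<bar>" for n
      by (intro AE_I2) (simp add: abs_mult abs_of_nonneg[OF cutoff_prod_bounds(1)] mult_left_le_one_le cutoff_prod_bounds)
    show "(\<lambda>x. cutoff_prod K t (\<epsilon> n) (f x) * divergence T x) \<in> borel_measurable ?L" for n
    proof -
      have "cutoff_prod K t (\<epsilon> n) \<in> borel_measurable borel" by (intro borel_measurable_continuous_onI cutoff_prod_continuous)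
      then show ?thesis by measurable
    qed
    have [measurable]: "level_region f K t \<Omega> \<in> sets lebesgue" by (rule level_region_measurable[OF \<Omega> wm(1)])
    then have "indicator (level_region f K t \<Omega>) \<in> borel_measurable ?L"
      by (intro measurable_restrict_space1) measurable
    then show "(\<lambda>x. indicator (level_region f K t \<Omega>) x * divergence T x) \<in> borel_measurable ?L"
      by measurable
  qed (use idiv in auto)
  moreover have "(LINT x|?L. indicator (level_region f K t \<Omega>) x * divergence T x) = gauss_green (level_region f K t \<Omega>) T"
  proof -
    have "(LINT x|?L. indicator (level_region f K t \<Omega>) x * divergence T x) =
      (LINT x|lebesgue. indicator \<Omega> x *\<^sub>R (indicator (level_region f K t \<Omega>) x * divergence T x))"
      using \<Omega> by (intro integral_restrict_space) auto
    also have "\<dots> = (LINT x|lebesgue. indicator (level_region f K t \<Omega>) x *\<^sub>R divergence T x)"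
      by (intro Bochner_Integration.integral_cong) (auto simp: indicator_def level_region_def)
    finally show ?thesis by (simp add: gauss_green_def set_lebesgue_integral_def)
  qed
  ultimately have "(\<lambda>n. LINT x|?L. cutoff_prod K t (\<epsilon> n) (f x) * divergence T x) \<longlonglongrightarrow> gauss_green (level_region f K t \<Omega>) T" by simp
  then have "(\<lambda>n. \<bar>LINT x|?L. cutoff_prod K t (\<epsilon> n) (f x) * divergence T x\<bar>) \<longlonglongrightarrow> \<bar>gauss_green (level_region f K t \<Omega>) T\<bar>"
    by (rule tendsto_rabs)
  then show ?thesis by (rule LIMSEQ_le_const2) (use est in blast)
qed

section \<open>Small dissipation selects a steady state\<close>

definition dissipation ::
    "'a::euclidean_space set \<Rightarrow> ('a \<Rightarrow> real ^ 'n) \<Rightarrow> ('a \<Rightarrow> real ^ 'n ^ 'n) \<Rightarrow> real \<Rightarrow> ('a \<Rightarrow> real ^ 'n) \<Rightarrow> 'a \<Rightarrow> real" where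
  "dissipation \<Omega> m A p u x = (\<Sum>i\<in>UNIV. u x $ i *
     (\<bar>fitness m A u i x\<bar> powr p + norm (weak_gradient \<Omega> (fitness m A u i) x) powr p))"

text \<open>
  Markov's inequality on \<open>E\<close>, with the complement of \<open>E\<close> estimated by its measure.
\<close>

lemma measure_le_integral_div:
  fixes F :: "'a::euclidean_space \<Rightarrow> real"
  assumes \<Omega>: "\<Omega> \<in> lmeasurable" and S: "S \<in> sets lebesgue" "S \<subseteq> \<Omega>" and E: "E \<in> sets lebesgue"
    and F: "integrable (lebesgue_on \<Omega>) F" "AE x in lebesgue_on \<Omega>. F x \<ge> 0"
    and \<eta>: "\<eta> > 0" "AE x in lebesgue_on \<Omega>. x \<in> S \<and> x \<in> E \<longrightarrow> \<eta> \<le> F x"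
  shows "measure lebesgue S \<le> measure lebesgue (\<Omega> - E) + (LINT x|lebesgue_on \<Omega>. F x) / \<eta>"
proof -
  have \<Omega>s: "\<Omega> \<in> sets lebesgue" using \<Omega> by auto
  have SE: "S \<inter> E \<in> sets (lebesgue_on \<Omega>)" using S E \<Omega>s by (subst sets_restrict_space_iff) auto
  have fin: "emeasure (lebesgue_on \<Omega>) (S \<inter> E) < \<infinity>"
  proof -
    have "emeasure (lebesgue_on \<Omega>) (S \<inter> E) = emeasure lebesgue (S \<inter> E)"
      using S \<Omega>s by (intro emeasure_restrict_space) auto
    also have "\<dots> \<le> emeasure lebesgue \<Omega>" using S \<Omega>s by (intro emeasure_mono) auto
    also have "\<dots> < \<infinity>" using fmeasurableD2[OF \<Omega>] by (simp add: top.not_eq_extremum)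
    finally show ?thesis .
  qed
  have iI: "integrable (lebesgue_on \<Omega>) (\<lambda>x. indicator (S \<inter> E) x * \<eta>)"
    using SE fin by (intro integrable_mult_left integrable_real_indicator)
  have "measure lebesgue (S \<inter> E) * \<eta> = (LINT x|lebesgue_on \<Omega>. indicator (S \<inter> E) x * \<eta>)"
    using SE S \<Omega>s by (simp add: measure_restrict_space Int_absorb2 le_infI1)
  also have "\<dots> \<le> (LINT x|lebesgue_on \<Omega>. F x)"
  proof (rule integral_mono_AE[OF iI F(1)])
    show "AE x in lebesgue_on \<Omega>. indicator (S \<inter> E) x * \<eta> \<le> F x"
      using F(2) \<eta>(2) by eventually_elim (auto simp: indicator_def)
  qed
  finally have 1: "measure lebesgue (S \<inter> E) \<le> (LINT x|lebesgue_on \<Omega>. F x) / \<eta>" using \<eta>(1) by (simp add: field_simps)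
  have "measure lebesgue S \<le> measure lebesgue ((S \<inter> E) \<union> (\<Omega> - E))"
  proof (rule measure_mono_fmeasurable)
    show "(S \<inter> E) \<union> (\<Omega> - E) \<in> lmeasurable"
      by (rule fmeasurableI2[OF \<Omega>]) (use S E \<Omega>s in auto)
  qed (use S in auto)
  also have "\<dots> \<le> measure lebesgue (S \<inter> E) + measure lebesgue (\<Omega> - E)"
    using S E \<Omega>s by (intro measure_Un_le) auto
  finally show ?thesis using 1 by simp
qed

lemma powr_ge_self: "x \<ge> 0 \<Longrightarrow> p \<ge> 1 \<Longrightarrow> x \<le> 1 + x powr p" for x p :: real
proof (cases "x \<le> 1")
  case False
  assume "p \<ge> 1"
  then have "x powr 1 \<le> x powr p" using False by (intro powr_mono) auto
  then show ?thesis using False by simp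
qed (simp add: add_increasing2)

locale competition =
  fixes \<Omega> :: "(real ^ 'd) set" and m :: "real ^ 'd \<Rightarrow> real ^ 'n" and A :: "real ^ 'd \<Rightarrow> real ^ 'n ^ 'n" and \<kappa> p :: real
  assumes bdd: "bounded \<Omega>" and op: "open \<Omega>"
    and C1m: "C1_closure \<Omega> m" and C1A: "C1_closure \<Omega> A"
    and kap: "\<kappa> > 0" and struct: "\<And>x. x \<in> closure \<Omega> \<Longrightarrow> structural \<kappa> (A x) (m x)" and p1: "p \<ge> 1"
begin

abbreviation "L \<equiv> lebesgue_on \<Omega>"

lemma \<Omega>_lm: "\<Omega> \<in> lmeasurable" using bdd op by (simp add: lmeasurable_open)

lemma \<Omega>_sets: "\<Omega> \<in> sets lebesgue" using \<Omega>_lm by auto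

lemma struct': "x \<in> \<Omega> \<Longrightarrow> structural \<kappa> (A x) (m x)" using struct closure_subset by blast

lemma AE_L: "AE x in L. x \<in> \<Omega>" by (rule AE_I2) simp

lemma sobolev_facts:
  assumes u: "u \<in> sobolev_W1 \<Omega> p"
  shows "u \<in> borel_measurable L" "(\<lambda>x. u x $ i) \<in> borel_measurable L" "integrable L (\<lambda>x. norm (u x) powr p)"
    "has_weak_gradient \<Omega> (fitness m A u i) (weak_gradient \<Omega> (fitness m A u i))"
    "fitness m A u i \<in> borel_measurable L" "weak_gradient \<Omega> (fitness m A u i) \<in> borel_measurable L"
    "dissipation \<Omega> m A p u \<in> borel_measurable L"
proof -
  show um: "u \<in> borel_measurable L" "integrable L (\<lambda>x. norm (u x) powr p)"
    using u by (auto simp: sobolev_W1_def Lp_def)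
  show ui: "(\<lambda>x. u x $ i) \<in> borel_measurable L" for i
    by (rule measurable_compose[OF um(1)]) (intro borel_measurable_continuous_onI continuous_intros)
  show w: "has_weak_gradient \<Omega> (fitness m A u i) (weak_gradient \<Omega> (fitness m A u i))" for i
    by (rule fitness_has_weak_gradient[OF op C1m C1A]) (use u in \<open>auto simp: sobolev_W1_def\<close>)
  show wm: "fitness m A u i \<in> borel_measurable L" "weak_gradient \<Omega> (fitness m A u i) \<in> borel_measurable L" for i
    by (rule has_weak_gradient_measurable[OF op w])+
  note [measurable] = ui wm
  show "dissipation \<Omega> m A p u \<in> borel_measurable L"
    unfolding dissipation_def[abs_def] by measurable
qed

lemma dissipation_ge:
  assumes "\<And>i. u x $ i \<ge> 0"
  shows "u x $ i * \<bar>fitness m A u i x\<bar> powr p \<le> dissipation \<Omega> m A p u x"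
    "u x $ i * (\<bar>fitness m A u i x\<bar> powr p + norm (weak_gradient \<Omega> (fitness m A u i) x) powr p) \<le> dissipation \<Omega> m A p u x"
    "(\<Sum>i\<in>UNIV. u x $ i * \<bar>fitness m A u i x\<bar> powr p) \<le> dissipation \<Omega> m A p u x"
    "dissipation \<Omega> m A p u x \<ge> 0"
proof -
  show 2: "u x $ i * (\<bar>fitness m A u i x\<bar> powr p + norm (weak_gradient \<Omega> (fitness m A u i) x) powr p) \<le> dissipation \<Omega> m A p u x"
    unfolding dissipation_def using assms by (intro member_le_sum) auto
  show "u x $ i * \<bar>fitness m A u i x\<bar> powr p \<le> dissipation \<Omega> m A p u x"
    by (rule order_trans[OF _ 2]) (use assms in \<open>auto intro!: mult_left_mono\<close>)
  show "(\<Sum>i\<in>UNIV. u x $ i * \<bar>fitness m A u i x\<bar> powr p) \<le> dissipation \<Omega> m A p u x"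
    unfolding dissipation_def using assms by (intro sum_mono mult_left_mono) auto
  show "dissipation \<Omega> m A p u x \<ge> 0"
    unfolding dissipation_def using assms by (intro sum_nonneg) auto
qed

text \<open>
  By \<open>component_lower_bound\<close> the function \<open>W = q * dissipation\<close> dominates the gradients wherever
  \<open>s / 2 \<le> \<bar>f\<^sub>i\<bar> \<le> s\<close> and all \<open>f\<^sub>j \<ge> - s\<close>. A level \<open>t\<close> between \<open>s / 2\<close> and \<open>s\<close> is chosen at which the
  integral of \<open>W\<close> over the sets \<open>\<bar>f\<^sub>i\<bar> \<le> t\<close>, summed over \<open>i\<close>, grows at most at its average rate. The
  level does not depend on \<open>K\<close>, so all regions have perimeter at most a multiple of \<open>D\<close>. If none of
  them had a complement of measure at most \<open>C1 * D\<close>, then all of them and also the set \<open>B\<close> that they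
  leave uncovered would have measure at most a multiple of \<open>D\<close>; so would \<open>\<Omega>\<close>, and the
  claim holds for any \<open>K\<close>.
\<close>

proposition state_selection:
  assumes iso: "relative_isoperimetric \<Omega>"
  shows "\<exists>C s c. C > 0 \<and> s > 0 \<and> c > 0 \<and> (\<forall>u. u \<in> sobolev_W1 \<Omega> p \<longrightarrow> (AE x in L. \<forall>i. u x $ i \<ge> 0) \<longrightarrow>
     integrable L (dissipation \<Omega> m A p u) \<longrightarrow>
     (\<exists>K E. E \<in> sets lebesgue \<and> measure lebesgue (\<Omega> - E) \<le> C * (LINT x|L. dissipation \<Omega> m A p u x) \<and>
        (AE x in L. x \<in> E \<longrightarrow> (\<forall>i. if i \<in> K then u x $ i \<ge> c else fitness m A u i x \<ge> s))))"
proof -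
  let ?N = "real CARD('n)"
  obtain s c where s: "s > 0" and c: "c > 0" and low: "\<And>a m u. \<And>i::'n. structural \<kappa> a m \<Longrightarrow> (\<And>j. u $ j \<ge> 0) \<Longrightarrow>
      (\<And>j. residual a m u j \<ge> - s) \<Longrightarrow> residual a m u i \<le> s \<Longrightarrow> u $ i \<ge> c"
    using component_lower_bound[OF kap, where ?'n = 'n] by blast
  have s2: "s / 2 > 0" using s by simp
  obtain \<delta> where \<delta>: "\<delta> > 0" and diss: "\<And>a m u. \<And>j::'n. structural \<kappa> a m \<Longrightarrow> (\<And>j. u $ j \<ge> 0) \<Longrightarrow> residual a m u j \<le> - (s / 2) \<Longrightarrow>
      (\<Sum>i\<in>UNIV. u $ i * \<bar>residual a m u i\<bar> powr p) \<ge> \<delta>"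
    using dissipation_lower_bound[OF kap p1 s2, where ?'n = 'n] by blast
  obtain Ci where Ci: "Ci > 0" "\<And>E M. E \<in> sets lebesgue \<Longrightarrow> E \<subseteq> \<Omega> \<Longrightarrow>
     (\<forall>T\<in>C1c \<Omega>. (\<forall>x. norm (T x) \<le> 1) \<longrightarrow> \<bar>gauss_green E T\<bar> \<le> M) \<Longrightarrow>
     measure lebesgue E \<le> Ci * M \<or> measure lebesgue (\<Omega> - E) \<le> Ci * M"
    using isoperimetric_linear[OF op bdd iso] by blast
  \<comment> \<open>\<open>q\<close> makes \<open>q u\<^sub>i (\<bar>f\<^sub>i\<bar>\<^sup>p + \<bar>\<nabla>f\<^sub>i\<bar>\<^sup>p) \<ge> 1 + \<bar>\<nabla>f\<^sub>i\<bar>\<^sup>p\<close> where \<open>u\<^sub>i \<ge> c\<close> and \<open>\<bar>f\<^sub>i\<bar> \<ge> s / 2\<close>; \<open>C1\<close> collects the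
    isoperimetric constant, the factor 4 of \<open>gauss_green_level_region_le\<close> and the average slope on
    an interval of length \<open>s / 2\<close>; \<open>C2\<close> adds up the \<open>2\<^sup>N\<close> regions and the uncovered set.\<close>
  define q where "q = max 1 ((2 / s) powr p) / c"
  have q: "q > 0" using c by (simp add: q_def)
  define C1 where "C1 = Ci * (4 * (2 / s * (?N * q)))"
  have C1: "C1 > 0" using Ci(1) s q by (simp add: C1_def)
  define C2 where "C2 = (2 ^ CARD('n)) * C1 + 1 / \<delta> + C1"
  have C2: "C2 > 0" using C1 \<delta> by (simp add: C2_def add_pos_pos)
  have main: "\<exists>K E. E \<in> sets lebesgue \<and> measure lebesgue (\<Omega> - E) \<le> C2 * (LINT x|L. dissipation \<Omega> m A p u x) \<and>
        (AE x in L. x \<in> E \<longrightarrow> (\<forall>i. if i \<in> K then u x $ i \<ge> c else fitness m A u i x \<ge> s / 2))"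
    if u: "u \<in> sobolev_W1 \<Omega> p" and pos: "AE x in L. \<forall>i. u x $ i \<ge> 0" and int: "integrable L (dissipation \<Omega> m A p u)" for u
  proof -
    note sf = sobolev_facts[OF u]
    define f where "f x = (\<chi> i. fitness m A u i x)" for x
    define g where "g i = weak_gradient \<Omega> (fitness m A u i)" for i
    define D where "D = (LINT x|L. dissipation \<Omega> m A p u x)"
    define W where "W x = q * dissipation \<Omega> m A p u x" for x
    have f: "f x $ i = fitness m A u i x" for x i by (simp add: f_def)
    have fr: "f x $ i = residual (A x) (m x) (u x) i" for x i by (simp add: f fitness_eq_residual)
    have wf: "has_weak_gradient \<Omega> (\<lambda>x. f x $ i) (g i)" for i using sf(4)[of i] by (simp add: f g_def)
    have fm[measurable]: "(\<lambda>x. f x $ i) \<in> borel_measurable L" for i by (simp add: f sf(5))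
    have Fpos: "AE x in L. dissipation \<Omega> m A p u x \<ge> 0" using pos by eventually_elim (rule dissipation_ge(4), blast)
    have D0: "D \<ge> 0" unfolding D_def by (rule integral_nonneg_AE[OF Fpos])
    have Wpos: "AE x in L. W x \<ge> 0" using Fpos by eventually_elim (use q in \<open>simp add: W_def\<close>)
    have Wint: "integrable L W" unfolding W_def[abs_def] using int by (rule integrable_mult_right)
    have WD: "(LINT x|L. W x) = q * D" by (simp add: W_def D_def)
    have lowAE: "AE x in L. \<forall>i. (\<forall>j. f x $ j \<ge> - s) \<longrightarrow> f x $ i \<le> s \<longrightarrow> u x $ i \<ge> c"
      using AE_L pos
    proof eventually_elim
      case (elim x)
      show ?case using low[OF struct'[OF elim(1)]] elim(2) unfolding fr by blast
    qed
    have bnd: "AE x in L. \<forall>i. s / 2 \<le> \<bar>f x $ i\<bar> \<and> \<bar>f x $ i\<bar> \<le> s \<and> (\<forall>j. f x $ j \<ge> - s) \<longrightarrow> norm (g i x) \<le> W x"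
      using lowAE pos
    proof eventually_elim
      case (elim x)
      show ?case
      proof (intro allI impI)
        fix i assume i: "s / 2 \<le> \<bar>f x $ i\<bar> \<and> \<bar>f x $ i\<bar> \<le> s \<and> (\<forall>j. f x $ j \<ge> - s)"
        have ui: "u x $ i \<ge> c" using elim(1) i by auto
        let ?a = "\<bar>f x $ i\<bar> powr p" and ?b = "norm (g i x) powr p"
        have "(s / 2) powr p \<le> ?a" using i s p1 by (intro powr_mono2) auto
        then have "(2 / s) powr p * (s / 2) powr p \<le> (2 / s) powr p * ?a" by (rule mult_left_mono) simp
        moreover have "(2 / s) powr p * (s / 2) powr p = 1" using s by (simp add: powr_mult[symmetric])
        ultimately have "1 \<le> (2 / s) powr p * ?a" by simp
        then have "norm (g i x) \<le> (2 / s) powr p * ?a + ?b" using powr_ge_self[of "norm (g i x)" p] p1 by simp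
        also have "\<dots> \<le> max 1 ((2 / s) powr p) * ?a + max 1 ((2 / s) powr p) * ?b"
          by (intro add_mono mult_right_mono) (auto simp: mult_le_cancel_right1)
        also have "\<dots> = q * (c * (?a + ?b))" using c by (simp add: q_def algebra_simps)
        also have "\<dots> \<le> q * (u x $ i * (?a + ?b))" using ui q by (intro mult_left_mono mult_right_mono) auto
        also have "\<dots> \<le> W x" unfolding W_def
          using dissipation_ge(2)[of u x i] elim(2) q by (intro mult_left_mono) (auto simp: f g_def)
        finally show "norm (g i x) \<le> W x" .
      qed
    qed
    define I where "I i t x = indicator {x. \<bar>f x $ i\<bar> \<le> t} x * W x" for i t x
    define V where "V t = (\<Sum>i\<in>UNIV. LINT x|L. I i t x)" for t
    have indm: "(\<lambda>x. indicator {x. P x} x * W x) \<in> borel_measurable L" if "{x \<in> space L. P x} \<in> sets L" for P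
    proof -
      have [measurable]: "W \<in> borel_measurable L" using Wint by auto
      have "(\<lambda>x. indicator {x \<in> space L. P x} x * W x) \<in> borel_measurable L" using that by measurable
      then show ?thesis by (rule measurable_cong[THEN iffD1, rotated]) (auto simp: indicator_def)
    qed
    have indi: "integrable L (\<lambda>x. indicator {x. P x} x * W x)" if "{x \<in> space L. P x} \<in> sets L" for P
      by (rule Bochner_Integration.integrable_bound[OF Wint indm[OF that]]) (auto simp: indicator_def)
    have iI: "integrable L (I i t)" for i t unfolding I_def[abs_def] by (rule indi) measurable
    have V_diff: "V t' - V t = (\<Sum>i\<in>UNIV. LINT x|L. indicator {x. t < \<bar>f x $ i\<bar> \<and> \<bar>f x $ i\<bar> \<le> t'} x * W x)" if "t \<le> t'" for t t'
    proof -
      have "(LINT x|L. I i t' x) - (LINT x|L. I i t x) = (LINT x|L. indicator {x. t < \<bar>f x $ i\<bar> \<and> \<bar>f x $ i\<bar> \<le> t'} x * W x)" for i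
      proof -
        have "(LINT x|L. I i t' x) - (LINT x|L. I i t x) = (LINT x|L. I i t' x - I i t x)"
          using iI by simp
        also have "\<dots> = (LINT x|L. indicator {x. t < \<bar>f x $ i\<bar> \<and> \<bar>f x $ i\<bar> \<le> t'} x * W x)"
          using that by (intro Bochner_Integration.integral_cong) (auto simp: I_def indicator_def)
        finally show ?thesis .
      qed
      then show ?thesis by (simp add: V_def sum_subtractf[symmetric])
    qed
    have Vmono: "mono_on {s/2..s} V"
    proof (rule mono_onI)
      fix t t' :: real assume "t \<le> t'"
      have "0 \<le> V t' - V t" unfolding V_diff[OF \<open>t \<le> t'\<close>]
        by (intro sum_nonneg integral_nonneg_AE) (use Wpos in \<open>eventually_elim, simp\<close>)
      then show "V t \<le> V t'" by simp
    qed
    have Vle: "V s - V (s / 2) \<le> ?N * (q * D)"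
    proof -
      have "V s - V (s / 2) \<le> (\<Sum>i\<in>(UNIV::'n set). LINT x|L. W x)"
      proof (subst V_diff)
        show "s / 2 \<le> s" using s by simp
        show "(\<Sum>i\<in>UNIV. LINT x|L. indicator {x. s / 2 < \<bar>f x $ i\<bar> \<and> \<bar>f x $ i\<bar> \<le> s} x * W x) \<le> (\<Sum>i\<in>(UNIV::'n set). LINT x|L. W x)"
        proof (intro sum_mono integral_mono_AE Wint indi)
          show "AE x in L. indicator {x. s / 2 < \<bar>f x $ i\<bar> \<and> \<bar>f x $ i\<bar> \<le> s} x * W x \<le> W x" for i
            using Wpos by eventually_elim (simp add: indicator_def)
        qed measurable
      qed
      then show ?thesis by (simp add: WD)
    qed
    obtain t where t: "s / 2 \<le> t" "t < s" and inc: "\<And>\<delta>. \<delta> > 0 \<Longrightarrow> \<exists>\<epsilon>. 0 < \<epsilon> \<and> \<epsilon> < \<delta> \<and> V (t + \<epsilon>) - V t \<le> (V s - V (s / 2)) / (s - s / 2) * \<epsilon>"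
      using exists_slope_le_average[OF _ Vmono] s by auto
    define M where "M = 2 / s * (?N * (q * D))"
    have slope: "(V s - V (s / 2)) / (s - s / 2) \<le> M"
    proof -
      have "(V s - V (s / 2)) / (s - s / 2) = 2 / s * (V s - V (s / 2))" using s by (simp add: field_simps)
      also have "\<dots> \<le> M" unfolding M_def using Vle s by (intro mult_left_mono) auto
      finally show ?thesis .
    qed
    let ?E = "\<lambda>K. level_region f K t \<Omega>"
    have Es: "?E K \<in> sets lebesgue" "?E K \<subseteq> \<Omega>" for K
      using level_region_measurable[OF op fm] by (auto simp: level_region_def)
    have gg: "\<bar>gauss_green (?E K) T\<bar> \<le> 4 * M" if T: "T \<in> C1c \<Omega>" "\<And>x. norm (T x) \<le> 1" for K T
    proof (rule gauss_green_level_region_le[OF op wf _ t(2) Wint Wpos _ _ T])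
      show "t \<ge> 0" using t s by simp
      show "AE x in L. \<forall>i. t < \<bar>f x $ i\<bar> \<and> \<bar>f x $ i\<bar> \<le> s \<and> (\<forall>j. f x $ j \<ge> - s) \<longrightarrow> norm (g i x) \<le> W x"
        using bnd by eventually_elim (use t(1) in fastforce)
      fix \<delta>' :: real assume "\<delta>' > 0"
      from inc[OF this] obtain \<epsilon> where \<epsilon>: "0 < \<epsilon>" "\<epsilon> < \<delta>'" "V (t + \<epsilon>) - V t \<le> (V s - V (s / 2)) / (s - s / 2) * \<epsilon>" by blast
      have "V (t + \<epsilon>) - V t \<le> M * \<epsilon>" using \<epsilon>(1,3) slope by (meson order_trans mult_right_mono less_imp_le)
      then show "\<exists>\<epsilon>>0. \<epsilon> < \<delta>' \<and> (\<Sum>i\<in>UNIV. LINT x|L. indicator {x. t < \<bar>f x $ i\<bar> \<and> \<bar>f x $ i\<bar> \<le> t + \<epsilon>} x * W x) \<le> M * \<epsilon>"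
        using \<epsilon> by (subst (asm) V_diff) auto
    qed
    have C1D: "Ci * (4 * M) = C1 * D" by (simp add: C1_def M_def)
    have dich: "measure lebesgue (?E K) \<le> C1 * D \<or> measure lebesgue (\<Omega> - ?E K) \<le> C1 * D" for K
      using Ci(2)[OF Es, of K "4 * M"] gg unfolding C1D by blast
    have C12: "C1 * D \<le> C2 * D" using D0 C1 \<delta> by (intro mult_right_mono) (auto simp: C2_def)
    have "\<exists>K. measure lebesgue (\<Omega> - ?E K) \<le> C2 * D"
    proof (cases "\<exists>K. measure lebesgue (\<Omega> - ?E K) \<le> C1 * D")
      case True
      then show ?thesis using C12 order_trans by blast
    next
      case False
      then have small: "measure lebesgue (?E K) \<le> C1 * D" for K using dich by blast
      define B where "B = \<Omega> - (\<Union>K\<in>UNIV. ?E K)"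
      have Us: "(\<Union>K\<in>UNIV. ?E K) \<in> sets lebesgue" using Es by (intro sets.finite_UN) auto
      have Bs: "B \<in> sets lebesgue" unfolding B_def by (rule sets.Diff[OF \<Omega>_sets Us])
      have "measure lebesgue B \<le> measure lebesgue (\<Omega> - \<Omega>) + (LINT x|L. dissipation \<Omega> m A p u x) / \<delta>"
      proof (rule measure_le_integral_div[OF \<Omega>_lm Bs _ \<Omega>_sets int Fpos \<delta>])
        show "B \<subseteq> \<Omega>" by (auto simp: B_def)
        show "AE x in L. x \<in> B \<and> x \<in> \<Omega> \<longrightarrow> \<delta> \<le> dissipation \<Omega> m A p u x"
          using AE_L pos
        proof eventually_elim
          case (elim x)
          show ?case
          proof
            assume x: "x \<in> B \<and> x \<in> \<Omega>"
            have "\<exists>j. f x $ j < - t"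
            proof (rule ccontr)
              assume "\<not> ?thesis"
              then have "x \<in> ?E {k. f x $ k \<le> t}" using x by (auto simp: level_region_def not_less abs_le_iff) (smt (verit))+
              then show False using x by (auto simp: B_def)
            qed
            then obtain j where "f x $ j \<le> - (s / 2)" using t(1) by (meson less_imp_le neg_le_iff_le order_trans)
            then have "(\<Sum>i\<in>UNIV. u x $ i * \<bar>f x $ i\<bar> powr p) \<ge> \<delta>"
              using diss[OF struct'[OF elim(1)]] elim(2) unfolding fr by blast
            then show "\<delta> \<le> dissipation \<Omega> m A p u x" using dissipation_ge(3)[of u x] elim(2) by (simp add: f)
          qed
        qed
      qed
      then have Bm: "measure lebesgue B \<le> D / \<delta>" by (simp add: D_def)
      have "measure lebesgue \<Omega> \<le> measure lebesgue (B \<union> (\<Union>K\<in>UNIV. ?E K))"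
      proof (rule measure_mono_fmeasurable)
        show "B \<union> (\<Union>K\<in>UNIV. ?E K) \<in> lmeasurable"
          using Es(2) by (intro fmeasurableI2[OF \<Omega>_lm _ sets.Un[OF Bs Us]]) (auto simp: B_def)
      qed (use \<Omega>_sets in \<open>auto simp: B_def\<close>)
      also have "\<dots> \<le> measure lebesgue B + measure lebesgue (\<Union>K\<in>UNIV. ?E K)"
        by (rule measure_Un_le[OF Bs Us])
      also have "measure lebesgue (\<Union>K\<in>UNIV. ?E K) \<le> (\<Sum>K\<in>UNIV. measure lebesgue (?E K))"
        using Es by (intro measure_UNION_le) auto
      also have "\<dots> \<le> (\<Sum>K\<in>(UNIV :: 'n set set). C1 * D)" by (intro sum_mono small)
      also have "\<dots> = 2 ^ CARD('n) * (C1 * D)" by (simp add: card_UNIV_set)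
      finally have "measure lebesgue \<Omega> \<le> 2 ^ CARD('n) * (C1 * D) + D / \<delta>" using Bm by simp
      also have "\<dots> \<le> C2 * D" using D0 C1 by (simp add: C2_def algebra_simps)
      finally have "measure lebesgue \<Omega> \<le> C2 * D" .
      moreover have "measure lebesgue (\<Omega> - ?E UNIV) \<le> measure lebesgue \<Omega>"
        using \<Omega>_lm \<Omega>_sets Es by (intro measure_mono_fmeasurable) auto
      ultimately show ?thesis by (meson order_trans)
    qed
    then obtain K where K: "measure lebesgue (\<Omega> - ?E K) \<le> C2 * D" by blast
    have "AE x in L. x \<in> ?E K \<longrightarrow> (\<forall>i. if i \<in> K then u x $ i \<ge> c else fitness m A u i x \<ge> s / 2)"
      using lowAE
    proof eventually_elim
      case (elim x)
      show ?case
      proof (intro impI allI)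
        fix i assume x: "x \<in> ?E K"
        have "- s \<le> f x $ j" for j
        proof (cases "j \<in> K")
          case True
          then have "\<bar>f x $ j\<bar> \<le> t" using x by (force simp: level_region_def)
          then show ?thesis using t by linarith
        next
          case False
          then have "f x $ j > t" using x by (force simp: level_region_def)
          then show ?thesis using t s by linarith
        qed
        then have low': "f x $ i \<le> s \<Longrightarrow> u x $ i \<ge> c" using elim by blast
        show "if i \<in> K then u x $ i \<ge> c else fitness m A u i x \<ge> s / 2"
        proof (cases "i \<in> K")
          case True
          then have "\<bar>f x $ i\<bar> \<le> t" using x by (force simp: level_region_def)
          then show ?thesis using True low' t by auto
        next
          case False
          then have "f x $ i > t" using x by (force simp: level_region_def)
          then show ?thesis using False t by (simp add: f)
        qed
      qed
    qed
    then show ?thesis using K Es unfolding D_def by blast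
  qed
  show ?thesis
    by (intro exI[of _ C2] exI[of _ "s / 2"] exI[of _ c] conjI allI impI main C2 s2 c)
qed

lemma finite_L: "finite_measure L" by (rule finite_measure_lebesgue_on[OF \<Omega>_lm])

lemma integrable_const_L: "integrable L (\<lambda>_. k :: real)"
proof -
  interpret finite_measure L by (rule finite_L)
  show ?thesis by simp
qed

lemma integral_const_L: "(LINT x|L. k) = k * measure lebesgue \<Omega>"
  using \<Omega>_sets by (simp add: measure_restrict_space)

lemma dissipation_controls:
  "\<exists>C>0. \<forall>u x. x \<in> \<Omega> \<longrightarrow> (\<forall>i. u x $ i \<ge> 0) \<longrightarrow>
     norm (u x) powr p \<le> C + C * dissipation \<Omega> m A p u x \<and>
     (\<Sum>i\<in>UNIV. \<bar>fitness m A u i x\<bar> powr p) \<le> C + C * dissipation \<Omega> m A p u x"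
proof -
  obtain C where C: "C > 0" "\<forall>a m. \<forall>u :: real ^ 'n. structural \<kappa> a m \<longrightarrow> (\<forall>i. u $ i \<ge> 0) \<longrightarrow>
      norm u powr p \<le> C * (1 + (\<Sum>i\<in>UNIV. u $ i * \<bar>residual a m u i\<bar> powr p)) \<and>
      (\<Sum>i\<in>UNIV. \<bar>residual a m u i\<bar> powr p) \<le> C * (1 + (\<Sum>i\<in>UNIV. u $ i * \<bar>residual a m u i\<bar> powr p))"
    using residual_powr_le[OF kap p1] by blast
  show ?thesis
  proof (intro exI[of _ C] conjI C(1) allI impI)
    fix u :: "real ^ 'd \<Rightarrow> real ^ 'n" and x assume x: "x \<in> \<Omega>" and u: "\<forall>i. u x $ i \<ge> 0"
    let ?s = "\<Sum>i\<in>UNIV. u x $ i * \<bar>fitness m A u i x\<bar> powr p"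
    have le: "C * (1 + ?s) \<le> C + C * dissipation \<Omega> m A p u x"
      using dissipation_ge(3)[of u x] u C(1) by (simp add: distrib_left mult_left_mono)
    have both: "norm (u x) powr p \<le> C * (1 + ?s) \<and> (\<Sum>i\<in>UNIV. \<bar>fitness m A u i x\<bar> powr p) \<le> C * (1 + ?s)"
      using C(2)[rule_format, OF struct'[OF x], of "u x"] u by (simp add: fitness_eq_residual)
    show "norm (u x) powr p \<le> C + C * dissipation \<Omega> m A p u x"
      "(\<Sum>i\<in>UNIV. \<bar>fitness m A u i x\<bar> powr p) \<le> C + C * dissipation \<Omega> m A p u x"
      using both le by linarith+
  qed
qed

text \<open>
  Otherwise there is a sequence in \<open>U\<close> with total dissipation tending to zero, each member close to a
  state \<open>K \<noteq> UNIV\<close> except on a set of small measure. By the pigeonhole principle \<open>K\<close> is constant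
  along a subsequence. On the good sets \<open>u\<^sub>k \<ge> c\<close> for \<open>k \<in> K\<close> and \<open>f\<^sub>i \<ge> s\<close> for \<open>i \<notin> K\<close>, so the dissipation, by Markov's inequality,
  forces \<open>f\<^sub>k\<close> and \<open>u\<^sub>i\<close> to zero in measure. This contradicts \<open>noseq\<close> with \<open>I = - K\<close>.
\<close>

lemma mixed_state_dissipation_lower_bound:
  assumes U: "U \<subseteq> sobolev_W1 \<Omega> p" "\<And>u. u \<in> U \<Longrightarrow> AE x in L. \<forall>i. u x $ i \<ge> 0"
    and noseq: "\<not> (\<exists>(v :: nat \<Rightarrow> real ^ 'd \<Rightarrow> real ^ 'n) (I :: 'n set).
            (\<forall>n. v n \<in> U) \<and> (\<exists>B. \<forall>n. Lp_norm \<Omega> p (v n) \<le> B) \<and> I \<noteq> {} \<and>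
            (\<forall>i\<in>I. tendsto_in_measure \<Omega> (\<lambda>n x. v n x $ i) (\<lambda>_. 0)) \<and>
            (\<forall>k. k \<notin> I \<longrightarrow> tendsto_in_measure \<Omega> (\<lambda>n. fitness m A (v n) k) (\<lambda>_. 0)))"
    and C: "C > 0" and s: "s > 0" and c: "c > 0"
  shows "\<exists>\<delta>>0. \<forall>u\<in>U. \<forall>K E. integrable L (dissipation \<Omega> m A p u) \<longrightarrow> K \<noteq> UNIV \<longrightarrow> E \<in> sets lebesgue \<longrightarrow>
     measure lebesgue (\<Omega> - E) \<le> C * (LINT x|L. dissipation \<Omega> m A p u x) \<longrightarrow>
     (AE x in L. x \<in> E \<longrightarrow> (\<forall>i. if i \<in> K then u x $ i \<ge> c else fitness m A u i x \<ge> s)) \<longrightarrow>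
     \<delta> \<le> (LINT x|L. dissipation \<Omega> m A p u x)"
proof (rule ccontr)
  let ?D = "\<lambda>u. LINT x|L. dissipation \<Omega> m A p u x"
  let ?good = "\<lambda>u K E. integrable L (dissipation \<Omega> m A p u) \<and> K \<noteq> UNIV \<and> E \<in> sets lebesgue \<and>
     measure lebesgue (\<Omega> - E) \<le> C * ?D u \<and>
     (AE x in L. x \<in> E \<longrightarrow> (\<forall>i. if i \<in> K then u x $ i \<ge> c else fitness m A u i x \<ge> s))"
  assume neg: "\<not> ?thesis"
  have "\<forall>n. \<exists>z. fst z \<in> U \<and> ?good (fst z) (fst (snd z)) (snd (snd z)) \<and> ?D (fst z) < inverse (real (Suc n))"
  proof
    fix n
    have "inverse (real (Suc n)) > 0" by simp
    with neg obtain u K E where "u \<in> U" "?good u K E" "\<not> inverse (real (Suc n)) \<le> ?D u" by blast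
    then show "\<exists>z. fst z \<in> U \<and> ?good (fst z) (fst (snd z)) (snd (snd z)) \<and> ?D (fst z) < inverse (real (Suc n))"
      by (intro exI[of _ "(u, K, E)"]) (auto simp only: fst_conv snd_conv not_le)
  qed
  from choice[OF this] obtain z where z: "\<And>n. fst (z n) \<in> U" "\<And>n. ?good (fst (z n)) (fst (snd (z n))) (snd (snd (z n)))"
    "\<And>n. ?D (fst (z n)) < inverse (real (Suc n))" by blast
  obtain n0 where inf: "infinite {n \<in> UNIV. fst (snd (z n)) = fst (snd (z n0))}"
    using pigeonhole_infinite[of "UNIV :: nat set" "\<lambda>n. fst (snd (z n))"] by auto
  define K where "K = fst (snd (z n0))"
  define r where "r = enumerate {n \<in> UNIV. fst (snd (z n)) = fst (snd (z n0))}"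
  have rmono: "strict_mono r" unfolding r_def by (rule strict_mono_enumerate[OF inf])
  have rK: "fst (snd (z (r n))) = K" for n
    using enumerate_in_set[OF inf, of n] by (simp add: r_def K_def)
  define v where "v n = fst (z (r n))" for n
  define E where "E n = snd (snd (z (r n)))" for n
  define d where "d n = ?D (v n)" for n
  have vU: "v n \<in> U" for n using z(1) by (simp add: v_def)
  have int: "integrable L (dissipation \<Omega> m A p (v n))" and KU: "K \<noteq> UNIV" and Es: "E n \<in> sets lebesgue"
    and mE: "measure lebesgue (\<Omega> - E n) \<le> C * d n"
    and AEE: "AE x in L. x \<in> E n \<longrightarrow> (\<forall>i. if i \<in> K then v n x $ i \<ge> c else fitness m A (v n) i x \<ge> s)" for n
    using z(2)[of "r n"] unfolding v_def E_def d_def rK by blast+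
  have pos: "AE x in L. \<forall>i. v n x $ i \<ge> 0" for n by (rule U(2)[OF vU])
  have Fpos: "AE x in L. dissipation \<Omega> m A p (v n) x \<ge> 0" for n
    using pos[of n] by eventually_elim (rule dissipation_ge(4), blast)
  have d0: "d n \<ge> 0" for n unfolding d_def by (rule integral_nonneg_AE[OF Fpos])
  have dn: "d n \<le> inverse (real (Suc n))" for n
  proof -
    have "n \<le> r n" by (rule seq_suble[OF rmono])
    then have "inverse (real (Suc (r n))) \<le> inverse (real (Suc n))" by (intro le_imp_inverse_le) auto
    then show ?thesis using z(3)[of "r n"] unfolding d_def v_def by linarith
  qed
  have dlim: "d \<longlonglongrightarrow> 0"
    by (rule Lim_null_comparison[OF _ LIMSEQ_inverse_real_of_nat]) (use d0 dn in \<open>auto intro!: always_eventually\<close>)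
  note sf = sobolev_facts[OF subsetD[OF U(1) vU]]
  have tend: "(\<lambda>n. measure lebesgue {x \<in> \<Omega>. \<bar>h n x - 0\<bar> > \<epsilon>}) \<longlonglongrightarrow> 0"
    if hm: "\<And>n. h n \<in> borel_measurable L" and \<eta>: "\<eta> > 0"
      and h: "\<And>n. AE x in L. \<bar>h n x\<bar> > \<epsilon> \<and> x \<in> E n \<longrightarrow> \<eta> \<le> dissipation \<Omega> m A p (v n) x" for h :: "nat \<Rightarrow> real ^ 'd \<Rightarrow> real" and \<epsilon> \<eta>
  proof (rule Lim_null_comparison)
    have "(\<lambda>n. C * d n + d n / \<eta>) \<longlonglongrightarrow> C * 0 + 0 / \<eta>" by (intro tendsto_intros dlim) (use \<eta> in auto)
    then show "(\<lambda>n. C * d n + d n / \<eta>) \<longlonglongrightarrow> 0" by simp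
    show "\<forall>\<^sub>F n in sequentially. norm (measure lebesgue {x \<in> \<Omega>. \<bar>h n x - 0\<bar> > \<epsilon>}) \<le> C * d n + d n / \<eta>"
    proof (rule always_eventually, rule allI)
      fix n
      have [measurable]: "h n \<in> borel_measurable L" by (rule hm)
      have "{x \<in> space L. \<bar>h n x\<bar> > \<epsilon>} \<in> sets L" by measurable
      then have Ss: "{x \<in> \<Omega>. \<bar>h n x\<bar> > \<epsilon>} \<in> sets lebesgue"
        using \<Omega>_sets by (subst (asm) sets_restrict_space_iff) auto
      have "measure lebesgue {x \<in> \<Omega>. \<bar>h n x\<bar> > \<epsilon>} \<le> measure lebesgue (\<Omega> - E n) + (LINT x|L. dissipation \<Omega> m A p (v n) x) / \<eta>"
      proof (rule measure_le_integral_div[OF \<Omega>_lm Ss _ Es int Fpos \<eta>])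
        show "AE x in L. x \<in> {x \<in> \<Omega>. \<bar>h n x\<bar> > \<epsilon>} \<and> x \<in> E n \<longrightarrow> \<eta> \<le> dissipation \<Omega> m A p (v n) x"
          using h[of n] by eventually_elim auto
      qed auto
      then show "norm (measure lebesgue {x \<in> \<Omega>. \<bar>h n x - 0\<bar> > \<epsilon>}) \<le> C * d n + d n / \<eta>"
        using mE[of n] by (simp add: d_def)
    qed
  qed
  have t1: "tendsto_in_measure \<Omega> (\<lambda>n x. v n x $ i) (\<lambda>_. 0)" if i: "i \<notin> K" for i
    unfolding tendsto_in_measure_def
  proof (intro allI impI)
    fix \<epsilon> :: real assume \<epsilon>: "\<epsilon> > 0"
    show "(\<lambda>n. measure lebesgue {x \<in> \<Omega>. \<epsilon> < \<bar>v n x $ i - 0\<bar>}) \<longlonglongrightarrow> 0"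
    proof (rule tend[where \<eta> = "\<epsilon> * s powr p"])
      show "AE x in L. \<bar>v n x $ i\<bar> > \<epsilon> \<and> x \<in> E n \<longrightarrow> \<epsilon> * s powr p \<le> dissipation \<Omega> m A p (v n) x" for n
        using pos[of n] AEE[of n]
      proof eventually_elim
        case (elim x)
        show ?case
        proof
          assume x: "\<bar>v n x $ i\<bar> > \<epsilon> \<and> x \<in> E n"
          then have "fitness m A (v n) i x \<ge> s" using elim(2) i by (meson)
          then have "s powr p \<le> \<bar>fitness m A (v n) i x\<bar> powr p" using s p1 by (intro powr_mono2) auto
          then have "\<epsilon> * s powr p \<le> v n x $ i * \<bar>fitness m A (v n) i x\<bar> powr p"
            using x \<epsilon> elim(1) by (intro mult_mono) (auto simp: abs_of_nonneg)
          also have "\<dots> \<le> dissipation \<Omega> m A p (v n) x" by (rule dissipation_ge(1)) (use elim(1) in blast)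
          finally show "\<epsilon> * s powr p \<le> dissipation \<Omega> m A p (v n) x" .
        qed
      qed
    qed (use sf(2) \<epsilon> s in auto)
  qed
  have t2: "tendsto_in_measure \<Omega> (\<lambda>n. fitness m A (v n) k) (\<lambda>_. 0)" if k: "k \<in> K" for k
    unfolding tendsto_in_measure_def
  proof (intro allI impI)
    fix \<epsilon> :: real assume \<epsilon>: "\<epsilon> > 0"
    show "(\<lambda>n. measure lebesgue {x \<in> \<Omega>. \<epsilon> < \<bar>fitness m A (v n) k x - 0\<bar>}) \<longlonglongrightarrow> 0"
    proof (rule tend[where \<eta> = "c * \<epsilon> powr p"])
      show "AE x in L. \<bar>fitness m A (v n) k x\<bar> > \<epsilon> \<and> x \<in> E n \<longrightarrow> c * \<epsilon> powr p \<le> dissipation \<Omega> m A p (v n) x" for n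
        using pos[of n] AEE[of n]
      proof eventually_elim
        case (elim x)
        show ?case
        proof
          assume x: "\<bar>fitness m A (v n) k x\<bar> > \<epsilon> \<and> x \<in> E n"
          then have "v n x $ k \<ge> c" using elim(2) k by (meson)
          moreover have "\<epsilon> powr p \<le> \<bar>fitness m A (v n) k x\<bar> powr p" using x \<epsilon> p1 by (intro powr_mono2) auto
          ultimately have "c * \<epsilon> powr p \<le> v n x $ k * \<bar>fitness m A (v n) k x\<bar> powr p"
            using c elim(1) by (intro mult_mono) auto
          also have "\<dots> \<le> dissipation \<Omega> m A p (v n) x" by (rule dissipation_ge(1)) (use elim(1) in blast)
          finally show "c * \<epsilon> powr p \<le> dissipation \<Omega> m A p (v n) x" .
        qed
      qed
    qed (use sf(5) \<epsilon> c in auto)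
  qed
  obtain C0 where C0: "C0 > 0" "\<And>u x. x \<in> \<Omega> \<Longrightarrow> \<forall>i. u x $ i \<ge> 0 \<Longrightarrow>
      norm (u x) powr p \<le> C0 + C0 * dissipation \<Omega> m A p u x"
    using dissipation_controls by blast
  have "Lp_norm \<Omega> p (v n) \<le> (C0 * (measure lebesgue \<Omega> + 1)) powr (1 / p)" for n
    unfolding Lp_norm_def
  proof (rule powr_mono2)
    have "(LINT x|L. norm (v n x) powr p) \<le> (LINT x|L. C0 + C0 * dissipation \<Omega> m A p (v n) x)"
    proof (rule integral_mono_AE)
      show "AE x in L. norm (v n x) powr p \<le> C0 + C0 * dissipation \<Omega> m A p (v n) x"
        using AE_L pos[of n] by eventually_elim (rule C0(2))
    qed (use sf(3) int integrable_const_L in auto)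
    also have "\<dots> = C0 * measure lebesgue \<Omega> + C0 * d n"
      using int integrable_const_L by (simp add: integral_const_L d_def del: lebesgue_integral_const)
    also have "\<dots> \<le> C0 * (measure lebesgue \<Omega> + 1)"
    proof -
      have "d n \<le> 1" using dn[of n] by (rule order_trans) (simp add: field_simps)
      then have "C0 * d n \<le> C0 * 1" using C0(1) by (intro mult_left_mono) auto
      then show ?thesis by (simp add: algebra_simps)
    qed
    finally show "(LINT x|L. norm (v n x) powr p) \<le> C0 * (measure lebesgue \<Omega> + 1)" .
  qed (use p1 in auto)
  then have b: "\<exists>B. \<forall>n. Lp_norm \<Omega> p (v n) \<le> B" by blast
  have b2: "- K \<noteq> {}" using KU by auto
  have b3: "\<forall>i\<in>- K. tendsto_in_measure \<Omega> (\<lambda>n x. v n x $ i) (\<lambda>_. 0)" using t1 by simp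
  have b4: "\<forall>k. k \<notin> - K \<longrightarrow> tendsto_in_measure \<Omega> (\<lambda>n. fitness m A (v n) k) (\<lambda>_. 0)" using t2 by simp
  have b0: "\<forall>n. v n \<in> U" using vU by blast
  show False
    by (rule notE[OF noseq], rule exI[of _ v], rule exI[of _ "- K"], intro conjI b0 b b2 b3 b4)
qed

text \<open>
  If the selected state is \<open>UNIV\<close>, the sum of the \<open>\<bar>f\<^sub>i\<bar>\<^sup>p\<close> is at most \<open>1 / c\<close> times the dissipation on
  \<open>E\<close>, and outside \<open>E\<close> at most \<open>C0\<close> plus \<open>C0\<close> times the dissipation, where the constant is integrated
  over a set of measure at most \<open>C D\<close>. For any other state \<open>D \<ge> \<delta>\<close>, so the constant is integrated
  over all of \<open>\<Omega>\<close> and absorbed by \<open>D / \<delta>\<close>.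
\<close>

lemma fitness_powr_integral_le:
  assumes U: "U \<subseteq> sobolev_W1 \<Omega> p" "\<And>u. u \<in> U \<Longrightarrow> AE x in L. \<forall>i. u x $ i \<ge> 0"
    and noseq: "\<not> (\<exists>(v :: nat \<Rightarrow> real ^ 'd \<Rightarrow> real ^ 'n) (I :: 'n set).
            (\<forall>n. v n \<in> U) \<and> (\<exists>B. \<forall>n. Lp_norm \<Omega> p (v n) \<le> B) \<and> I \<noteq> {} \<and>
            (\<forall>i\<in>I. tendsto_in_measure \<Omega> (\<lambda>n x. v n x $ i) (\<lambda>_. 0)) \<and>
            (\<forall>k. k \<notin> I \<longrightarrow> tendsto_in_measure \<Omega> (\<lambda>n. fitness m A (v n) k) (\<lambda>_. 0)))"
    and iso: "relative_isoperimetric \<Omega>"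
  shows "\<exists>C>0. \<forall>u\<in>U. (\<integral>\<^sup>+ x. ennreal (\<Sum>i\<in>UNIV. \<bar>fitness m A u i x\<bar> powr p) \<partial>L)
           \<le> ennreal C * (\<integral>\<^sup>+ x. ennreal (dissipation \<Omega> m A p u x) \<partial>L)"
proof -
  let ?D = "\<lambda>u. LINT x|L. dissipation \<Omega> m A p u x"
  let ?S = "\<lambda>u x. \<Sum>i\<in>UNIV. \<bar>fitness m A u i x\<bar> powr p"
  obtain C s c where C: "C > 0" and s: "s > 0" and c: "c > 0"
    and sel: "\<And>u. u \<in> sobolev_W1 \<Omega> p \<Longrightarrow> (AE x in L. \<forall>i. u x $ i \<ge> 0) \<Longrightarrow>
     integrable L (dissipation \<Omega> m A p u) \<Longrightarrow>
     \<exists>K E. E \<in> sets lebesgue \<and> measure lebesgue (\<Omega> - E) \<le> C * ?D u \<and>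
        (AE x in L. x \<in> E \<longrightarrow> (\<forall>i. if i \<in> K then u x $ i \<ge> c else fitness m A u i x \<ge> s))"
    using state_selection[OF iso] by blast
  from mixed_state_dissipation_lower_bound[OF U noseq C s c]
  obtain \<delta> where \<delta>mix: "\<delta> > 0 \<and> (\<forall>u\<in>U. \<forall>K E. integrable L (dissipation \<Omega> m A p u) \<longrightarrow> K \<noteq> UNIV \<longrightarrow> E \<in> sets lebesgue \<longrightarrow>
     measure lebesgue (\<Omega> - E) \<le> C * ?D u \<longrightarrow>
     (AE x in L. x \<in> E \<longrightarrow> (\<forall>i. if i \<in> K then u x $ i \<ge> c else fitness m A u i x \<ge> s)) \<longrightarrow> \<delta> \<le> ?D u)" ..
  note \<delta> = conjunct1[OF \<delta>mix] and mix = conjunct2[OF \<delta>mix, rule_format]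
  obtain C0 where C0: "C0 > 0" "\<And>u x. x \<in> \<Omega> \<Longrightarrow> \<forall>i. u x $ i \<ge> 0 \<Longrightarrow>
      ?S u x \<le> C0 + C0 * dissipation \<Omega> m A p u x"
    using dissipation_controls by blast
  define CF where "CF = 1 / c + C0 + C0 * C + C0 * measure lebesgue \<Omega> / \<delta>"
  have CF: "CF > 0" using c C0(1) C \<delta> by (simp add: CF_def add_pos_nonneg)
  have main: "(\<integral>\<^sup>+ x. ennreal (?S u x) \<partial>L) \<le> ennreal CF * (\<integral>\<^sup>+ x. ennreal (dissipation \<Omega> m A p u x) \<partial>L)" if u: "u \<in> U" for u
  proof (cases "(\<integral>\<^sup>+ x. ennreal (dissipation \<Omega> m A p u x) \<partial>L) = \<infinity>")
    case True
    then show ?thesis using CF by (simp add: ennreal_mult_top)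
  next
    case False
    have uW: "u \<in> sobolev_W1 \<Omega> p" using u U by blast
    note sf = sobolev_facts[OF uW]
    have pos: "AE x in L. \<forall>i. u x $ i \<ge> 0" by (rule U(2)[OF u])
    have Fpos: "AE x in L. dissipation \<Omega> m A p u x \<ge> 0"
      using pos by eventually_elim (rule dissipation_ge(4), blast)
    have int: "integrable L (dissipation \<Omega> m A p u)"
      using False by (intro integrableI_nonneg sf(7) Fpos) (simp add: top.not_eq_extremum)
    have nnD: "(\<integral>\<^sup>+ x. ennreal (dissipation \<Omega> m A p u x) \<partial>L) = ennreal (?D u)"
      by (rule nn_integral_eq_integral[OF int Fpos])
    have D0: "?D u \<ge> 0" by (rule integral_nonneg_AE[OF Fpos])
    have pw: "AE x in L. ?S u x \<le> C0 + C0 * dissipation \<Omega> m A p u x"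
      using AE_L pos by eventually_elim (rule C0(2))
    have bound: "(\<integral>\<^sup>+ x. ennreal (?S u x) \<partial>L) \<le> ennreal CF * ennreal (?D u)"
      if h: "integrable L h" "AE x in L. ?S u x \<le> h x" and hD: "(LINT x|L. h x) \<le> CF * ?D u" for h
    proof -
      have hpos: "AE x in L. h x \<ge> 0" using h(2)
      proof eventually_elim
        case (elim x)
        have "?S u x \<ge> 0" by (intro sum_nonneg) auto
        then show ?case using elim by linarith
      qed
      have "(\<integral>\<^sup>+ x. ennreal (?S u x) \<partial>L) \<le> (\<integral>\<^sup>+ x. ennreal (h x) \<partial>L)"
        by (rule nn_integral_mono_AE) (use h(2) in \<open>eventually_elim, simp add: ennreal_leI\<close>)
      also have "\<dots> = ennreal (LINT x|L. h x)" by (rule nn_integral_eq_integral[OF h(1) hpos])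
      also have "\<dots> \<le> ennreal (CF * ?D u)" by (rule ennreal_leI[OF hD])
      also have "\<dots> = ennreal CF * ennreal (?D u)" using CF D0 by (simp add: ennreal_mult)
      finally show ?thesis .
    qed
    obtain K E where E: "E \<in> sets lebesgue" "measure lebesgue (\<Omega> - E) \<le> C * ?D u"
      and AEE: "AE x in L. x \<in> E \<longrightarrow> (\<forall>i. if i \<in> K then u x $ i \<ge> c else fitness m A u i x \<ge> s)"
      using sel[OF uW pos int] by blast
    show ?thesis
    proof (cases "K = UNIV")
      case True
      have OE: "\<Omega> - E \<in> sets L" using E \<Omega>_sets by (subst sets_restrict_space_iff) auto
      interpret finite_measure L by (rule finite_L)
      have i0: "integrable L (indicator (\<Omega> - E) :: _ \<Rightarrow> real)"
        using OE by (intro integrable_real_indicator) (simp_all add: less_top[symmetric])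
      then have i1: "integrable L (\<lambda>x. C0 * indicator (\<Omega> - E) x)" by (rule integrable_mult_right)
      show ?thesis unfolding nnD
      proof (rule bound)
        show "integrable L (\<lambda>x. (1 / c + C0) * dissipation \<Omega> m A p u x + C0 * indicator (\<Omega> - E) x)"
          using int i0 by (intro Bochner_Integration.integrable_add integrable_mult_right)
        show "AE x in L. ?S u x \<le> (1 / c + C0) * dissipation \<Omega> m A p u x + C0 * indicator (\<Omega> - E) x"
          using AE_L pos Fpos pw AEE
        proof eventually_elim
          case (elim x)
          show ?case
          proof (cases "x \<in> E")
            case x: True
            have "c * ?S u x \<le> (\<Sum>i\<in>UNIV. u x $ i * \<bar>fitness m A u i x\<bar> powr p)"
              unfolding sum_distrib_left using elim(5) x True by (intro sum_mono mult_right_mono) auto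
            also have "\<dots> \<le> dissipation \<Omega> m A p u x" by (rule dissipation_ge(3)) (use elim(2) in blast)
            finally have "?S u x \<le> 1 / c * dissipation \<Omega> m A p u x" using c by (simp add: field_simps)
            also have "\<dots> \<le> (1 / c + C0) * dissipation \<Omega> m A p u x" using elim(3) C0(1) by (intro mult_right_mono) auto
            finally show ?thesis using x by simp
          next
            case x: False
            have "1 / c * dissipation \<Omega> m A p u x \<ge> 0" using elim(3) c by simp
            then show ?thesis using elim(1,4) x by (simp add: algebra_simps)
          qed
        qed
        have "(LINT x|L. (1 / c + C0) * dissipation \<Omega> m A p u x + C0 * indicator (\<Omega> - E) x) =
           (1 / c + C0) * ?D u + C0 * measure lebesgue (\<Omega> - E)"
        proof -
          have "(LINT x|L. indicator (\<Omega> - E) x) = measure lebesgue (\<Omega> - E)"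
            using OE \<Omega>_sets by (simp add: measure_restrict_space Int_absorb2)
          then show ?thesis using int i0 i1 by (subst Bochner_Integration.integral_add) auto
        qed
        also have "\<dots> \<le> (1 / c + C0) * ?D u + C0 * (C * ?D u)" using E(2) C0(1) by simp
        also have "\<dots> = (1 / c + C0 + C0 * C) * ?D u" by (simp add: algebra_simps)
        also have "\<dots> \<le> CF * ?D u" using D0 C0(1) \<delta> by (intro mult_right_mono) (auto simp: CF_def)
        finally show "(LINT x|L. (1 / c + C0) * dissipation \<Omega> m A p u x + C0 * indicator (\<Omega> - E) x) \<le> CF * ?D u" .
      qed
    next
      case False
      have D\<delta>: "\<delta> \<le> ?D u" by (rule mix[OF u int False E AEE])
      show ?thesis unfolding nnD
      proof (rule bound[OF _ pw])
        show "integrable L (\<lambda>x. C0 + C0 * dissipation \<Omega> m A p u x)"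
          using int by (intro Bochner_Integration.integrable_add integrable_mult_right integrable_const_L)
        have "(LINT x|L. C0 + C0 * dissipation \<Omega> m A p u x) = C0 * measure lebesgue \<Omega> + C0 * ?D u"
          using int integrable_const_L by (simp add: integral_const_L del: lebesgue_integral_const)
        also have "C0 * measure lebesgue \<Omega> \<le> C0 * measure lebesgue \<Omega> / \<delta> * ?D u"
          using mult_left_mono[OF D\<delta>, of "C0 * measure lebesgue \<Omega> / \<delta>"] C0(1) \<delta> by simp
        also have "C0 * measure lebesgue \<Omega> / \<delta> * ?D u + C0 * ?D u = (C0 * measure lebesgue \<Omega> / \<delta> + C0) * ?D u"
          by (simp add: algebra_simps)
        also have "\<dots> \<le> CF * ?D u" using D0 C0(1) c C by (intro mult_right_mono) (auto simp: CF_def)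
        finally show "(LINT x|L. C0 + C0 * dissipation \<Omega> m A p u x) \<le> CF * ?D u" by simp
      qed
    qed
  qed
  show ?thesis using CF main by blast
qed

end

theorem theorem1:
  fixes \<Omega> :: "(real ^ 'd) set"
    and m :: "real ^ 'd \<Rightarrow> real ^ 'n"
    and A :: "real ^ 'd \<Rightarrow> real ^ 'n ^ 'n"
    and U :: "(real ^ 'd \<Rightarrow> real ^ 'n) set"
    and \<kappa> p :: real
  assumes "bounded \<Omega>" and "connected \<Omega>" and "open \<Omega>" and "relative_isoperimetric \<Omega>"
    and "C1_closure \<Omega> m" and "C1_closure \<Omega> A"
    and "\<kappa> > 0" and "\<And>x. x \<in> closure \<Omega> \<Longrightarrow> structural \<kappa> (A x) (m x)"
    and "p \<ge> 1" and "U \<subseteq> sobolev_W1 \<Omega> p"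
    and "\<And>u. u \<in> U \<Longrightarrow> AE x in lebesgue_on \<Omega>. \<forall>i. u x $ i \<ge> 0"
    and "\<not> (\<exists>(v :: nat \<Rightarrow> real ^ 'd \<Rightarrow> real ^ 'n) (I :: 'n set).
            (\<forall>n. v n \<in> U) \<and> (\<exists>B. \<forall>n. Lp_norm \<Omega> p (v n) \<le> B) \<and> I \<noteq> {} \<and>
            (\<forall>i\<in>I. tendsto_in_measure \<Omega> (\<lambda>n x. v n x $ i) (\<lambda>_. 0)) \<and>
            (\<forall>k. k \<notin> I \<longrightarrow> tendsto_in_measure \<Omega> (\<lambda>n. fitness m A (v n) k) (\<lambda>_. 0)))"
  shows "\<exists>C>0. \<forall>u\<in>U.
           (\<integral>\<^sup>+ x. ennreal (\<Sum>i\<in>UNIV. \<bar>fitness m A u i x\<bar> powr p) \<partial>lebesgue_on \<Omega>)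
           \<le> ennreal C *
             (\<integral>\<^sup>+ x. ennreal (\<Sum>i\<in>UNIV. u x $ i *
                 (\<bar>fitness m A u i x\<bar> powr p
                  + norm (weak_gradient \<Omega> (fitness m A u i) x) powr p)) \<partial>lebesgue_on \<Omega>)"
proof -
  interpret competition \<Omega> m A \<kappa> p
    using assms(1,3,5-9) by unfold_locales
  show ?thesis
    using fitness_powr_integral_le[OF assms(10-12,4)] unfolding dissipation_def .
qed

end
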